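(* Let $T>0$ be arbitrary, let $\nu>0$, and let $(\mathbf{u},p)$ be a smooth solution on $[0,T]\times\overline{\Omega}$ of the time-dependent incompressible Stokes problem $$\mathbf{u}_t-\nu\Delta\mathbf{u}+\nabla p=\mathbf{f},\qquad \nabla\cdot\mathbf{u}=0 \quad\text{in } (0,T]\times\Omega,$$ with $\mathbf{u}=\mathbf{0}$ on $\partial\Omega$ and $\mathbf{u}(0,\cdot)=\mathbf{u}_0$ (with $\mathbf{u}_0$ divergence-free). Let $(\mathbf{V}_h,Q_h)$ be a conforming, inf-sup stable pair of finite element spaces such that $Q_h$ contains an $H^1$-conforming finite element subspace that is elementwise at least affine, and let $L_h$ denote Lagrange interpolation into this subspace. Let $(\mathbf{u}_h,p_h)$ with $(\mathbf{u}_h(t),p_h(t))\in \mathbf{V}_h\times Q_h$ solve the semi-discrete problem: for all $t\in(0,T]$ and all $(\mathbf{v}_h,q_h)\in\mathbf{V}_h\times Q_h$, $$(\dot{\mathbf{u}}_h,\mathbf{v}_h)+\nu(\nabla\mathbf{u}_h,\nabla\mathbf{v}_h)-(p_h,\nabla\cdot\mathbf{v}_h)+(\nabla\cdot\mathbf{u}_h,q_h)=(\mathbf{f},\mathbf{v}_h),$$ with initial value $\mathbf{u}_h(0)=\mathbb{P}_h(\mathbf{u}_0)$. Set $\mathbf{e}_h(t):=\mathbf{u}_h(t)-\mathbb{P}_h(\mathbf{u}(t))$. Then, with $e=\exp(1)$, $$\|\mathbf{e}_h(T)\|_0^2+\nu\int_0^T\|\nabla\mathbf{e}_h(t)\|_0^2\,dt\;\le\;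 e\,\nu\int_0^T\big\|\nabla\big(\mathbb{S}_h(\mathbf{u}(t))-\mathbb{P}_h(\mathbf{u}(t))\big)\big\|_0^2\,dt+e\,T\int_0^T\big\|\nabla\big(p(t)-L_hp(t)\big)\big\|_0^2\,dt .$$
   Context: $\Omega\subset\mathbb{R}^d$, $d\in\{2,3\}$, is a bounded convex (polygonal/polyhedral) domain with a shape-regular triangulation. $(\cdot,\cdot)$ is the $L^2(\Omega)$ inner product (of scalar, vector or matrix fields) and $\|\cdot\|_0$ the corresponding norm. The pressure $p$ is normalized to have zero mean. Conforming: $\mathbf{V}_h\subset H^1_0(\Omega)^d$ and $Q_h\subset L^2_0(\Omega)=\{q\in L^2(\Omega):\int_\Omega q=0\}$ are finite-dimensional (finite element) spaces. Inf-sup stable: the Babuska--Brezzi condition holds, i.e. there is $\beta>0$ with $\sup_{\mathbf{0}\neq\mathbf{v}_h\in\mathbf{V}_h}(\nabla\cdot\mathbf{v}_h,q_h)/\|\nabla\mathbf{v}_h\|_0\ge\beta\|q_h\|_0$ for all $q_h\in Q_h$. The discretely divergence-free space is $\mathbf{V}_h^0:=\{\mathbf{v}_h\in\mathbf{V}_h:(\nabla\cdot\mathbf{v}_h,q_h)=0\ \ \forall q_h\in Q_h\}$. The assumption on $Q_h$ means: for some $k\ge1$, $Q_h$ contains all zero-mean continuous functions on $\overline\Omega$ that are polynomials of degree at most $k$ on each element of the triangulation; $L_hq$ is the (nodal) Lagrange interpolant of a continuous function $q$ in the continuous piecewise polynomials of degree at most $k$. (Subtracting the mean of $L_hq$ in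 order to land in $Q_h$ does not affect $\nabla L_hq$, which is all that enters the claim.) The discrete Helmholtz--Hodge projection $\mathbb{P}_h(\mathbf{w})\in\mathbf{V}_h^0$ of $\mathbf{w}\in L^2(\Omega)^d$ is defined by $(\mathbb{P}_h(\mathbf{w}),\mathbf{v}_h)=(\mathbf{w},\mathbf{v}_h)$ for all $\mathbf{v}_h\in\mathbf{V}_h^0$. The discrete Stokes projection $\mathbb{S}_h(\mathbf{w})\in\mathbf{V}_h^0$ of $\mathbf{w}\in H^1(\Omega)^d$ is defined by $(\nabla\mathbb{S}_h(\mathbf{w}),\nabla\mathbf{v}_h)=(\nabla\mathbf{w},\nabla\mathbf{v}_h)$ for all $\mathbf{v}_h\in\mathbf{V}_h^0$. The semi-discrete velocity $t\mapsto\mathbf{u}_h(t)\in\mathbf{V}_h$ is understood to be continuous on $[0,T]$ and continuously differentiable in time, with $\dot{\mathbf{u}}_h$ its time derivative. *)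

theory Defs
  imports "HOL-Analysis.Analysis"
begin

section \<open>Classical derivatives and smoothness\<close>

definition partial :: "'n::finite \<Rightarrow> (real^'n \<Rightarrow> 'b::real_normed_vector) \<Rightarrow> real^'n \<Rightarrow> 'b" where
  "partial i f x = frechet_derivative f (at x) (axis i 1)"

definition gradient :: "(real^'n::finite \<Rightarrow> real) \<Rightarrow> real^'n \<Rightarrow> real^'n" where
  "gradient f x = (\<chi> i. partial i f x)"

definition divergence :: "(real^'n::finite \<Rightarrow> real^'n) \<Rightarrow> real^'n \<Rightarrow> real" where
  "divergence v x = (\<Sum>i\<in>UNIV. partial i v x $ i)"

definition laplacian :: "(real^'n::finite \<Rightarrow> 'b::real_normed_vector) \<Rightarrow> real^'n \<Rightarrow> 'b" where
  "laplacian f x = (\<Sum>i\<in>UNIV. partial i (partial i f) x)"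

text \<open>Meant for open \<open>U\<close>, where the derivative at a point is determined by the values on \<open>U\<close>.\<close>

primrec C_k_on :: "nat \<Rightarrow> 'a::euclidean_space set \<Rightarrow> ('a \<Rightarrow> 'b::real_normed_vector) \<Rightarrow> bool" where
  "C_k_on 0 U f \<longleftrightarrow> continuous_on U f"
| "C_k_on (Suc k) U f \<longleftrightarrow>
     (\<forall>x\<in>U. f differentiable (at x)) \<and>
     (\<forall>b\<in>Basis. C_k_on k U (\<lambda>x. frechet_derivative f (at x) b))"

definition smooth_on_open :: "'a::euclidean_space set \<Rightarrow> ('a \<Rightarrow> 'b::real_normed_vector) \<Rightarrow> bool" where
  "smooth_on_open U f \<longleftrightarrow> (\<forall>k. C_k_on k U f)"

text \<open>Smoothness on a set that need not be open, such as \<open>[0,T]\<close> times a closed domain: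
  existence of a smooth extension to an open neighbourhood.\<close>

definition smooth_on :: "'a::euclidean_space set \<Rightarrow> ('a \<Rightarrow> 'b::real_normed_vector) \<Rightarrow> bool" where
  "smooth_on S f \<longleftrightarrow> (\<exists>U g. open U \<and> S \<subseteq> U \<and> smooth_on_open U g \<and> (\<forall>x\<in>S. f x = g x))"

definition test_functions :: "(real^'n::finite) set \<Rightarrow> (real^'n \<Rightarrow> real) set" where
  "test_functions \<Omega> =
     {\<phi>. smooth_on_open UNIV \<phi> \<and> compact (closure {x. \<phi> x \<noteq> 0}) \<and> closure {x. \<phi> x \<noteq> 0} \<subseteq> \<Omega>}"


section \<open>Lebesgue and Sobolev spaces\<close>

text \<open>Elements of the function spaces are represented by functions on the whole of \<open>real^'n\<close>, of
  which only the values on \<open>\<Omega>\<close>, up to null sets, matter. The inner product on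
  \<open>real^'n^'n\<close> is the Frobenius one, so the following covers scalar, vector and matrix fields.\<close>

definition square_integrable :: "(real^'n::finite) set \<Rightarrow> (real^'n \<Rightarrow> 'b::euclidean_space) \<Rightarrow> bool" where
  "square_integrable \<Omega> f \<longleftrightarrow>
     f \<in> borel_measurable (lebesgue_on \<Omega>) \<and> integrable (lebesgue_on \<Omega>) (\<lambda>x. (norm (f x))\<^sup>2)"

definition ae_eq :: "(real^'n::finite) set \<Rightarrow> (real^'n \<Rightarrow> 'b) \<Rightarrow> (real^'n \<Rightarrow> 'b) \<Rightarrow> bool" where
  "ae_eq \<Omega> f g \<longleftrightarrow> (AE x in lebesgue_on \<Omega>. f x = g x)"

definition l2_inner :: "(real^'n::finite) set \<Rightarrow> (real^'n \<Rightarrow> 'b::euclidean_space) \<Rightarrow> (real^'n \<Rightarrow> 'b) \<Rightarrow> real" where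
  "l2_inner \<Omega> f g = (LINT x|lebesgue_on \<Omega>. f x \<bullet> g x)"

definition l2_norm :: "(real^'n::finite) set \<Rightarrow> (real^'n \<Rightarrow> 'b::euclidean_space) \<Rightarrow> real" where
  "l2_norm \<Omega> f = sqrt (l2_inner \<Omega> f f)"

definition L2_0 :: "(real^'n::finite) set \<Rightarrow> (real^'n \<Rightarrow> real) set" where
  "L2_0 \<Omega> = {q. square_integrable \<Omega> q \<and> (LINT x|lebesgue_on \<Omega>. q x) = 0}"

definition is_weak_partial ::
    "(real^'n::finite) set \<Rightarrow> 'n \<Rightarrow> (real^'n \<Rightarrow> real) \<Rightarrow> (real^'n \<Rightarrow> real) \<Rightarrow> bool" where
  "is_weak_partial \<Omega> i f g \<longleftrightarrow>
     square_integrable \<Omega> g \<and>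
     (\<forall>\<phi>\<in>test_functions \<Omega>.
        (LINT x|lebesgue_on \<Omega>. f x * partial i \<phi> x) = - (LINT x|lebesgue_on \<Omega>. g x * \<phi> x))"

definition H1 :: "(real^'n::finite) set \<Rightarrow> (real^'n \<Rightarrow> real) set" where
  "H1 \<Omega> = {f. square_integrable \<Omega> f \<and> (\<forall>i. \<exists>g. is_weak_partial \<Omega> i f g)}"

text \<open>Weak derivatives are unique up to null sets; the choice of a representative does not affect
  the integrals in which they occur.\<close>

definition weak_partial :: "(real^'n::finite) set \<Rightarrow> 'n \<Rightarrow> (real^'n \<Rightarrow> real) \<Rightarrow> real^'n \<Rightarrow> real" where
  "weak_partial \<Omega> i f = (SOME g. is_weak_partial \<Omega> i f g)"

definition weak_grad :: "(real^'n::finite) set \<Rightarrow> (real^'n \<Rightarrow> real) \<Rightarrow> real^'n \<Rightarrow> real^'n" where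
  "weak_grad \<Omega> f x = (\<chi> i. weak_partial \<Omega> i f x)"

definition weak_Grad :: "(real^'n::finite) set \<Rightarrow> (real^'n \<Rightarrow> real^'n) \<Rightarrow> real^'n \<Rightarrow> real^'n^'n" where
  "weak_Grad \<Omega> v x = (\<chi> i. weak_grad \<Omega> (\<lambda>y. v y $ i) x)"

definition weak_div :: "(real^'n::finite) set \<Rightarrow> (real^'n \<Rightarrow> real^'n) \<Rightarrow> real^'n \<Rightarrow> real" where
  "weak_div \<Omega> v x = (\<Sum>i\<in>UNIV. weak_partial \<Omega> i (\<lambda>y. v y $ i) x)"

text \<open>The closure of the test functions in the \<open>H1\<close> norm.\<close>

definition H1_0 :: "(real^'n::finite) set \<Rightarrow> (real^'n \<Rightarrow> real) set" where
  "H1_0 \<Omega> = {f \<in> H1 \<Omega>. \<forall>\<epsilon>>0. \<exists>\<phi>\<in>test_functions \<Omega>.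
      (l2_norm \<Omega> (\<lambda>x. f x - \<phi> x))\<^sup>2 + (l2_norm \<Omega> (weak_grad \<Omega> (\<lambda>x. f x - \<phi> x)))\<^sup>2 < \<epsilon>\<^sup>2}"

definition H1_0_vec :: "(real^'n::finite) set \<Rightarrow> (real^'n \<Rightarrow> real^'n) set" where
  "H1_0_vec \<Omega> = {v. \<forall>i. (\<lambda>x. v x $ i) \<in> H1_0 \<Omega>}"

text \<open>Continuity and differentiability of a time-dependent field with respect to the \<open>L2\<close> norm.
  For fields with values in a finite-dimensional space of (classes of) functions this does not
  depend on the choice of the norm.\<close>

definition l2_continuous_on ::
    "(real^'n::finite) set \<Rightarrow> real set \<Rightarrow> (real \<Rightarrow> real^'n \<Rightarrow> 'b::euclidean_space) \<Rightarrow> bool" where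
  "l2_continuous_on \<Omega> I w \<longleftrightarrow>
     (\<forall>t\<in>I. ((\<lambda>s. l2_norm \<Omega> (\<lambda>x. w s x - w t x)) \<longlongrightarrow> 0) (at t within I))"

definition l2_has_time_derivative ::
    "(real^'n::finite) set \<Rightarrow> (real \<Rightarrow> real^'n \<Rightarrow> 'b::euclidean_space) \<Rightarrow> (real^'n \<Rightarrow> 'b) \<Rightarrow> real filter
      \<Rightarrow> real \<Rightarrow> bool" where
  "l2_has_time_derivative \<Omega> w w' F t \<longleftrightarrow>
     ((\<lambda>s. l2_norm \<Omega> (\<lambda>x. (w s x - w t x) /\<^sub>R (s - t) - w' x)) \<longlongrightarrow> 0) F"


section \<open>Meshes and Lagrange interpolation\<close>

definition convex_polytopal_domain :: "'a::euclidean_space set \<Rightarrow> bool" where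
  "convex_polytopal_domain \<Omega> \<longleftrightarrow>
     open \<Omega> \<and> \<Omega> \<noteq> {} \<and> bounded \<Omega> \<and> convex \<Omega> \<and> polytope (closure \<Omega>)"

definition triangulation_of :: "'a::euclidean_space set \<Rightarrow> 'a set set \<Rightarrow> bool" where
  "triangulation_of \<Omega> \<T> \<longleftrightarrow>
     triangulation \<T> \<and> (\<forall>K\<in>\<T>. int DIM('a) simplex K) \<and> \<Union>\<T> = closure \<Omega>"

definition shape_regular :: "real \<Rightarrow> 'a::euclidean_space set set \<Rightarrow> bool" where
  "shape_regular \<sigma> \<T> \<longleftrightarrow> (\<forall>K\<in>\<T>. \<exists>x r. 0 < r \<and> cball x r \<subseteq> K \<and> diameter K \<le> \<sigma> * r)"

definition poly_deg_le :: "nat \<Rightarrow> (real^'n::finite \<Rightarrow> real) \<Rightarrow> bool" where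
  "poly_deg_le k P \<longleftrightarrow>
     (\<exists>c. \<forall>x. P x = (\<Sum>\<alpha> | (\<Sum>i\<in>UNIV. \<alpha> i) \<le> k. c \<alpha> * (\<Prod>i\<in>UNIV. (x $ i) ^ \<alpha> i)))"

definition lagrange_space :: "(real^'n::finite) set set \<Rightarrow> nat \<Rightarrow> (real^'n \<Rightarrow> real) set" where
  "lagrange_space \<T> k =
     {w. continuous_on (\<Union>\<T>) w \<and> (\<forall>K\<in>\<T>. \<exists>P. poly_deg_le k P \<and> (\<forall>x\<in>K. w x = P x))}"

text \<open>The points of \<open>K\<close> all of whose barycentric coordinates are multiples of \<open>1/k\<close>.\<close>

definition simplex_nodes :: "nat \<Rightarrow> 'a::euclidean_space set \<Rightarrow> 'a set" where
  "simplex_nodes k K =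
     {(\<Sum>a | a extreme_point_of K. (real (m a) / real k) *\<^sub>R a) | m :: 'a \<Rightarrow> nat.
        (\<Sum>a | a extreme_point_of K. m a) = k}"

definition lagrange_nodes :: "'a::euclidean_space set set \<Rightarrow> nat \<Rightarrow> 'a set" where
  "lagrange_nodes \<T> k = (\<Union>K\<in>\<T>. simplex_nodes k K)"

text \<open>The nodal basis function is unique on \<open>\<Union>\<T>\<close>, and unspecified elsewhere.\<close>

definition nodal_basis :: "(real^'n::finite) set set \<Rightarrow> nat \<Rightarrow> real^'n \<Rightarrow> real^'n \<Rightarrow> real" where
  "nodal_basis \<T> k a =
     (SOME \<phi>. \<phi> \<in> lagrange_space \<T> k \<and>
              (\<forall>b\<in>lagrange_nodes \<T> k. \<phi> b = (if b = a then 1 else 0)))"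

definition lagrange_interp ::
    "(real^'n::finite) set set \<Rightarrow> nat \<Rightarrow> (real^'n \<Rightarrow> real) \<Rightarrow> real^'n \<Rightarrow> real" where
  "lagrange_interp \<T> k q x = (\<Sum>a\<in>lagrange_nodes \<T> k. q a * nodal_basis \<T> k a x)"


section \<open>Discrete spaces and projections\<close>

text \<open>A linear space of representatives that is finite-dimensional modulo equality almost
  everywhere. It may contain one or several representatives of each class.\<close>

definition finite_dim_function_space ::
    "(real^'n::finite) set \<Rightarrow> (real^'n \<Rightarrow> 'b::euclidean_space) set \<Rightarrow> bool" where
  "finite_dim_function_space \<Omega> V \<longleftrightarrow>
     (\<lambda>x. 0) \<in> V \<and>
     (\<forall>v\<in>V. \<forall>w\<in>V. (\<lambda>x. v x + w x) \<in> V) \<and>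
     (\<forall>c. \<forall>v\<in>V. (\<lambda>x. c *\<^sub>R v x) \<in> V) \<and>
     (\<exists>B. finite B \<and> B \<subseteq> V \<and> (\<forall>v\<in>V. \<exists>c. ae_eq \<Omega> v (\<lambda>x. \<Sum>b\<in>B. c b *\<^sub>R b x)))"

definition conforming_pair ::
    "(real^'n::finite) set \<Rightarrow> (real^'n \<Rightarrow> real^'n) set \<Rightarrow> (real^'n \<Rightarrow> real) set \<Rightarrow> bool" where
  "conforming_pair \<Omega> V Q \<longleftrightarrow>
     finite_dim_function_space \<Omega> V \<and> V \<subseteq> H1_0_vec \<Omega> \<and>
     finite_dim_function_space \<Omega> Q \<and> Q \<subseteq> L2_0 \<Omega>"

text \<open>The supremum is taken in the extended reals, so that it is meaningful without a proof that
  the set is nonempty and bounded.\<close>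

definition inf_sup_stable ::
    "(real^'n::finite) set \<Rightarrow> (real^'n \<Rightarrow> real^'n) set \<Rightarrow> (real^'n \<Rightarrow> real) set \<Rightarrow> bool" where
  "inf_sup_stable \<Omega> V Q \<longleftrightarrow>
     (\<exists>\<beta>>0. \<forall>q\<in>Q.
        (SUP v\<in>{v\<in>V. \<not> ae_eq \<Omega> v (\<lambda>x. 0)}.
           ereal (l2_inner \<Omega> (weak_div \<Omega> v) q / l2_norm \<Omega> (weak_Grad \<Omega> v)))
        \<ge> ereal (\<beta> * l2_norm \<Omega> q))"

definition contains_lagrange_space ::
    "(real^'n::finite) set \<Rightarrow> (real^'n \<Rightarrow> real) set \<Rightarrow> (real^'n) set set \<Rightarrow> nat \<Rightarrow> bool" where
  "contains_lagrange_space \<Omega> Q \<T> k \<longleftrightarrow>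
     (\<forall>w\<in>lagrange_space \<T> k. (LINT x|lebesgue_on \<Omega>. w x) = 0 \<longrightarrow> (\<exists>q\<in>Q. ae_eq \<Omega> q w))"

definition discretely_div_free ::
    "(real^'n::finite) set \<Rightarrow> (real^'n \<Rightarrow> real^'n) set \<Rightarrow> (real^'n \<Rightarrow> real) set \<Rightarrow> (real^'n \<Rightarrow> real^'n) set" where
  "discretely_div_free \<Omega> V Q = {v \<in> V. \<forall>q\<in>Q. l2_inner \<Omega> (weak_div \<Omega> v) q = 0}"

text \<open>On a conforming pair, both projections exist for all fields in \<open>L2\<close> and \<open>H1\<close>,
  respectively, and are unique up to null sets.\<close>

definition helmholtz_proj ::
    "(real^'n::finite) set \<Rightarrow> (real^'n \<Rightarrow> real^'n) set \<Rightarrow> (real^'n \<Rightarrow> real) set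
      \<Rightarrow> (real^'n \<Rightarrow> real^'n) \<Rightarrow> real^'n \<Rightarrow> real^'n" where
  "helmholtz_proj \<Omega> V Q w =
     (SOME z. z \<in> discretely_div_free \<Omega> V Q \<and>
        (\<forall>v\<in>discretely_div_free \<Omega> V Q. l2_inner \<Omega> z v = l2_inner \<Omega> w v))"

definition stokes_proj ::
    "(real^'n::finite) set \<Rightarrow> (real^'n \<Rightarrow> real^'n) set \<Rightarrow> (real^'n \<Rightarrow> real) set
      \<Rightarrow> (real^'n \<Rightarrow> real^'n) \<Rightarrow> real^'n \<Rightarrow> real^'n" where
  "stokes_proj \<Omega> V Q w =
     (SOME z. z \<in> discretely_div_free \<Omega> V Q \<and>
        (\<forall>v\<in>discretely_div_free \<Omega> V Q.
           l2_inner \<Omega> (weak_Grad \<Omega> z) (weak_Grad \<Omega> v) = l2_inner \<Omega> (weak_Grad \<Omega> w) (weak_Grad \<Omega> v)))"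


section \<open>The continuous and the semi-discrete Stokes problem\<close>

definition smooth_stokes_solution ::
    "(real^'n::finite) set \<Rightarrow> real \<Rightarrow> real \<Rightarrow> (real \<Rightarrow> real^'n \<Rightarrow> real^'n) \<Rightarrow> (real^'n \<Rightarrow> real^'n)
      \<Rightarrow> (real \<Rightarrow> real^'n \<Rightarrow> real^'n) \<Rightarrow> (real \<Rightarrow> real^'n \<Rightarrow> real) \<Rightarrow> bool" where
  "smooth_stokes_solution \<Omega> T \<nu> f u\<^sub>0 u p \<longleftrightarrow>
     smooth_on ({0..T} \<times> closure \<Omega>) (\<lambda>(t, x). u t x) \<and>
     smooth_on ({0..T} \<times> closure \<Omega>) (\<lambda>(t, x). p t x) \<and>
     (\<forall>t\<in>{0<..T}. \<forall>x\<in>\<Omega>.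
        vector_derivative (\<lambda>s. u s x) (at t within {0..T}) - \<nu> *\<^sub>R laplacian (u t) x + gradient (p t) x
          = f t x \<and>
        divergence (u t) x = 0) \<and>
     (\<forall>t\<in>{0..T}. \<forall>x\<in>frontier \<Omega>. u t x = 0) \<and>
     (\<forall>x\<in>closure \<Omega>. u 0 x = u\<^sub>0 x) \<and>
     (\<forall>x\<in>\<Omega>. divergence u\<^sub>0 x = 0) \<and>
     (\<forall>t\<in>{0..T}. (LINT x|lebesgue_on \<Omega>. p t x) = 0)"

definition semidiscrete_stokes_solution ::
    "(real^'n::finite) set \<Rightarrow> (real^'n \<Rightarrow> real^'n) set \<Rightarrow> (real^'n \<Rightarrow> real) set \<Rightarrow> real \<Rightarrow> real
      \<Rightarrow> (real \<Rightarrow> real^'n \<Rightarrow> real^'n) \<Rightarrow> (real^'n \<Rightarrow> real^'n)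
      \<Rightarrow> (real \<Rightarrow> real^'n \<Rightarrow> real^'n) \<Rightarrow> (real \<Rightarrow> real^'n \<Rightarrow> real^'n) \<Rightarrow> (real \<Rightarrow> real^'n \<Rightarrow> real) \<Rightarrow> bool" where
  "semidiscrete_stokes_solution \<Omega> V Q T \<nu> f u\<^sub>0 u\<^sub>h u\<^sub>h' p\<^sub>h \<longleftrightarrow>
     (\<forall>t\<in>{0..T}. u\<^sub>h t \<in> V) \<and> l2_continuous_on \<Omega> {0..T} u\<^sub>h \<and>
     (\<forall>t\<in>{0<..T}. u\<^sub>h' t \<in> V \<and> l2_has_time_derivative \<Omega> u\<^sub>h (u\<^sub>h' t) (at t within {0..T}) t) \<and>
     l2_continuous_on \<Omega> {0<..T} u\<^sub>h' \<and>
     (\<forall>t\<in>{0<..T}. p\<^sub>h t \<in> Q) \<and>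
     (\<forall>t\<in>{0<..T}. \<forall>v\<in>V. \<forall>q\<in>Q.
        l2_inner \<Omega> (u\<^sub>h' t) v + \<nu> * l2_inner \<Omega> (weak_Grad \<Omega> (u\<^sub>h t)) (weak_Grad \<Omega> v)
          - l2_inner \<Omega> (p\<^sub>h t) (weak_div \<Omega> v) + l2_inner \<Omega> (weak_div \<Omega> (u\<^sub>h t)) q
        = l2_inner \<Omega> (f t) v) \<and>
     ae_eq \<Omega> (u\<^sub>h 0) (helmholtz_proj \<Omega> V Q u\<^sub>0)"

end

theory Submission
  imports Defs
begin

text \<open>The discrete error \<open>e = u\<^sub>h - P\<^sub>h u\<close> is discretely divergence free. Testing both problems with
  such fields removes \<open>p\<^sub>h\<close>, lets the gradient of the continuous piecewise polynomial \<open>L\<^sub>h p\<close> be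
  subtracted from that of \<open>p\<close> at no cost, and replaces \<open>u\<close> by \<open>S\<^sub>h u\<close> in the viscous term and by
  \<open>P\<^sub>h u\<close> in the time derivative. With \<open>e\<close> as test function and Young's inequality (with weight \<open>T\<close>
  for the pressure term), \<open>E = \<parallel>e\<parallel>\<^sup>2\<close> satisfies
  \<open>E' + \<nu> \<parallel>\<nabla>e\<parallel>\<^sup>2 \<le> \<nu> \<parallel>\<nabla>(S\<^sub>h u - P\<^sub>h u)\<parallel>\<^sup>2 + T \<parallel>\<nabla>(p - L\<^sub>h p)\<parallel>\<^sup>2 + E / T\<close>,
  and \<open>E(0) = 0\<close>; the factor \<open>exp 1\<close> comes from Gronwall's inequality on \<open>[0,T]\<close>.

  Weak gradients are unspecified representatives, so they have to be shown to exist and to be unique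
  almost everywhere. Existence for Lipschitz functions follows from the translation invariance of the
  integral applied to difference quotients; uniqueness from smooth bump functions converging to the
  indicators of boxes.\<close>

section \<open>Orthonormal bases modulo null vectors\<close>

text \<open>Projections and weak gradients are chosen independently at each time, so regularity in
  time cannot be read off the representatives. Therefore the terms that live in the discrete space
  are rewritten through finitely many scalar coefficients in two bases of the discretely
  divergence-free space, one orthonormal for the L2 product and one for the Dirichlet form. For a
  basis field \<open>v\<close> the coefficient \<open>(P_h u, v)\<close> equals
  \<open>(u, v)\<close>, which is differentiable in time; hence \<open>E\<close> can be
  differentiated and the integrands are continuous, so that the integrals in the claim are genuine
  ones. On representatives both forms are only semidefinite, and linear algebra is done modulo null
  vectors. A second obstacle is that \<open>L_h p\<close> is merely Lipschitz across element
  boundaries. Weak derivatives of Lipschitz functions are obtained where difference quotients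
  converge almost everywhere, and convexity of \<Omega> turns the elementwise bounds into a global
  one. The weight \<open>T\<close> in Young's inequality is the length of the time interval, which
  makes the exponent in Gronwall's inequality \<open>T / T = 1\<close>.\<close>

locale semi_inner_space =
  fixes V :: "('a \<Rightarrow> 'b::real_vector) set" and ip :: "('a \<Rightarrow> 'b) \<Rightarrow> ('a \<Rightarrow> 'b) \<Rightarrow> real"
  assumes zero_mem: "(\<lambda>x. 0) \<in> V"
    and add_mem: "v \<in> V \<Longrightarrow> w \<in> V \<Longrightarrow> (\<lambda>x. v x + w x) \<in> V"
    and scale_mem: "v \<in> V \<Longrightarrow> (\<lambda>x. c *\<^sub>R v x) \<in> V"
    and ip_add_left: "u \<in> V \<Longrightarrow> v \<in> V \<Longrightarrow> w \<in> V \<Longrightarrow> ip (\<lambda>x. u x + v x) w = ip u w + ip v w"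
    and ip_scale_left: "v \<in> V \<Longrightarrow> w \<in> V \<Longrightarrow> ip (\<lambda>x. c *\<^sub>R v x) w = c * ip v w"
    and ip_commute: "v \<in> V \<Longrightarrow> w \<in> V \<Longrightarrow> ip v w = ip w v"
    and ip_nonneg: "v \<in> V \<Longrightarrow> 0 \<le> ip v v"
begin

abbreviation sqn :: "('a \<Rightarrow> 'b) \<Rightarrow> real" where
  "sqn v \<equiv> ip v v"

lemma diff_mem:
  assumes "v \<in> V" "w \<in> V" shows "(\<lambda>x. v x - w x) \<in> V"
  using add_mem[OF assms(1) scale_mem[OF assms(2), of "-1"]] by simp

lemma sum_mem: "(\<And>i. i \<in> I \<Longrightarrow> f i \<in> V) \<Longrightarrow> (\<lambda>x. \<Sum>i\<in>I. c i *\<^sub>R f i x) \<in> V"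
proof (induction I rule: infinite_finite_induct)
  case (insert i I)
  then show ?case using add_mem[OF scale_mem[of "f i" "c i"], of "\<lambda>x. \<Sum>i\<in>I. c i *\<^sub>R f i x"] by simp
qed (simp_all add: zero_mem)

lemma ip_diff_left:
  assumes "u \<in> V" "v \<in> V" "w \<in> V"
  shows "ip (\<lambda>x. u x - v x) w = ip u w - ip v w"
  using ip_add_left[OF assms(1) scale_mem[OF assms(2), of "-1"] assms(3)]
    ip_scale_left[OF assms(2,3), of "-1"] by simp

lemma ip_zero_left: "w \<in> V \<Longrightarrow> ip (\<lambda>x. 0) w = 0"
  using ip_scale_left[of w w 0] by simp

lemma ip_sum_left:
  assumes "\<And>i. i \<in> I \<Longrightarrow> f i \<in> V" "w \<in> V"
  shows "ip (\<lambda>x. \<Sum>i\<in>I. c i *\<^sub>R f i x) w = (\<Sum>i\<in>I. c i * ip (f i) w)"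
  using assms(1)
proof (induction I rule: infinite_finite_induct)
  case (insert i I)
  have "ip (\<lambda>x. c i *\<^sub>R f i x + (\<Sum>i\<in>I. c i *\<^sub>R f i x)) w
      = ip (\<lambda>x. c i *\<^sub>R f i x) w + ip (\<lambda>x. \<Sum>i\<in>I. c i *\<^sub>R f i x) w"
    using insert.prems assms(2) by (intro ip_add_left scale_mem sum_mem) auto
  with insert assms(2) show ?case by (simp add: ip_scale_left)
qed (simp_all add: ip_zero_left assms(2))

lemma ip_add_right:
  "u \<in> V \<Longrightarrow> v \<in> V \<Longrightarrow> w \<in> V \<Longrightarrow> ip w (\<lambda>x. u x + v x) = ip w u + ip w v"
  by (simp add: ip_commute[of w] add_mem ip_add_left)

lemma ip_diff_right:
  "u \<in> V \<Longrightarrow> v \<in> V \<Longrightarrow> w \<in> V \<Longrightarrow> ip w (\<lambda>x. u x - v x) = ip w u - ip w v"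
  by (simp add: ip_commute[of w] diff_mem ip_diff_left)

lemma ip_scale_right:
  "v \<in> V \<Longrightarrow> w \<in> V \<Longrightarrow> ip w (\<lambda>x. c *\<^sub>R v x) = c * ip w v"
  by (simp add: ip_commute[of w] scale_mem ip_scale_left)

lemma ip_sum_right:
  "(\<And>i. i \<in> I \<Longrightarrow> f i \<in> V) \<Longrightarrow> w \<in> V \<Longrightarrow>
    ip w (\<lambda>x. \<Sum>i\<in>I. c i *\<^sub>R f i x) = (\<Sum>i\<in>I. c i * ip w (f i))"
  by (simp add: ip_commute[of w] sum_mem ip_sum_left)

text \<open>This expansion is the common source of Cauchy-Schwarz, of both uses of Young's
  inequality and of the fact that combinations of null vectors are null.\<close>

lemma ip_scale_add_self:
  assumes "v \<in> V" "w \<in> V"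
  shows "sqn (\<lambda>x. v x + c *\<^sub>R w x) = sqn v + 2 * c * ip v w + c\<^sup>2 * sqn w"
  using assms by (simp add: ip_add_left ip_add_right ip_scale_left ip_scale_right add_mem scale_mem
      ip_commute[of w v] power2_eq_square algebra_simps)

lemma Cauchy_Schwarz:
  assumes "v \<in> V" "w \<in> V"
  shows "(ip v w)\<^sup>2 \<le> sqn v * sqn w"
proof -
  have ineq: "0 \<le> sqn v + 2 * c * ip v w + c\<^sup>2 * sqn w" for c
    using ip_scale_add_self[OF assms, of c, symmetric] assms
    by (simp add: ip_nonneg add_mem scale_mem)
  show ?thesis
  proof (cases "sqn w = 0")
    case True
    have "ip v w = 0"
    proof (rule ccontr)
      assume "ip v w \<noteq> 0"
      \<comment> \<open>With \<open>sqn w = 0\<close> the quadratic in \<open>c\<close> is affine;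
        at this \<open>c\<close> it takes the value \<open>-1\<close>.\<close>
      with ineq[of "- (sqn v + 1) / (2 * ip v w)"] True show False
        by (simp add: field_simps)
    qed
    with True show ?thesis by simp
  next
    case False
    then have "sqn w > 0" using ip_nonneg[OF assms(2)] by linarith
    \<comment> \<open>The minimiser of the quadratic in \<open>c\<close>.\<close>
    with ineq[of "- ip v w / sqn w"] show ?thesis
      by (simp add: field_simps power2_eq_square)
  qed
qed

text \<open>By Cauchy-Schwarz a vector of zero seminorm is invisible to the form, so computations
  modulo null vectors are possible without forming a quotient space.\<close>

lemma ip_null_left:
  assumes "v \<in> V" "w \<in> V" "sqn v = 0" shows "ip v w = 0"
  using Cauchy_Schwarz[OF assms(1,2)] assms(3) by simp

lemma ip_null_right:
  assumes "v \<in> V" "w \<in> V" "sqn v = 0" shows "ip w v = 0"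
  using ip_null_left[OF assms] ip_commute assms by simp

lemma ip_abs_le: "v \<in> V \<Longrightarrow> w \<in> V \<Longrightarrow> \<bar>ip v w\<bar> \<le> sqrt (sqn v) * sqrt (sqn w)"
  using Cauchy_Schwarz[of v w] by (metis real_sqrt_abs real_sqrt_le_iff real_sqrt_mult)

section \<open>Subspaces, spans and orthonormal bases up to null vectors\<close>

definition subsp :: "('a \<Rightarrow> 'b) set \<Rightarrow> bool" where
  "subsp W \<longleftrightarrow> W \<subseteq> V \<and> (\<lambda>x. 0) \<in> W \<and> (\<forall>v\<in>W. \<forall>w\<in>W. (\<lambda>x. v x + w x) \<in> W) \<and>
     (\<forall>c. \<forall>v\<in>W. (\<lambda>x. c *\<^sub>R v x) \<in> W)"

lemma subsp_zero: "subsp W \<Longrightarrow> (\<lambda>x. 0) \<in> W"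
  by (simp add: subsp_def)

lemma subsp_add: "subsp W \<Longrightarrow> v \<in> W \<Longrightarrow> w \<in> W \<Longrightarrow> (\<lambda>x. v x + w x) \<in> W"
  by (simp add: subsp_def)

lemma subsp_scale: "subsp W \<Longrightarrow> v \<in> W \<Longrightarrow> (\<lambda>x. c *\<^sub>R v x) \<in> W"
  by (simp add: subsp_def)

lemma subsp_sum:
  assumes "subsp W" "\<And>i. i \<in> I \<Longrightarrow> f i \<in> W"
  shows "(\<lambda>x. \<Sum>i\<in>I. c i *\<^sub>R f i x) \<in> W"
  using assms(2)
proof (induction I rule: infinite_finite_induct)
  case (insert i I)
  then show ?case
    using subsp_add[OF assms(1) subsp_scale[OF assms(1), of "f i" "c i"], of "\<lambda>x. \<Sum>i\<in>I. c i *\<^sub>R f i x"]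
    by simp
qed (simp_all add: subsp_zero[OF assms(1)])

lemma subsp_diff:
  assumes "subsp W" "v \<in> W" "w \<in> W" shows "(\<lambda>x. v x - w x) \<in> W"
  using subsp_add[OF assms(1,2) subsp_scale[OF assms(1,3), of "-1"]] by simp

text \<open>This is finite dimension modulo almost everywhere equality in abstract form. The
  generators \<open>B\<close> may lie outside the subspace that they are to span, as for generators
  of \<open>V\<close> and its discretely divergence-free part.\<close>

definition null_span :: "('a \<Rightarrow> 'b) set \<Rightarrow> ('a \<Rightarrow> 'b) set" where
  "null_span B = {v \<in> V. \<exists>c. sqn (\<lambda>x. v x - (\<Sum>b\<in>B. c b *\<^sub>R b x)) = 0}"

text \<open>The members of \<open>E\<close> lie in \<open>W\<close> itself, but the expansion of a
  vector of \<open>W\<close> is exact only up to a null vector.\<close>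

definition orthonormal_basis :: "('a \<Rightarrow> 'b) set \<Rightarrow> ('a \<Rightarrow> 'b) set \<Rightarrow> bool" where
  "orthonormal_basis W E \<longleftrightarrow> finite E \<and> E \<subseteq> W \<and>
     (\<forall>e\<in>E. \<forall>e'\<in>E. ip e e' = (if e = e' then 1 else 0)) \<and>
     (\<forall>v\<in>W. sqn (\<lambda>x. v x - (\<Sum>e\<in>E. ip v e *\<^sub>R e x)) = 0)"

lemma subsp_null_span:
  assumes "finite B" "B \<subseteq> V" "subsp W"
  shows "subsp (W \<inter> null_span B)"
proof -
  have WV: "W \<subseteq> V" using assms(3) by (simp add: subsp_def)
  have sumV: "(\<lambda>x. \<Sum>b\<in>B. c b *\<^sub>R b x) \<in> V" for c
    using sum_mem[of B "\<lambda>b. b" c] assms(2) by auto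
  have "(\<lambda>x. v x + w x) \<in> null_span B" if v: "v \<in> null_span B" and w: "w \<in> null_span B" for v w
  proof -
    obtain c d where
      c: "sqn (\<lambda>x. v x - (\<Sum>b\<in>B. c b *\<^sub>R b x)) = 0" and
      d: "sqn (\<lambda>x. w x - (\<Sum>b\<in>B. d b *\<^sub>R b x)) = 0"
      using v w by (auto simp: null_span_def)
    have V: "v \<in> V" "w \<in> V" using v w by (auto simp: null_span_def)
    let ?a = "\<lambda>x. v x - (\<Sum>b\<in>B. c b *\<^sub>R b x)" and ?b = "\<lambda>x. w x - (\<Sum>b\<in>B. d b *\<^sub>R b x)"
    have m: "?a \<in> V" "?b \<in> V" using V sumV diff_mem by auto
    have "sqn (\<lambda>x. ?a x + 1 *\<^sub>R ?b x) = 0"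
      unfolding ip_scale_add_self[OF m] using ip_null_left[OF m] c d by simp
    also have "(\<lambda>x. ?a x + 1 *\<^sub>R ?b x) = (\<lambda>x. (v x + w x) - (\<Sum>b\<in>B. (c b + d b) *\<^sub>R b x))"
      by (auto simp: sum.distrib scaleR_add_left)
    finally show ?thesis using add_mem[OF V] by (auto simp: null_span_def intro!: exI[of _ "\<lambda>b. c b + d b"])
  qed
  moreover have "(\<lambda>x. a *\<^sub>R v x) \<in> null_span B" if v: "v \<in> null_span B" for v a
  proof -
    obtain c where
      c: "sqn (\<lambda>x. v x - (\<Sum>b\<in>B. c b *\<^sub>R b x)) = 0"
      using v by (auto simp: null_span_def)
    have V: "v \<in> V" using v by (auto simp: null_span_def)
    let ?a = "\<lambda>x. v x - (\<Sum>b\<in>B. c b *\<^sub>R b x)"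
    have m: "?a \<in> V" using V sumV diff_mem by auto
    have "sqn (\<lambda>x. a *\<^sub>R ?a x) = 0"
      using m c by (simp add: ip_scale_left ip_scale_right scale_mem)
    also have "(\<lambda>x. a *\<^sub>R ?a x) = (\<lambda>x. a *\<^sub>R v x - (\<Sum>b\<in>B. (a * c b) *\<^sub>R b x))"
      by (auto simp: scaleR_sum_right scaleR_diff_right)
    finally show ?thesis using scale_mem[OF V] by (auto simp: null_span_def intro!: exI[of _ "\<lambda>b. a * c b"])
  qed
  moreover have "(\<lambda>x. 0) \<in> null_span B"
    using zero_mem ip_zero_left[OF zero_mem] by (auto simp: null_span_def intro!: exI[of _ "\<lambda>b. 0"])
  ultimately show ?thesis using assms(3) by (auto simp: subsp_def)
qed

text \<open>Induction over the generators with \<open>W\<close> general: up to null vectors, the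
  part of \<open>W\<close> spanned by the smaller set has codimension at most one in
  \<open>W\<close>, so a single Gram-Schmidt step passes from its basis to one of
  \<open>W\<close>.\<close>

lemma orthonormal_basis_exists:
  assumes "finite B" "B \<subseteq> V" "subsp W" "W \<subseteq> null_span B"
  shows "\<exists>E. orthonormal_basis W E"
  using assms
proof (induction B arbitrary: W rule: finite_induct)
  case empty
  then have "orthonormal_basis W {}"
    by (auto simp: orthonormal_basis_def null_span_def)
  then show ?case by blast
next
  case (insert b B)
  have WV: "W \<subseteq> V" using insert.prems by (simp add: subsp_def)
  let ?W = "W \<inter> null_span B"
  have sub: "subsp ?W" using insert by (intro subsp_null_span) auto
  then obtain E where E: "orthonormal_basis ?W E"
    using insert.IH[of ?W] insert.prems by auto
  have fE: "finite E" and EW: "E \<subseteq> W" and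
    ort: "\<And>e e'. e \<in> E \<Longrightarrow> e' \<in> E \<Longrightarrow> ip e e' = (if e = e' then 1 else 0)"
    using E by (auto simp: orthonormal_basis_def)
  have EV: "E \<subseteq> V" using EW WV by auto
  have proj_orth: "ip (\<lambda>x. v x - (\<Sum>e\<in>E. ip v e *\<^sub>R e x)) e' = 0" if "v \<in> V" "e' \<in> E" for v e'
  proof -
    have "ip (\<lambda>x. v x - (\<Sum>e\<in>E. ip v e *\<^sub>R e x)) e' = ip v e' - (\<Sum>e\<in>E. ip v e * ip e e')"
      using that EV by (subst ip_diff_left) (auto intro!: sum_mem simp: ip_sum_left subset_iff)
    also have "(\<Sum>e\<in>E. ip v e * ip e e') = (\<Sum>e\<in>E. if e = e' then ip v e else 0)"
      using that by (intro sum.cong) (auto simp: ort)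
    finally show ?thesis using that fE by simp
  qed
  have sumE: "(\<lambda>x. \<Sum>e\<in>E. ip v e *\<^sub>R e x) \<in> W" for v
    using subsp_sum[OF insert.prems(2), of E "\<lambda>e. e" "ip v"] EW by auto
  show ?case
  proof (cases "\<exists>v\<in>W. sqn (\<lambda>x. v x - (\<Sum>e\<in>E. ip v e *\<^sub>R e x)) \<noteq> 0")
    case False
    then have "orthonormal_basis W E" using fE EW ort by (auto simp: orthonormal_basis_def)
    then show ?thesis by blast
  next
    case True
    then obtain v0 where v0: "v0 \<in> W"
      and ne: "sqn (\<lambda>x. v0 x - (\<Sum>e\<in>E. ip v0 e *\<^sub>R e x)) \<noteq> 0"
      by blast
    \<comment> \<open>The Gram-Schmidt residual of a vector that the present basis fails to
      represent.\<close>
    define r where "r = (\<lambda>x. v0 x - (\<Sum>e\<in>E. ip v0 e *\<^sub>R e x))"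
    have rW: "r \<in> W" unfolding r_def by (rule subsp_diff[OF insert.prems(2) v0 sumE])
    then have rV: "r \<in> V" using WV by auto
    have rpos: "sqn r > 0" using ip_nonneg[OF rV] ne unfolding r_def by linarith
    have rE: "ip r e = 0" if "e \<in> E" for e
      unfolding r_def using proj_orth[OF _ that] v0 WV by auto
    define e0 where "e0 = (\<lambda>x. (1 / sqrt (sqn r)) *\<^sub>R r x)"
    have e0W: "e0 \<in> W" unfolding e0_def by (rule subsp_scale[OF insert.prems(2) rW])
    then have e0V: "e0 \<in> V" using WV by auto
    have e0e0: "sqn e0 = 1"
      using rV rpos unfolding e0_def by (simp add: ip_scale_left ip_scale_right scale_mem)
    have e0E: "ip e0 e = 0" "ip e e0 = 0" if "e \<in> E" for e
    proof -
      show "ip e0 e = 0" using rV EV that rE[OF that] unfolding e0_def by (auto simp: ip_scale_left subset_iff)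
      then show "ip e e0 = 0" using ip_commute[OF e0V, of e] EV that by auto
    qed
    have notin: "e0 \<notin> E" using e0E(1)[of e0] e0e0 by auto
    \<comment> \<open>Inside this span \<open>r\<close> would be its own expansion remainder,
      because it is orthogonal to \<open>E\<close>, and hence null.\<close>
    have r_nonspan: "r \<notin> null_span B"
    proof
      assume "r \<in> null_span B"
      then have "sqn (\<lambda>x. r x - (\<Sum>e\<in>E. ip r e *\<^sub>R e x)) = 0"
        using E rW by (auto simp: orthonormal_basis_def)
      moreover have "(\<lambda>x. r x - (\<Sum>e\<in>E. ip r e *\<^sub>R e x)) = r" using rE by simp
      ultimately show False using rpos by simp
    qed
    have bspl: "\<exists>a c. sqn (\<lambda>x. v x - (a *\<^sub>R b x + (\<Sum>e\<in>B. c e *\<^sub>R e x))) = 0"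
      if v: "v \<in> W" for v
    proof -
      obtain c where "sqn (\<lambda>x. v x - (\<Sum>e\<in>insert b B. c e *\<^sub>R e x)) = 0"
        using v insert.prems(3) unfolding null_span_def by blast
      then show ?thesis using insert.hyps by (intro exI[of _ "c b"] exI[of _ c]) simp
    qed
    obtain a c where ac: "sqn (\<lambda>x. r x - (a *\<^sub>R b x + (\<Sum>e\<in>B. c e *\<^sub>R e x))) = 0"
      using bspl[OF rW] by blast
    have a0: "a \<noteq> 0"
    proof
      assume "a = 0"
      then show False using ac r_nonspan rV by (auto simp: null_span_def)
    qed
    have sB: "(\<lambda>x. \<Sum>e\<in>B. d e *\<^sub>R e x) \<in> V" for d
      using sum_mem[of B "\<lambda>e. e" d] insert.prems(1) by auto
    have bV: "b \<in> V" using insert.prems(1) by auto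
    have key: "sqn (\<lambda>x. v x - (\<Sum>e\<in>insert e0 E. ip v e *\<^sub>R e x)) = 0"
      if v: "v \<in> W" for v
    proof -
      obtain a' c' where ac': "sqn (\<lambda>x. v x - (a' *\<^sub>R b x + (\<Sum>e\<in>B. c' e *\<^sub>R e x))) = 0"
        using bspl[OF v] by blast
      \<comment> \<open>Chosen so that \<open>b\<close> cancels in \<open>v - s r\<close>, which
        then lies in the part already spanned by \<open>E\<close>.\<close>
      define s where "s = a' / a"
      define w where "w = (\<lambda>x. v x - s *\<^sub>R r x)"
      have vV: "v \<in> V" using v WV by auto
      have wW: "w \<in> W"
        unfolding w_def by (intro subsp_diff[OF insert.prems(2) v] subsp_scale[OF insert.prems(2) rW])
      have wV: "w \<in> V" using wW WV by auto
      have "w \<in> null_span B"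
      proof -
        let ?p = "\<lambda>x. v x - (a' *\<^sub>R b x + (\<Sum>e\<in>B. c' e *\<^sub>R e x))"
        let ?q = "\<lambda>x. r x - (a *\<^sub>R b x + (\<Sum>e\<in>B. c e *\<^sub>R e x))"
        have m: "?p \<in> V" "?q \<in> V"
          using vV rV bV sB by (auto intro!: diff_mem add_mem scale_mem)
        have "sqn (\<lambda>x. ?p x + (- s) *\<^sub>R ?q x) = 0"
          unfolding ip_scale_add_self[OF m] using ip_null_left[OF m] ac ac' by simp
        also have "(\<lambda>x. ?p x + (- s) *\<^sub>R ?q x) = (\<lambda>x. w x - (\<Sum>e\<in>B. (c' e - s * c e) *\<^sub>R e x))"
          using a0 by (auto simp: w_def s_def algebra_simps sum_subtractf sum_negf sum.distrib scaleR_sum_right)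
        finally show ?thesis using wV by (auto simp: null_span_def)
      qed
      then have wn: "sqn (\<lambda>x. w x - (\<Sum>e\<in>E. ip w e *\<^sub>R e x)) = 0"
        using E wW by (auto simp: orthonormal_basis_def)
      have we: "ip w e = ip v e" if "e \<in> E" for e
        unfolding w_def using that EV vV rV rE
        by (subst ip_diff_left) (auto simp: ip_scale_left scale_mem subset_iff)
      have rr: "r x = sqrt (sqn r) *\<^sub>R e0 x" for x using rpos by (simp add: e0_def)
      let ?z = "\<lambda>x. w x - (\<Sum>e\<in>E. ip w e *\<^sub>R e x)"
      have zV: "?z \<in> V" using wV EV by (intro diff_mem sum_mem) auto
      let ?s = "s * sqrt (sqn r)"
      have SV: "(\<lambda>x. \<Sum>e\<in>E. ip w e *\<^sub>R e x) \<in> V" using EV by (intro sum_mem) auto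
      have "ip ?z e0 = ip w e0 - (\<Sum>e\<in>E. ip w e * ip e e0)"
        using ip_diff_left[OF wV SV e0V] ip_sum_left[of E "\<lambda>e. e" e0 "ip w"] EV e0V by auto
      then have "ip w e0 = 0" using ip_null_left[OF zV e0V wn] e0E by simp
      moreover have "ip w e0 = ip v e0 - s * ip r e0"
        unfolding w_def using vV rV e0V by (simp add: ip_diff_left ip_scale_left scale_mem)
      moreover have "ip r e0 = sqrt (sqn r)"
        using rV rpos unfolding e0_def by (simp add: ip_scale_right real_div_sqrt)
      ultimately have ve0: "ip v e0 = ?s" by simp
      \<comment> \<open>The term for \<open>e0\<close> is exactly \<open>s *\<^sub>R r x\<close>, so
        the remainder of \<open>v\<close> is that of \<open>w\<close>.\<close>
      have "(\<lambda>x. v x - (\<Sum>e\<in>insert e0 E. ip v e *\<^sub>R e x)) = ?z"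
        using fE notin we by (auto simp: ve0 w_def rr intro!: sum.cong)
      then show ?thesis using wn by simp
    qed
    have "orthonormal_basis W (insert e0 E)"
      using fE EW e0W ort key e0E e0e0 notin unfolding orthonormal_basis_def by auto
    then show ?thesis by blast
  qed
qed

text \<open>Parseval with a second factor from all of \<open>V\<close>: the remainder of
  \<open>v\<close> is null and therefore orthogonal to \<open>w\<close> as well.\<close>

lemma orthonormal_basis_ip:
  assumes E: "orthonormal_basis W E" and "W \<subseteq> V" and v: "v \<in> W" and w: "w \<in> V"
  shows "ip v w = (\<Sum>e\<in>E. ip v e * ip e w)"
proof -
  have EV: "E \<subseteq> V" and vV: "v \<in> V" using assms by (auto simp: orthonormal_basis_def)
  let ?s = "\<lambda>x. \<Sum>e\<in>E. ip v e *\<^sub>R e x"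
  have sV: "?s \<in> V" using EV by (intro sum_mem) auto
  have "ip (\<lambda>x. v x - ?s x) w = 0"
    using ip_null_left[OF diff_mem[OF vV sV] w] E v by (auto simp: orthonormal_basis_def)
  moreover have "ip ?s w = (\<Sum>e\<in>E. ip v e * ip e w)" using EV w by (intro ip_sum_left) auto
  ultimately show ?thesis using ip_diff_left[OF vV sV w] by simp
qed

text \<open>Riesz representation in finite dimension, with the values of \<open>l\<close> on the
  basis as coefficients. Vanishing on null vectors takes the place of continuity: it makes
  \<open>l\<close> blind to the remainder of the expansion.\<close>

lemma representer_exists:
  assumes E: "orthonormal_basis W E" and W: "subsp W"
    and add: "\<And>v w. v \<in> W \<Longrightarrow> w \<in> W \<Longrightarrow> l (\<lambda>x. v x + w x) = l v + l w"
    and scale: "\<And>v c. v \<in> W \<Longrightarrow> l (\<lambda>x. c *\<^sub>R v x) = c * l v"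
    and null: "\<And>v. v \<in> W \<Longrightarrow> sqn v = 0 \<Longrightarrow> l v = 0"
  shows "\<exists>z\<in>W. \<forall>v\<in>W. ip z v = l v"
proof -
  have WV: "W \<subseteq> V" and W0: "(\<lambda>x. 0) \<in> W" using W by (auto simp: subsp_def)
  have EW: "E \<subseteq> W" and fE: "finite E" using E by (auto simp: orthonormal_basis_def)
  have EV: "E \<subseteq> V" using EW WV by auto
  have lsum: "l (\<lambda>x. \<Sum>e\<in>F. c e *\<^sub>R e x) = (\<Sum>e\<in>F. c e * l e)" if "finite F" "F \<subseteq> W" for F c
    using that
  proof (induction F)
    case empty
    show ?case using scale[OF W0, of 0] by simp
  next
    case (insert e F)
    have "(\<lambda>x. c e *\<^sub>R e x) \<in> W" "(\<lambda>x. \<Sum>e\<in>F. c e *\<^sub>R e x) \<in> W"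
      using insert.prems subsp_sum[OF W, of F "\<lambda>e. e" c] subsp_scale[OF W] by auto
    then show ?case using insert by (simp add: add scale)
  qed
  let ?z = "\<lambda>x. \<Sum>e\<in>E. l e *\<^sub>R e x"
  have zW: "?z \<in> W" using subsp_sum[OF W, of E "\<lambda>e. e" l] EW by auto
  have "ip ?z v = l v" if v: "v \<in> W" for v
  proof -
    let ?s = "\<lambda>x. \<Sum>e\<in>E. ip v e *\<^sub>R e x"
    have sW: "?s \<in> W" using subsp_sum[OF W, of E "\<lambda>e. e" "ip v"] EW by auto
    have dW: "(\<lambda>x. v x - ?s x) \<in> W" by (rule subsp_diff[OF W v sW])
    have "l (\<lambda>x. v x - ?s x) = 0" using null[OF dW] E v by (auto simp: orthonormal_basis_def)
    then have "l v = l ?s" using add[OF dW sW] by simp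
    also have "\<dots> = (\<Sum>e\<in>E. ip v e * l e)" by (rule lsum[OF fE EW])
    also have "\<dots> = ip ?z v"
    proof -
      have vV: "v \<in> V" using v WV by auto
      have "ip ?z v = (\<Sum>e\<in>E. l e * ip e v)" using EV vV by (intro ip_sum_left) auto
      also have "\<dots> = (\<Sum>e\<in>E. ip v e * l e)"
        using EV vV ip_commute[of v] by (intro sum.cong) (auto simp: mult.commute)
      finally show ?thesis by simp
    qed
    finally show ?thesis by simp
  qed
  with zW show ?thesis by blast
qed

end

section \<open>Square-integrable functions\<close>

lemma borel_measurable_lebesgue_on: "f \<in> borel_measurable borel \<Longrightarrow> f \<in> borel_measurable (lebesgue_on S)"
  by (intro measurable_restrict_space1 measurable_completion) simp

lemma square_integrable_integrable_inner:
  fixes f g :: "real^'n::finite \<Rightarrow> 'b::euclidean_space"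
  assumes "square_integrable \<Omega> f" "square_integrable \<Omega> g"
  shows "integrable (lebesgue_on \<Omega>) (\<lambda>x. f x \<bullet> g x)"
proof (rule Bochner_Integration.integrable_bound)
  show "integrable (lebesgue_on \<Omega>) (\<lambda>x. (norm (f x))\<^sup>2 + (norm (g x))\<^sup>2)"
    using assms unfolding square_integrable_def by (intro Bochner_Integration.integrable_add) auto
  show "(\<lambda>x. f x \<bullet> g x) \<in> borel_measurable (lebesgue_on \<Omega>)"
    using assms unfolding square_integrable_def by (intro borel_measurable_inner) auto
  have "norm (a \<bullet> b) \<le> norm ((norm a)\<^sup>2 + (norm b)\<^sup>2)" for a b :: 'b
  proof -
    have "norm (a \<bullet> b) \<le> norm a * norm b" by (simp add: Cauchy_Schwarz_ineq2)
    also have "\<dots> \<le> (norm a)\<^sup>2 + (norm b)\<^sup>2"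
      using sum_squares_bound[of "norm a" "norm b"] mult_nonneg_nonneg[of "norm a" "norm b"]
      by (simp add: mult.assoc del: mult_nonneg_nonneg)
    finally show ?thesis by simp
  qed
  then show "AE x in lebesgue_on \<Omega>. norm (f x \<bullet> g x) \<le> norm ((norm (f x))\<^sup>2 + (norm (g x))\<^sup>2)"
    by simp
qed

lemma square_integrable_add:
  assumes "square_integrable \<Omega> f" "square_integrable \<Omega> g"
  shows "square_integrable \<Omega> (\<lambda>x. f x + g x)"
proof -
  have "integrable (lebesgue_on \<Omega>) (\<lambda>x. (norm (f x))\<^sup>2 + 2 * (f x \<bullet> g x) + (norm (g x))\<^sup>2)"
    using assms square_integrable_integrable_inner[OF assms]
    unfolding square_integrable_def by (intro Bochner_Integration.integrable_add) auto
  also have "(\<lambda>x. (norm (f x))\<^sup>2 + 2 * (f x \<bullet> g x) + (norm (g x))\<^sup>2) = (\<lambda>x. (norm (f x + g x))\<^sup>2)"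
    by (simp add: power2_norm_eq_inner inner_add_left inner_add_right inner_commute algebra_simps)
  finally show ?thesis using assms unfolding square_integrable_def by (intro conjI borel_measurable_add) auto
qed

lemma square_integrable_scaleR:
  "square_integrable \<Omega> f \<Longrightarrow> square_integrable \<Omega> (\<lambda>x. c *\<^sub>R f x)"
  unfolding square_integrable_def by (auto simp: power_mult_distrib intro: borel_measurable_scaleR)

lemma square_integrable_zero: "square_integrable \<Omega> (\<lambda>x. 0)"
  by (simp add: square_integrable_def)

text \<open>The codomain stays polymorphic, so scalar, vector and matrix fields are served by one
  interpretation.\<close>

interpretation L2: semi_inner_space "Collect (square_integrable \<Omega>)" "l2_inner \<Omega>"
  for \<Omega> :: "(real^'n::finite) set"
proof
  fix u v w :: "real^'n \<Rightarrow> 'b::euclidean_space" and c :: real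
  assume u: "u \<in> Collect (square_integrable \<Omega>)" and v: "v \<in> Collect (square_integrable \<Omega>)"
    and w: "w \<in> Collect (square_integrable \<Omega>)"
  show "l2_inner \<Omega> (\<lambda>x. u x + v x) w = l2_inner \<Omega> u w + l2_inner \<Omega> v w"
    using u v w unfolding l2_inner_def
    by (simp add: inner_add_left Bochner_Integration.integral_add square_integrable_integrable_inner)
next
qed (auto simp: l2_inner_def square_integrable_zero square_integrable_add square_integrable_scaleR
      inner_commute)

lemmas square_integrable_diff = L2.diff_mem[unfolded mem_Collect_eq]

lemma square_integrable_sum:
  "(\<And>i. i \<in> I \<Longrightarrow> square_integrable \<Omega> (f i)) \<Longrightarrow> square_integrable \<Omega> (\<lambda>x. \<Sum>i\<in>I. f i x)"
  using L2.sum_mem[of I f \<Omega> "\<lambda>_. 1"] by simp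

lemma l2_inner_cong_AE:
  assumes "ae_eq \<Omega> f f'" "ae_eq \<Omega> g g'"
    and "square_integrable \<Omega> f" "square_integrable \<Omega> f'" "square_integrable \<Omega> g" "square_integrable \<Omega> g'"
  shows "l2_inner \<Omega> f g = l2_inner \<Omega> f' g'"
  unfolding l2_inner_def using assms
  by (intro integral_cong_AE) (auto simp: square_integrable_def ae_eq_def)

lemma ae_eq_refl: "ae_eq \<Omega> f f"
  by (simp add: ae_eq_def)

lemma ae_eq_sym: "ae_eq \<Omega> f g \<Longrightarrow> ae_eq \<Omega> g f"
  by (auto simp: ae_eq_def)

lemma ae_eq_zero_of_l2_null:
  assumes "square_integrable \<Omega> f" "l2_inner \<Omega> f f = 0"
  shows "ae_eq \<Omega> f (\<lambda>x. 0)"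
proof -
  have "AE x in lebesgue_on \<Omega>. f x \<bullet> f x = 0"
    using assms square_integrable_integrable_inner[OF assms(1,1)]
    by (subst integral_nonneg_eq_0_iff_AE[symmetric]) (auto simp: l2_inner_def)
  then show ?thesis by (simp add: ae_eq_def)
qed

lemma l2_norm_power2: "(l2_norm \<Omega> f)\<^sup>2 = l2_inner \<Omega> f f"
  unfolding l2_norm_def l2_inner_def by (simp add: integral_nonneg_AE)

lemma l2_inner_abs_le:
  "square_integrable \<Omega> f \<Longrightarrow> square_integrable \<Omega> g \<Longrightarrow> \<bar>l2_inner \<Omega> f g\<bar> \<le> l2_norm \<Omega> f * l2_norm \<Omega> g"
  using L2.ip_abs_le[of f \<Omega> g] by (simp add: l2_norm_def)

lemma square_integrable_bounded:
  fixes f :: "real^'n::finite \<Rightarrow> 'b::euclidean_space"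
  assumes "\<Omega> \<in> lmeasurable" "f \<in> borel_measurable (lebesgue_on \<Omega>)"
    and bound: "AE x in lebesgue_on \<Omega>. norm (f x) \<le> B"
  shows "square_integrable \<Omega> f"
proof -
  interpret finite_measure "lebesgue_on \<Omega>" by (rule finite_measure_lebesgue_on[OF assms(1)])
  have "integrable (lebesgue_on \<Omega>) (\<lambda>x. (norm (f x))\<^sup>2)"
  proof (rule integrable_const_bound[of _ "B\<^sup>2"])
    show "AE x in lebesgue_on \<Omega>. norm ((norm (f x))\<^sup>2) \<le> B\<^sup>2"
      using bound by eventually_elim (simp add: power_mono)
  qed (use assms in auto)
  then show ?thesis using assms by (simp add: square_integrable_def)
qed

text \<open>On a set of finite measure the constant \<open>1\<close> is square integrable, and the
  product with it is integrable.\<close>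

lemma integrable_of_square_integrable:
  fixes f :: "real^'n::finite \<Rightarrow> real"
  assumes "\<Omega> \<in> lmeasurable" "square_integrable \<Omega> f"
  shows "integrable (lebesgue_on \<Omega>) f"
  using square_integrable_integrable_inner[OF assms(2) square_integrable_bounded[OF assms(1), of "\<lambda>_. 1::real" 1]]
  by simp

section \<open>Components of vector and matrix fields\<close>

lemma square_integrable_component:
  fixes f :: "real^'n::finite \<Rightarrow> 'b::euclidean_space^'m::finite"
  assumes "square_integrable \<Omega> f" shows "square_integrable \<Omega> (\<lambda>x. f x $ i)"
proof -
  have m: "(\<lambda>x. f x $ i) \<in> borel_measurable (lebesgue_on \<Omega>)"
    using assms
    by (auto simp: square_integrable_def intro!: continuous_intros
        measurable_compose[OF _ borel_measurable_continuous_onI[of "\<lambda>v. v $ i"]])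
  have "integrable (lebesgue_on \<Omega>) (\<lambda>x. (norm (f x $ i))\<^sup>2)"
  proof (rule Bochner_Integration.integrable_bound)
    show "integrable (lebesgue_on \<Omega>) (\<lambda>x. (norm (f x))\<^sup>2)"
      using assms by (simp add: square_integrable_def)
    show "(\<lambda>x. (norm (f x $ i))\<^sup>2) \<in> borel_measurable (lebesgue_on \<Omega>)" using m by simp
    show "AE x in lebesgue_on \<Omega>. norm ((norm (f x $ i))\<^sup>2) \<le> norm ((norm (f x))\<^sup>2)"
      by (intro AE_I2) (simp add: power_mono Finite_Cartesian_Product.norm_nth_le)
  qed
  with m show ?thesis by (simp add: square_integrable_def)
qed

lemma square_integrable_vec:
  fixes f :: "real^'n::finite \<Rightarrow> 'b::euclidean_space^'m::finite"
  assumes "\<And>i. square_integrable \<Omega> (\<lambda>x. f x $ i)"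
  shows "square_integrable \<Omega> f"
proof -
  have "f \<in> borel_measurable (lebesgue_on \<Omega>)"
  proof (rule borel_measurable_euclidean_space[THEN iffD2], rule ballI)
    fix b :: "'b^'m" assume "b \<in> Basis"
    then obtain i u where b: "b = axis i u" by (auto simp: Basis_vec_def)
    show "(\<lambda>x. f x \<bullet> b) \<in> borel_measurable (lebesgue_on \<Omega>)"
      using assms[of i] by (auto simp: b inner_axis square_integrable_def)
  qed
  moreover have "integrable (lebesgue_on \<Omega>) (\<lambda>x. (norm (f x))\<^sup>2)"
  proof -
    have "integrable (lebesgue_on \<Omega>) (\<lambda>x. \<Sum>i\<in>UNIV. (norm (f x $ i))\<^sup>2)"
      using assms by (intro Bochner_Integration.integrable_sum) (auto simp: square_integrable_def)
    also have "(\<lambda>x. \<Sum>i\<in>UNIV. (norm (f x $ i))\<^sup>2) = (\<lambda>x. (norm (f x))\<^sup>2)"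
      by (simp add: norm_vec_def L2_set_def sum_nonneg)
    finally show ?thesis .
  qed
  ultimately show ?thesis by (simp add: square_integrable_def)
qed

lemma l2_inner_vec:
  fixes f g :: "real^'n::finite \<Rightarrow> 'b::euclidean_space^'m::finite"
  assumes "square_integrable \<Omega> f" "square_integrable \<Omega> g"
  shows "l2_inner \<Omega> f g = (\<Sum>i\<in>UNIV. l2_inner \<Omega> (\<lambda>x. f x $ i) (\<lambda>x. g x $ i))"
  unfolding l2_inner_def inner_vec_def
  using assms by (intro Bochner_Integration.integral_sum square_integrable_integrable_inner square_integrable_component)

section \<open>Smooth test functions\<close>

text \<open>On an open set a derivative depends on nearby values only, so equality on
  \<open>U\<close> is inherited by every derivative in the recursion, whatever happens outside
  \<open>U\<close>.\<close>

lemma C_k_on_cong: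
  assumes "open U" "C_k_on k U f" "\<And>x. x \<in> U \<Longrightarrow> f x = g x"
  shows "C_k_on k U g"
  using assms(2,3)
proof (induction k arbitrary: f g)
  case 0
  then show ?case by (simp cong: continuous_on_cong)
next
  case (Suc k)
  have D: "(g has_derivative frechet_derivative f (at x)) (at x)" if x: "x \<in> U" for x
  proof -
    have "(f has_derivative frechet_derivative f (at x)) (at x)"
      using Suc.prems(1) x by (simp add: frechet_derivative_works[symmetric])
    then show ?thesis
      using has_derivative_transform_within_open[OF _ \<open>open U\<close> x] Suc.prems(2) by blast
  qed
  then have "frechet_derivative f (at x) = frechet_derivative g (at x)" if "x \<in> U" for x
    using that frechet_derivative_at by blast
  then have "C_k_on k U (\<lambda>x. frechet_derivative g (at x) b)" if "b \<in> Basis" for b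
    using Suc.IH[of "\<lambda>x. frechet_derivative f (at x) b"] Suc.prems(1) that by simp
  with D show ?case by (auto simp: differentiable_def)
qed

text \<open>The inductive smoothness proofs below go through this rule: an explicit derivative
  replaces \<open>frechet_derivative\<close>, which is specified by choice only.\<close>

lemma C_k_on_SucI:
  assumes "open U" "\<And>x. x \<in> U \<Longrightarrow> (f has_derivative f' x) (at x)"
    "\<And>b. b \<in> Basis \<Longrightarrow> C_k_on k U (\<lambda>x. f' x b)"
  shows "C_k_on (Suc k) U f"
proof -
  have "f' x = frechet_derivative f (at x)" if "x \<in> U" for x
    using assms(2)[OF that] frechet_derivative_at by blast
  then have "C_k_on k U (\<lambda>x. frechet_derivative f (at x) b)" if "b \<in> Basis" for b
    using C_k_on_cong[OF assms(1) assms(3)[OF that]] by simp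
  then show ?thesis using assms(2) by (auto simp: differentiable_def)
qed

lemma C_k_on_Suc_D: "C_k_on (Suc k) U f \<Longrightarrow> C_k_on k U f"
proof (induction k arbitrary: f)
  case 0
  then have "\<forall>x\<in>U. f differentiable (at x)" unfolding C_k_on.simps(2) by blast
  then show ?case
    unfolding C_k_on.simps(1) by (meson continuous_at_imp_continuous_on differentiable_imp_continuous_within)
next
  case (Suc k)
  have "C_k_on k U (\<lambda>x. frechet_derivative f (at x) b)" if "b \<in> Basis" for b
    using Suc.prems Suc.IH[of "\<lambda>x. frechet_derivative f (at x) b"] that
    unfolding C_k_on.simps(2)[of "Suc k" U f] by blast
  moreover have "\<forall>x\<in>U. f differentiable (at x)"
    using Suc.prems unfolding C_k_on.simps(2)[of "Suc k" U f] by blast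
  ultimately show ?case unfolding C_k_on.simps(2) by blast
qed

lemma C_k_on_const: "open U \<Longrightarrow> C_k_on k U (\<lambda>x. c)"
proof (induction k arbitrary: c)
  case (Suc k)
  show ?case by (rule C_k_on_SucI[OF Suc.prems has_derivative_const Suc.IH[OF Suc.prems]])
qed simp

lemma C_k_on_add:
  assumes "open U" "C_k_on k U f" "C_k_on k U g"
  shows "C_k_on k U (\<lambda>x. f x + g x)"
  using assms(2,3)
proof (induction k arbitrary: f g)
  case 0
  then show ?case by (simp add: continuous_on_add)
next
  case (Suc k)
  show ?case
  proof (rule C_k_on_SucI[OF assms(1)])
    show "((\<lambda>x. f x + g x) has_derivative
        (\<lambda>h. frechet_derivative f (at x) h + frechet_derivative g (at x) h)) (at x)" if "x \<in> U" for x
      using Suc.prems that by (intro has_derivative_add) (simp_all add: frechet_derivative_works[symmetric])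
    show "C_k_on k U (\<lambda>x. frechet_derivative f (at x) b + frechet_derivative g (at x) b)"
      if "b \<in> Basis" for b
      using Suc.prems that by (intro Suc.IH) auto
  qed
qed

text \<open>Each summand of the product rule keeps one factor undifferentiated, hence the passage
  from order \<open>Suc k\<close> down to \<open>k\<close> by \<open>C_k_on_Suc_D\<close>.\<close>

lemma C_k_on_mult:
  fixes f g :: "'a::euclidean_space \<Rightarrow> real"
  assumes "open U" "C_k_on k U f" "C_k_on k U g"
  shows "C_k_on k U (\<lambda>x. f x * g x)"
  using assms(2,3)
proof (induction k arbitrary: f g)
  case 0
  then show ?case by (simp add: continuous_on_mult)
next
  case (Suc k)
  show ?case
  proof (rule C_k_on_SucI[OF assms(1)])
    show "((\<lambda>x. f x * g x) has_derivative
        (\<lambda>h. f x * frechet_derivative g (at x) h + frechet_derivative f (at x) h * g x)) (at x)"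
      if "x \<in> U" for x
      using Suc.prems that by (intro has_derivative_mult) (simp_all add: frechet_derivative_works[symmetric])
    show "C_k_on k U (\<lambda>x. f x * frechet_derivative g (at x) b + frechet_derivative f (at x) b * g x)"
      if "b \<in> Basis" for b
      using Suc.prems that C_k_on_Suc_D by (intro C_k_on_add[OF assms(1)] Suc.IH) auto
  qed
qed

lemma smooth_on_open_prod:
  fixes f :: "'i \<Rightarrow> 'a::euclidean_space \<Rightarrow> real"
  assumes "open U" "\<And>i. i \<in> I \<Longrightarrow> smooth_on_open U (f i)"
  shows "smooth_on_open U (\<lambda>x. \<Prod>i\<in>I. f i x)"
  using assms(2)
  by (induction I rule: infinite_finite_induct)
    (auto simp: smooth_on_open_def intro: C_k_on_const C_k_on_mult assms(1))

text \<open>With \<open>p = 1\<close> this is the usual flat function; the family over all \<open>p\<close> is closed under differentiation.\<close>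

definition exp_decay :: "real poly \<Rightarrow> real \<Rightarrow> real" where
  "exp_decay p s = (if s > 0 then poly p (1 / s) * exp (- (1 / s)) else 0)"

text \<open>With \<open>y = 1 / s\<close> and \<open>y' = - y^2\<close>, the derivative of
  \<open>p(y) exp(-y)\<close> in \<open>s\<close> is
  \<open>y^2 (p(y) - p'(y)) exp(-y)\<close>.\<close>

definition exp_decay_deriv :: "real poly \<Rightarrow> real poly" where
  "exp_decay_deriv p = [:0, 0, 1:] * (p - pderiv p)"

lemma poly_times_exp_minus_tendsto_0: "((\<lambda>y::real. poly p y * exp (- y)) \<longlongrightarrow> 0) at_top"
proof -
  have "((\<lambda>y::real. \<Sum>i\<le>degree p. coeff p i * (y ^ i / exp y)) \<longlongrightarrow> (\<Sum>i\<le>degree p. coeff p i * 0)) at_top"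
    by (intro tendsto_intros tendsto_power_div_exp_0)
  then show ?thesis
    by (simp add: poly_altdef exp_minus sum_distrib_right divide_inverse mult.assoc)
qed

lemma exp_decay_has_derivative:
  "(exp_decay p has_real_derivative exp_decay (exp_decay_deriv p) s) (at s)"
proof (rule linorder_cases[of s 0])
  assume s: "s < 0"
  have "(exp_decay p has_real_derivative 0) (at s)"
    by (rule has_field_derivative_transform_within_open[of "\<lambda>_. 0" _ _ "{..<0}"])
      (use s in \<open>auto simp: exp_decay_def\<close>)
  then show ?thesis using s by (simp add: exp_decay_def)
next
  assume s: "s > 0"
  have "((\<lambda>s. poly p (1 / s) * exp (- (1 / s))) has_real_derivative
      exp_decay (exp_decay_deriv p) s) (at s)"
    using s by (auto intro!: derivative_eq_intros poly_DERIV[THEN DERIV_chain2]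
        simp: exp_decay_def exp_decay_deriv_def field_simps power2_eq_square)
  then show ?thesis
    by (rule has_field_derivative_transform_within_open[of _ _ _ "{0<..}"])
      (use s in \<open>auto simp: exp_decay_def\<close>)
next
  assume s: "s = 0"
  \<comment> \<open>The quotient \<open>exp_decay p y / y\<close> carries one more power of
    \<open>1 / y\<close>, which is the shift of \<open>p\<close> to \<open>pCons 0 p\<close>; the
    exponential decay absorbs it.\<close>
  have "((\<lambda>y. poly (pCons 0 p) (inverse y) * exp (- inverse y)) \<longlongrightarrow> 0) (at_right (0::real))"
    by (rule filterlim_compose[OF poly_times_exp_minus_tendsto_0 filterlim_inverse_at_top_right])
  then have "((\<lambda>y. (exp_decay p y - exp_decay p 0) / (y - 0)) \<longlongrightarrow> 0) (at_right 0)"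
    by (rule Lim_transform_eventually)
      (auto simp: eventually_at_filter exp_decay_def field_simps)
  moreover have "((\<lambda>y. (exp_decay p y - exp_decay p 0) / (y - 0)) \<longlongrightarrow> 0) (at_left 0)"
    by (rule Lim_transform_eventually[OF tendsto_const])
      (auto simp: eventually_at_filter exp_decay_def)
  ultimately have "((\<lambda>y. (exp_decay p y - exp_decay p 0) / (y - 0)) \<longlongrightarrow> 0) (at 0)"
    by (simp add: filterlim_split_at)
  then show ?thesis using s by (simp add: has_field_derivative_iff exp_decay_def)
qed

lemma C_k_on_exp_decay_affine:
  fixes i :: "'a::euclidean_space"
  shows "C_k_on k UNIV (\<lambda>x. exp_decay p (c * (x \<bullet> i) + d))"
proof (induction k arbitrary: p)
  case 0
  have "continuous_on UNIV (exp_decay p)"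
    using exp_decay_has_derivative by (meson DERIV_continuous_on has_field_derivative_at_within)
  then have "continuous_on UNIV (\<lambda>x. exp_decay p (c * (x \<bullet> i) + d))"
    by (rule continuous_on_compose2) (auto intro!: continuous_intros)
  then show ?case by simp
next
  case (Suc k)
  show ?case
  proof (rule C_k_on_SucI)
    show "((\<lambda>x. exp_decay p (c * (x \<bullet> i) + d)) has_derivative
        (\<lambda>h. exp_decay (exp_decay_deriv p) (c * (x \<bullet> i) + d) * (c * (h \<bullet> i)))) (at x)" for x
      by (rule DERIV_compose_FDERIV[OF exp_decay_has_derivative, THEN has_derivative_eq_rhs])
        (auto intro!: derivative_eq_intros)
    show "C_k_on k UNIV (\<lambda>x. exp_decay (exp_decay_deriv p) (c * (x \<bullet> i) + d) * (c * (b \<bullet> i)))" for b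
      by (intro C_k_on_mult C_k_on_const Suc.IH) auto
  qed auto
qed

text \<open>Each coordinate contributes two flat factors, one vanishing below \<open>a\<close> and
  one above \<open>b\<close>. The factor \<open>r\<close> sharpens the transition:
  \<open>exp (- 1 / (r s))\<close> tends to \<open>1\<close> for every \<open>s > 0\<close> as
  \<open>r\<close> grows.\<close>

definition box_bump :: "real \<Rightarrow> real^'n::finite \<Rightarrow> real^'n \<Rightarrow> real^'n \<Rightarrow> real" where
  "box_bump r a b x =
     (\<Prod>i\<in>UNIV. exp_decay 1 (r * (x $ i - a $ i)) * exp_decay 1 (r * (b $ i - x $ i)))"

lemma exp_decay_1_bounds: "0 \<le> exp_decay 1 s" "exp_decay 1 s \<le> 1"
  by (auto simp: exp_decay_def)

lemma box_bump_bounds: "0 \<le> box_bump r a b x" "box_bump r a b x \<le> 1"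
  unfolding box_bump_def
  by (auto intro!: prod_nonneg prod_le_1 mult_nonneg_nonneg mult_le_one simp: exp_decay_1_bounds)

lemma box_bump_outside:
  assumes "r > 0" "x \<notin> box a b" shows "box_bump r a b x = 0"
proof -
  obtain i where "x $ i \<le> a $ i \<or> b $ i \<le> x $ i" using assms by (auto simp: mem_box_cart not_less)
  then have "exp_decay 1 (r * (x $ i - a $ i)) * exp_decay 1 (r * (b $ i - x $ i)) = 0"
    using assms(1) by (auto simp: exp_decay_def zero_less_mult_iff)
  then show ?thesis by (auto simp: box_bump_def intro!: prod_zero)
qed

lemma box_bump_test_function:
  assumes "r > 0" "cbox a b \<subseteq> \<Omega>" shows "box_bump r a b \<in> test_functions \<Omega>"
proof -
  have sub: "closure {x. box_bump r a b x \<noteq> 0} \<subseteq> cbox a b"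
    using box_bump_outside[OF assms(1)] box_subset_cbox by (intro closure_minimal closed_cbox) blast
  then have "compact (closure {x. box_bump r a b x \<noteq> 0})"
    using compact_cbox by (metis closed_closure compact_Int_closed inf.absorb_iff2)
  moreover have "smooth_on_open UNIV (box_bump r a b)"
  proof -
    have eq: "exp_decay 1 (r * (x $ i - a $ i)) = exp_decay 1 (r * (x \<bullet> axis i 1) + - (r * a $ i))"
      "exp_decay 1 (r * (b $ i - x $ i)) = exp_decay 1 (- r * (x \<bullet> axis i 1) + r * b $ i)" for x i
      by (simp_all add: inner_axis algebra_simps)
    have "smooth_on_open UNIV (\<lambda>x. \<Prod>i\<in>UNIV. exp_decay 1 (r * (x \<bullet> axis i 1) + - (r * a $ i)) *
        exp_decay 1 (- r * (x \<bullet> axis i 1) + r * b $ i))"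
      unfolding smooth_on_open_def
      by (rule smooth_on_open_prod[unfolded smooth_on_open_def])
        (intro allI C_k_on_mult C_k_on_exp_decay_affine open_UNIV)+
    then show ?thesis unfolding box_bump_def[abs_def] eq .
  qed
  ultimately show ?thesis using sub assms(2) by (auto simp: test_functions_def)
qed

text \<open>The limit is the indicator of the open box because every bump already vanishes on the
  faces.\<close>

lemma box_bump_tendsto:
  "(\<lambda>n. box_bump (real (Suc n)) a b x) \<longlonglongrightarrow> indicator (box a b) x"
proof (cases "x \<in> box a b")
  case True
  have lim: "(\<lambda>n. exp_decay 1 (real (Suc n) * s)) \<longlonglongrightarrow> 1" if "s > 0" for s
  proof -
    have "(\<lambda>n. exp (- (inverse (real (Suc n)) * inverse s))) \<longlonglongrightarrow> exp (- (0 * inverse s))"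
      by (intro tendsto_intros LIMSEQ_inverse_real_of_nat)
    then show ?thesis using that by (simp add: exp_decay_def inverse_eq_divide)
  qed
  have "(\<lambda>n. box_bump (real (Suc n)) a b x) \<longlonglongrightarrow> (\<Prod>i\<in>(UNIV::'a set). 1 * 1)"
    unfolding box_bump_def using True
    by (intro tendsto_prod tendsto_mult lim) (auto simp: mem_box_cart)
  then show ?thesis using True by simp
next
  case False
  then show ?thesis by (simp add: box_bump_outside)
qed

text \<open>The integral of \<open>d\<close> over every box in \<open>\<Omega>\<close> vanishes, and box averages converge to \<open>d\<close> almost everywhere.\<close>

lemma AE_zero_if_orthogonal_to_test_functions:
  fixes d :: "real^'n::finite \<Rightarrow> real"
  assumes "open \<Omega>" and d: "integrable (lebesgue_on \<Omega>) d"
    and orth: "\<And>\<phi>. \<phi> \<in> test_functions \<Omega> \<Longrightarrow> (LINT x|lebesgue_on \<Omega>. d x * \<phi> x) = 0"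
  shows "ae_eq \<Omega> d (\<lambda>x. 0)"
proof -
  have \<Omega>: "\<Omega> \<in> sets lebesgue" using assms(1) by (simp add: borel_open sets_completionI_sets)
  \<comment> \<open>Extension by zero makes the differentiation theorem for functions on the whole
    space applicable.\<close>
  define D where "D = (\<lambda>x. if x \<in> \<Omega> then d x else 0)"
  have D: "integrable lebesgue D" unfolding D_def using d Lebesgue_Measure.integrable_restrict_UNIV[OF \<Omega>] by blast
  have Dint: "D integrable_on cbox a b" for a b
    using integrable_on_lebesgue[OF D] integrable_on_subcbox by blast
  have zero: "integral (cbox a b) D = 0" if ab: "cbox a b \<subseteq> \<Omega>" for a b
  proof -
    have box: "box a b \<subseteq> \<Omega>" using ab box_subset_cbox by blast
    have "(\<lambda>n. LINT x|lebesgue_on \<Omega>. d x * box_bump (real (Suc n)) a b x) \<longlonglongrightarrow>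
        (LINT x|lebesgue_on \<Omega>. d x * indicator (box a b) x)"
    proof (rule integral_dominated_convergence[where w="\<lambda>x. norm (d x)"])
      have "box_bump (real (Suc n)) a b \<in> borel_measurable borel" for n
      proof -
        have "box_bump (real (Suc n)) a b \<in> test_functions \<Omega>"
          using ab by (intro box_bump_test_function) auto
        then have "C_k_on 0 UNIV (box_bump (real (Suc n)) a b)"
          unfolding test_functions_def smooth_on_open_def by blast
        then show ?thesis by (intro borel_measurable_continuous_onI) simp
      qed
      then show "(\<lambda>x. d x * box_bump (real (Suc n)) a b x) \<in> borel_measurable (lebesgue_on \<Omega>)" for n
        using d by (intro borel_measurable_times) (auto intro: borel_measurable_lebesgue_on)
      show "(\<lambda>x. d x * indicator (box a b) x) \<in> borel_measurable (lebesgue_on \<Omega>)"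
        by (rule borel_measurable_times[OF borel_measurable_integrable[OF d]
              borel_measurable_lebesgue_on[OF borel_measurable_indicator]]) simp
      show "AE x in lebesgue_on \<Omega>. (\<lambda>n. d x * box_bump (real (Suc n)) a b x) \<longlonglongrightarrow> d x * indicator (box a b) x"
        by (intro AE_I2 tendsto_intros box_bump_tendsto)
      show "AE x in lebesgue_on \<Omega>. norm (d x * box_bump (real (Suc n)) a b x) \<le> norm (d x)" for n
        by (intro AE_I2) (simp add: abs_mult abs_of_nonneg[OF box_bump_bounds(1)] mult_left_le box_bump_bounds(2))
    qed (use d in auto)
    then have lim0: "(LINT x|lebesgue_on \<Omega>. d x * indicator (box a b) x) = 0"
      using orth[OF box_bump_test_function[OF _ ab]] by (simp add: LIMSEQ_const_iff)
    have "integrable (lebesgue_on (box a b)) D"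
    proof -
      have "integrable lebesgue (\<lambda>x. indicator (box a b) x *\<^sub>R D x)"
        using D by (intro integrable_mult_indicator) auto
      then show ?thesis by (subst integrable_restrict_space) auto
    qed
    then have "integral (box a b) D = (LINT x|lebesgue_on (box a b). D x)"
      by (intro integral_unique has_integral_integral_lebesgue_on) auto
    also have "\<dots> = (LINT x|lebesgue. (if x \<in> box a b then D x else 0))"
      by (rule Lebesgue_Measure.integral_restrict_UNIV[symmetric]) auto
    also have "(\<lambda>x. if x \<in> box a b then D x else 0) = (\<lambda>x. if x \<in> \<Omega> then d x * indicator (box a b) x else 0)"
      using box by (auto simp: D_def indicator_def)
    also have "(LINT x|lebesgue. (if x \<in> \<Omega> then d x * indicator (box a b) x else 0)) = 0"
      using Lebesgue_Measure.integral_restrict_UNIV[OF \<Omega>] lim0 by metis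
    finally show ?thesis by (simp add: integral_open_interval)
  qed
  \<comment> \<open>Lebesgue differentiation along the cubes whose lower corner is
    \<open>x\<close>.\<close>
  obtain N where N: "negligible N" and conv: "\<And>x e. \<lbrakk>x \<notin> N; 0 < e\<rbrakk> \<Longrightarrow>
      \<exists>\<delta>>0. \<forall>h. 0 < h \<and> h < \<delta> \<longrightarrow>
        norm (integral (cbox x (x + h *\<^sub>R One)) D /\<^sub>R h ^ DIM(real^'n) - D x) < e"
    using integrable_ccontinuous_explicit[OF Dint] by blast
  have "d x = 0" if x: "x \<in> \<Omega>" "x \<notin> N" for x
  proof (rule ccontr)
    assume "d x \<noteq> 0"
    then obtain \<delta> where \<delta>: "\<delta> > 0" and h: "\<And>h. 0 < h \<Longrightarrow> h < \<delta> \<Longrightarrow>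
        norm (integral (cbox x (x + h *\<^sub>R One)) D /\<^sub>R h ^ DIM(real^'n) - D x) < \<bar>d x\<bar>"
      using conv[OF x(2), of "\<bar>d x\<bar>"] by auto
    obtain r where r: "r > 0" "ball x r \<subseteq> \<Omega>" using x(1) assms(1) openE by blast
    \<comment> \<open>The cube of side \<open>h0\<close> at \<open>x\<close> has diameter below
      \<open>h0 * c\<close>, hence lies in the ball, while \<open>h0 < \<delta>\<close> brings its
      average closer to \<open>d x\<close> than \<open>\<bar>d x\<bar>\<close>. The average is
      \<open>0\<close>, which is not that close.\<close>
    define c where "c = norm (One :: real^'n) + 1"
    define h0 where "h0 = min (\<delta> / 2) (r / 2 / c)"
    have c: "c > 0" unfolding c_def by (simp add: add_nonneg_pos)
    have h0: "h0 > 0" "h0 < \<delta>" using \<delta> r c by (auto simp: h0_def min_def)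
    have "cbox x (x + h0 *\<^sub>R One) \<subseteq> \<Omega>"
    proof
      fix y assume y: "y \<in> cbox x (x + h0 *\<^sub>R One)"
      have "norm (y - x) \<le> norm (h0 *\<^sub>R One :: real^'n)"
      proof (rule norm_le_componentwise)
        fix b :: "real^'n" assume "b \<in> Basis"
        then show "\<bar>(y - x) \<bullet> b\<bar> \<le> \<bar>(h0 *\<^sub>R One) \<bullet> b\<bar>"
          using y h0 by (auto simp: mem_box inner_diff_left inner_add_left algebra_simps)
      qed
      also have "\<dots> \<le> h0 * c" using h0 by (simp add: c_def)
      also have "\<dots> < r" using r c by (auto simp: h0_def min_def field_simps)
      finally show "y \<in> \<Omega>" using r by (auto simp: dist_norm norm_minus_commute)
    qed
    then show False using zero h[OF h0] x(1) by (simp add: D_def)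
  qed
  moreover have "AE x in lebesgue. x \<notin> N"
    using N by (simp add: AE_not_in negligible_iff_null_sets)
  ultimately show ?thesis
    unfolding ae_eq_def using \<Omega> by (subst AE_restrict_space_iff) auto
qed

section \<open>Weak derivatives\<close>

lemma test_function_has_derivative:
  assumes "\<phi> \<in> test_functions \<Omega>"
  shows "(\<phi> has_derivative frechet_derivative \<phi> (at x)) (at x)"
proof -
  have "C_k_on (Suc 0) UNIV \<phi>"
    using assms unfolding test_functions_def smooth_on_open_def by blast
  then show ?thesis by (simp add: frechet_derivative_works[symmetric])
qed

lemma test_function_partial:
  assumes "\<phi> \<in> test_functions \<Omega>"
  shows "continuous_on UNIV (partial i \<phi>)"
    and "\<And>x. x \<notin> closure {x. \<phi> x \<noteq> 0} \<Longrightarrow> partial i \<phi> x = 0"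
    and "\<exists>B\<ge>0. \<forall>x. \<bar>partial i \<phi> x\<bar> \<le> B"
proof -
  let ?K = "closure {x. \<phi> x \<noteq> 0}"
  have "C_k_on (Suc 0) UNIV \<phi>"
    using assms unfolding test_functions_def smooth_on_open_def by blast
  then show cont: "continuous_on UNIV (partial i \<phi>)"
    by (simp add: partial_def[abs_def] axis_in_Basis_iff)
  show zero: "partial i \<phi> x = 0" if x: "x \<notin> ?K" for x
  proof -
    have "(\<phi> has_derivative (\<lambda>h. 0)) (at x)"
      by (rule has_derivative_transform_within_open[of "\<lambda>_. 0" _ _ _ "- ?K"])
        (use x closure_subset[of "{x. \<phi> x \<noteq> 0}"] in \<open>auto simp: open_Compl\<close>)
    then show ?thesis unfolding partial_def using frechet_derivative_at by metis
  qed
  have "compact ?K" using assms by (simp add: test_functions_def)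
  then have "bounded (partial i \<phi> ` ?K)"
    using continuous_on_subset[OF cont] by (intro compact_imp_bounded compact_continuous_image) auto
  then obtain B where "\<forall>x\<in>?K. \<bar>partial i \<phi> x\<bar> \<le> B" by (auto simp: bounded_iff)
  then show "\<exists>B\<ge>0. \<forall>x. \<bar>partial i \<phi> x\<bar> \<le> B"
    using zero by (intro exI[of _ "max B 0"]) (metis abs_zero max.cobounded2 max.coboundedI1)
qed

section \<open>Lipschitz bounds and difference quotients\<close>

lemma onorm_le_sum_axis:
  fixes f :: "real^'n::finite \<Rightarrow> real"
  assumes "bounded_linear f" shows "onorm f \<le> (\<Sum>i\<in>UNIV. \<bar>f (axis i 1)\<bar>)"
proof -
  have B: "Basis = (\<lambda>i::'n. axis i (1::real)) ` UNIV" by (auto simp: Basis_vec_def)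
  have "inj (\<lambda>i::'n. axis i (1::real))" by (auto simp: inj_def axis_eq_axis)
  then have "(\<Sum>b\<in>Basis. norm (f b)) = (\<Sum>i\<in>UNIV. \<bar>f (axis i 1)\<bar>)"
    unfolding B by (simp only: sum.reindex o_def real_norm_def)
  with onorm_componentwise[OF assms] show ?thesis by simp
qed

text \<open>The mean value inequality on a convex set. The operator norm of the derivative is at
  most the sum of the absolute values of its \<open>CARD('n)\<close> partial derivatives, which
  gives the constant.\<close>

lemma lipschitz_on_partials_bounded:
  fixes f :: "real^'n::finite \<Rightarrow> real" and B :: real
  assumes "convex S" "\<And>x. x \<in> S \<Longrightarrow> (f has_derivative f' x) (at x)"
    "\<And>x i. x \<in> S \<Longrightarrow> \<bar>f' x (axis i 1)\<bar> \<le> B" "0 \<le> B"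
  shows "(CARD('n) * B)-lipschitz_on S f"
proof (rule lipschitz_onI)
  fix x y assume xy: "x \<in> S" "y \<in> S"
  have "onorm (f' x) \<le> CARD('n) * B" if "x \<in> S" for x
  proof -
    have "onorm (f' x) \<le> (\<Sum>i\<in>UNIV. \<bar>f' x (axis i 1)\<bar>)"
      by (rule onorm_le_sum_axis[OF has_derivative_bounded_linear[OF assms(2)[OF that]]])
    also have "\<dots> \<le> (\<Sum>i\<in>(UNIV::'n set). B)" using assms(3) that by (intro sum_mono) auto
    finally show ?thesis by simp
  qed
  then show "dist (f x) (f y) \<le> CARD('n) * B * dist x y"
    unfolding dist_norm
    using xy assms(2) has_derivative_at_withinI by (intro differentiable_bound[OF assms(1)]) blast+
qed (use assms(4) in simp)

lemma test_function_lipschitz: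
  fixes \<phi> :: "real^'n::finite \<Rightarrow> real"
  assumes "\<phi> \<in> test_functions \<Omega>"
  shows "\<exists>L. L-lipschitz_on UNIV \<phi>"
proof -
  obtain B where B: "\<And>i. B i \<ge> 0" "\<And>i x. \<bar>partial i \<phi> x\<bar> \<le> B i"
    using test_function_partial(3)[OF assms] by metis
  have "\<bar>partial i \<phi> x\<bar> \<le> (\<Sum>i\<in>UNIV. B i)" for i x
    using B member_le_sum[of i UNIV B] by (meson UNIV_I finite_class.finite_UNIV order_trans)
  then show ?thesis
    using lipschitz_on_partials_bounded[OF convex_UNIV test_function_has_derivative[OF assms], of "\<Sum>i\<in>UNIV. B i"] B
    unfolding partial_def by (auto simp: sum_nonneg)
qed

text \<open>Only the steps \<open>1 / (n + 1)\<close> are used, since dominated convergence and the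
  measurability of a limit are statements about sequences.\<close>

abbreviation diff_quot :: "('a::real_normed_vector \<Rightarrow> real) \<Rightarrow> 'a \<Rightarrow> nat \<Rightarrow> 'a \<Rightarrow> real" where
  "diff_quot f v n x \<equiv> (f (x + inverse (real (Suc n)) *\<^sub>R v) - f x) * real (Suc n)"

lemma directional_quotient_tendsto:
  fixes f :: "'a::real_normed_vector \<Rightarrow> real"
  assumes "(f has_derivative f') (at x)"
  shows "(\<lambda>n. diff_quot f v n x) \<longlonglongrightarrow> f' v"
proof -
  have "((\<lambda>h. f (x + h *\<^sub>R v)) has_derivative (\<lambda>h. f' (h *\<^sub>R v))) (at 0)"
    by (rule has_derivative_compose[of "\<lambda>h. x + h *\<^sub>R v" _ 0 _ f f', simplified])
      (auto intro!: derivative_eq_intros simp: assms)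
  then have "((\<lambda>h. f (x + h *\<^sub>R v)) has_real_derivative f' v) (at 0)"
    using linear_cmul[OF has_derivative_linear[OF assms]]
    by (simp add: has_field_derivative_def mult.commute[of _ "f' v"])
  then have lim: "((\<lambda>h. (f (x + h *\<^sub>R v) - f x) / h) \<longlongrightarrow> f' v) (at 0)"
    by (simp add: has_field_derivative_iff)
  have "filterlim (\<lambda>n. inverse (real (Suc n))) (at 0) sequentially"
    using LIMSEQ_inverse_real_of_nat by (simp add: filterlim_at)
  from filterlim_compose[OF lim this] show ?thesis by (simp add: divide_inverse)
qed

text \<open>Backward quotients are what the translation of an integral leaves on the test
  function.\<close>

lemma directional_quotient_tendsto':
  fixes f :: "'a::real_normed_vector \<Rightarrow> real"
  assumes "(f has_derivative f') (at x)"
  shows "(\<lambda>n. (f x - f (x - inverse (real (Suc n)) *\<^sub>R v)) * real (Suc n)) \<longlonglongrightarrow> f' v"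
  using tendsto_minus[OF directional_quotient_tendsto[OF assms, of "-v"]]
    linear_neg[OF has_derivative_linear[OF assms]]
  by (simp add: algebra_simps)

lemma lborel_integral_translation:
  fixes f :: "'a::euclidean_space \<Rightarrow> real"
  assumes "f \<in> borel_measurable borel"
  shows "(LINT x|lborel. f (c + x)) = (LINT x|lborel. f x)"
proof -
  have "(LINT x|lborel. f x) = (LINT x|distr lborel borel ((+) c). f x)"
    by (simp add: lborel_distr_plus)
  also have "\<dots> = (LINT x|lborel. f (c + x))"
    using assms by (intro integral_distr) auto
  finally show ?thesis by simp
qed

text \<open>Translation moves the difference quotient of the test function onto \<open>F\<close>; both quotients are
  dominated because both functions are Lipschitz.\<close>

lemma is_weak_partial_lipschitz:
  fixes F G :: "real^'n::finite \<Rightarrow> real"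
  assumes \<Omega>: "open \<Omega>" "bounded \<Omega>" and lip: "L-lipschitz_on \<Omega> F"
    and G: "G \<in> borel_measurable (lebesgue_on \<Omega>)"
    and conv: "AE x in lebesgue_on \<Omega>.
      (\<lambda>n. diff_quot F (axis i 1) n x) \<longlonglongrightarrow> G x"
  shows "is_weak_partial \<Omega> i F G"
proof -
  have L0: "L \<ge> 0" using lip by (simp add: lipschitz_on_def)
  have meas: "\<Omega> \<in> sets lebesgue" and lmeas: "\<Omega> \<in> lmeasurable"
    using lmeasurable_open[OF \<Omega>(2,1)] by (auto simp: fmeasurable_def)
  have shift: "\<bar>F (x + h *\<^sub>R axis i 1) - F x\<bar> \<le> L * h" if "x \<in> \<Omega>" "x + h *\<^sub>R axis i 1 \<in> \<Omega>" "h \<ge> 0" for x h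
    using lipschitz_onD[OF lip that(2,1)] that(3) by (simp add: dist_norm norm_axis_1)
  \<comment> \<open>Since \<Omega> is open, all late quotients at a point are bounded by
    \<open>L\<close>, and so is their limit; on a bounded domain this makes \<open>G\<close> square
    integrable.\<close>
  have Gb: "AE x in lebesgue_on \<Omega>. norm (G x) \<le> L"
    using conv AE_space
  proof eventually_elim
    case (elim x)
    then obtain r where r: "r > 0" "ball x r \<subseteq> \<Omega>" using \<Omega>(1) openE by (metis space_lebesgue_on)
    have "eventually (\<lambda>n. inverse (real (Suc n)) < r) sequentially"
      using LIMSEQ_inverse_real_of_nat r(1) order_tendstoD(2) by blast
    then have "eventually (\<lambda>n. \<bar>diff_quot F (axis i 1) n x\<bar> \<le> L) sequentially"
    proof eventually_elim
      case (elim n)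
      have "x + inverse (real (Suc n)) *\<^sub>R axis i 1 \<in> ball x r"
        using elim by (simp add: dist_norm norm_axis_1)
      then have "\<bar>F (x + inverse (real (Suc n)) *\<^sub>R axis i 1) - F x\<bar> \<le> L * inverse (real (Suc n))"
        using r \<open>x \<in> space (lebesgue_on \<Omega>)\<close> by (intro shift) auto
      then show ?case by (simp add: abs_mult divide_simps mult.commute)
    qed
    then show ?case
      using tendsto_upperbound[OF tendsto_rabs[OF elim(1)]] by simp
  qed
  have si: "square_integrable \<Omega> G" by (rule square_integrable_bounded[OF lmeas G Gb])
  \<comment> \<open>Extensions by zero, so that integrals over the whole space can be
    translated.\<close>
  define F0 where "F0 = (\<lambda>x. if x \<in> \<Omega> then F x else 0)"
  define G0 where "G0 = (\<lambda>x. if x \<in> \<Omega> then G x else 0)"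
  have F0m: "F0 \<in> borel_measurable borel"
    unfolding F0_def using \<Omega>(1) lipschitz_on_continuous_on[OF lip]
    by (intro borel_measurable_continuous_on_if) auto
  have G0m: "G0 \<in> borel_measurable lebesgue"
    unfolding G0_def using G borel_measurable_if[OF meas] by blast
  obtain B where B: "\<And>x. \<bar>F0 x\<bar> \<le> B"
  proof -
    have "bounded (F ` \<Omega>)"
      by (rule bounded_uniformly_continuous_image[OF lipschitz_on_uniformly_continuous[OF lip] \<Omega>(2)])
    then obtain B where "\<And>x. x \<in> \<Omega> \<Longrightarrow> \<bar>F x\<bar> \<le> B" by (auto simp: bounded_iff)
    then show ?thesis by (intro that[of "max B 0"]) (auto simp: F0_def le_max_iff_disj)
  qed
  have B0: "B \<ge> 0" using B[of undefined] by linarith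
  have "(LINT x|lebesgue_on \<Omega>. F x * partial i \<phi> x) = - (LINT x|lebesgue_on \<Omega>. G x * \<phi> x)"
    if \<phi>: "\<phi> \<in> test_functions \<Omega>" for \<phi>
  proof -
    let ?K = "closure {x. \<phi> x \<noteq> 0}"
    have K: "compact ?K" "?K \<subseteq> \<Omega>" using \<phi> by (auto simp: test_functions_def)
    obtain \<delta> where \<delta>: "\<delta> > 0" "(\<Union>x\<in>?K. ball x \<delta>) \<subseteq> \<Omega>"
      using compact_subset_open_imp_ball_epsilon_subset[OF K(1) \<Omega>(1) K(2)] by blast
    obtain L' where L': "L'-lipschitz_on UNIV \<phi>" using test_function_lipschitz[OF \<phi>] by blast
    have L'0: "L' \<ge> 0" using L' by (simp add: lipschitz_on_def)
    have \<phi>c: "continuous_on UNIV \<phi>" by (rule lipschitz_on_continuous_on[OF L'])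
    then have \<phi>m: "\<phi> \<in> borel_measurable borel" by (rule borel_measurable_continuous_onI)
    have \<phi>0: "\<phi> x = 0" if "x \<notin> \<Omega>" for x using that K(2) closure_subset[of "{x. \<phi> x \<noteq> 0}"] by auto
    have "\<exists>C. \<forall>x. \<bar>\<phi> x\<bar> \<le> C"
    proof -
      have "bounded (\<phi> ` ?K)"
        using continuous_on_subset[OF \<phi>c] K by (intro compact_imp_bounded compact_continuous_image) auto
      then obtain C where C: "\<And>x. x \<in> ?K \<Longrightarrow> \<bar>\<phi> x\<bar> \<le> C" by (auto simp: bounded_iff)
      have "\<bar>\<phi> x\<bar> \<le> max C 0" for x
        using C[of x] closure_subset[of "{x. \<phi> x \<noteq> 0}"] by (cases "\<phi> x = 0") (auto simp: subset_iff)
      then show ?thesis by blast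
    qed
    then obtain C where C: "\<And>x. \<bar>\<phi> x\<bar> \<le> C" by blast
    obtain N where N: "inverse (real (Suc N)) < \<delta>" using reals_Archimedean[OF \<delta>(1)] by blast
    \<comment> \<open>Starting the sequence at \<open>N\<close> keeps every step below
      \<open>\<delta>\<close>: translates of the support of \<open>\<phi>\<close> then stay in
      \<Omega>, where \<open>F\<close> is Lipschitz.\<close>
    define h where "h n = inverse (real (Suc (n + N)))" for n
    have h: "h n > 0" "h n < \<delta>" for n
    proof -
      show "h n > 0" by (simp add: h_def)
      have "h n \<le> inverse (real (Suc N))" by (simp add: h_def le_imp_inverse_le)
      then show "h n < \<delta>" using N by simp
    qed
    let ?e = "axis i (1::real) :: real^'n"
    define I1 where "I1 n x = F0 x * ((\<phi> x - \<phi> (x - h n *\<^sub>R ?e)) * inverse (h n))" for n x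
    define I2 where "I2 n x = (F0 (x + h n *\<^sub>R ?e) - F0 x) * inverse (h n) * \<phi> x" for n x
    have ind: "integrable lborel (\<lambda>x. indicator \<Omega> x * c :: real)" for c
      using \<Omega> emeasure_bounded_finite[of \<Omega>]
      by (intro integrable_mult_left integrable_real_indicator) (auto simp: borel_open)
    have integ: "integrable lborel (\<lambda>x. F0 x * \<phi> (x - c))" for c
    proof (rule Bochner_Integration.integrable_bound[OF ind[of "B * C"]])
      have "(\<lambda>x. \<phi> (x - c)) \<in> borel_measurable borel"
        by (rule measurable_compose[OF _ \<phi>m]) simp
      then show "(\<lambda>x. F0 x * \<phi> (x - c)) \<in> borel_measurable lborel" using F0m by simp
      have "\<bar>F0 x * \<phi> (x - c)\<bar> \<le> \<bar>indicator \<Omega> x * (B * C)\<bar>" for x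
      proof (cases "x \<in> \<Omega>")
        case True
        have "\<bar>F0 x * \<phi> (x - c)\<bar> \<le> B * C"
          unfolding abs_mult using B C B0 by (intro mult_mono) auto
        then show ?thesis using True by simp
      qed (simp add: F0_def)
      then show "AE x in lborel. norm (F0 x * \<phi> (x - c)) \<le> norm (indicator \<Omega> x * (B * C))" by simp
    qed
    have meas2: "(\<lambda>x. F0 (x + c) * \<phi> x) \<in> borel_measurable borel" for c
      using measurable_compose[OF _ F0m, of "\<lambda>x. x + c" borel] \<phi>m by (intro borel_measurable_times) auto
    have integ2: "integrable lborel (\<lambda>x. F0 (x + c) * \<phi> x)" for c
    proof (rule Bochner_Integration.integrable_bound[OF ind[of "B * C"]])
      show "(\<lambda>x. F0 (x + c) * \<phi> x) \<in> borel_measurable lborel" using meas2 by simp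
      have "\<bar>F0 (x + c) * \<phi> x\<bar> \<le> \<bar>indicator \<Omega> x * (B * C)\<bar>" for x
      proof (cases "x \<in> \<Omega>")
        case True
        have "\<bar>F0 (x + c) * \<phi> x\<bar> \<le> B * C"
          unfolding abs_mult using B C B0 by (intro mult_mono) auto
        then show ?thesis using True by simp
      qed (simp add: \<phi>0)
      then show "AE x in lborel. norm (F0 (x + c) * \<phi> x) \<le> norm (indicator \<Omega> x * (B * C))" by simp
    qed
    \<comment> \<open>Discrete integration by parts: substituting
      \<open>x + h n *\<^sub>R ?e\<close> for \<open>x\<close> in the translated term moves the
      quotient from \<open>\<phi>\<close> to \<open>F0\<close> and changes the sign.\<close>
    have I12: "(LINT x|lborel. I1 n x) = - (LINT x|lborel. I2 n x)" for n
    proof -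
      have "(LINT x|lborel. F0 x * \<phi> (x - h n *\<^sub>R ?e)) = (LINT x|lborel. F0 (x + h n *\<^sub>R ?e) * \<phi> x)"
        using lborel_integral_translation[of "\<lambda>x. F0 x * \<phi> (x - h n *\<^sub>R ?e)" "h n *\<^sub>R ?e"]
          measurable_compose[OF _ \<phi>m, of "\<lambda>x. x - h n *\<^sub>R ?e" borel] F0m
        by (simp add: add.commute)
      moreover have "I1 n = (\<lambda>x. (F0 x * \<phi> x - F0 x * \<phi> (x - h n *\<^sub>R ?e)) * inverse (h n))"
        "I2 n = (\<lambda>x. (F0 (x + h n *\<^sub>R ?e) * \<phi> x - F0 x * \<phi> x) * inverse (h n))"
        unfolding I1_def I2_def by (rule ext, algebra)+
      moreover have "integrable lborel (\<lambda>x. F0 x * \<phi> x)" using integ[of 0] by simp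
      ultimately show ?thesis using integ[of "h n *\<^sub>R ?e"] integ2[of "h n *\<^sub>R ?e"]
        by (simp add: Bochner_Integration.integral_diff left_diff_distrib)
    qed
    have I1m: "I1 n \<in> borel_measurable borel" for n
      unfolding I1_def[abs_def] using F0m \<phi>m measurable_compose[OF _ \<phi>m, of "\<lambda>x. x - h n *\<^sub>R ?e" borel]
      by (intro borel_measurable_times borel_measurable_diff) auto
    have I2m: "I2 n \<in> borel_measurable borel" for n
      unfolding I2_def[abs_def] using F0m \<phi>m measurable_compose[OF _ F0m, of "\<lambda>x. x + h n *\<^sub>R ?e" borel]
      by (intro borel_measurable_times borel_measurable_diff) auto
    have indl: "integrable lebesgue (\<lambda>x. indicator \<Omega> x * c :: real)" for c
      using lmeas by (intro integrable_mult_left integrable_real_indicator) (auto simp: fmeasurable_def)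
    have q: "inverse (h n) = real (Suc (n + N))" for n by (simp add: h_def)
    have dphi: "(\<lambda>n. (\<phi> x - \<phi> (x - h n *\<^sub>R ?e)) * inverse (h n)) \<longlonglongrightarrow> partial i \<phi> x" for x
      using LIMSEQ_ignore_initial_segment[OF directional_quotient_tendsto'[OF test_function_has_derivative[OF \<phi>], of x ?e], of N]
      by (simp only: h_def inverse_inverse_eq partial_def)
    have lim1: "(\<lambda>n. LINT x|lebesgue. I1 n x) \<longlonglongrightarrow> (LINT x|lebesgue. F0 x * partial i \<phi> x)"
    proof (rule integral_dominated_convergence[where w="\<lambda>x. indicator \<Omega> x * (B * L')"])
      show "(\<lambda>x. F0 x * partial i \<phi> x) \<in> borel_measurable lebesgue"
        using F0m borel_measurable_continuous_onI[OF test_function_partial(1)[OF \<phi>]]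
        by (intro measurable_completion) auto
      show "I1 n \<in> borel_measurable lebesgue" for n using I1m by (intro measurable_completion) auto
      show "AE x in lebesgue. (\<lambda>n. I1 n x) \<longlonglongrightarrow> F0 x * partial i \<phi> x"
        unfolding I1_def by (intro AE_I2 tendsto_intros dphi)
      have "\<bar>I1 n x\<bar> \<le> indicator \<Omega> x * (B * L')" for n x
      proof (cases "x \<in> \<Omega>")
        case True
        have "\<bar>\<phi> x - \<phi> (x - h n *\<^sub>R ?e)\<bar> \<le> L' * h n"
          using lipschitz_onD[OF L', of x "x - h n *\<^sub>R ?e"] h[of n] by (simp add: dist_norm norm_axis_1)
        then have "\<bar>(\<phi> x - \<phi> (x - h n *\<^sub>R ?e)) * inverse (h n)\<bar> \<le> L'"
          using h[of n] by (simp add: abs_mult field_simps)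
        then show ?thesis
          using True unfolding I1_def abs_mult[of "F0 x"] by (auto intro!: mult_mono B B0)
      qed (simp add: I1_def F0_def)
      then show "AE x in lebesgue. norm (I1 n x) \<le> indicator \<Omega> x * (B * L')" for n by simp
    qed (rule indl)
    have lim2: "(\<lambda>n. LINT x|lebesgue. I2 n x) \<longlonglongrightarrow> (LINT x|lebesgue. G0 x * \<phi> x)"
    proof (rule integral_dominated_convergence[where w="\<lambda>x. indicator \<Omega> x * (L * C)"])
      show "(\<lambda>x. G0 x * \<phi> x) \<in> borel_measurable lebesgue"
        using G0m measurable_completion[of \<phi> lborel borel] \<phi>m by (intro borel_measurable_times) auto
      show "I2 n \<in> borel_measurable lebesgue" for n using I2m by (intro measurable_completion) auto
      have in\<Omega>: "x + h n *\<^sub>R ?e \<in> \<Omega>" if "\<phi> x \<noteq> 0" for x n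
      proof -
        have "x \<in> ?K" using that closure_subset[of "{x. \<phi> x \<noteq> 0}"] by auto
        moreover have "x + h n *\<^sub>R ?e \<in> ball x \<delta>" using h[of n] by (simp add: dist_norm norm_axis_1)
        ultimately show ?thesis using \<delta>(2) by blast
      qed
      \<comment> \<open>The jump of \<open>F0\<close> at the boundary would spoil the Lipschitz
        bound; the test function confines the quotient to points where \<open>F0\<close> is
        \<open>F\<close>.\<close>
      have I2eq: "I2 n x = (F (x + h n *\<^sub>R ?e) - F x) * inverse (h n) * \<phi> x" for n x
        using in\<Omega>[of x n] \<phi>0[of x] by (cases "\<phi> x = 0") (auto simp: I2_def F0_def)
      have "AE x in lebesgue. x \<in> \<Omega> \<longrightarrow>
          (\<lambda>n. diff_quot F (axis i 1) n x) \<longlonglongrightarrow> G x"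
        using conv meas by (subst (asm) AE_restrict_space_iff) auto
      then show "AE x in lebesgue. (\<lambda>n. I2 n x) \<longlonglongrightarrow> G0 x * \<phi> x"
      proof eventually_elim
        case (elim x)
        show ?case
        proof (cases "x \<in> \<Omega>")
          case True
          then have "(\<lambda>n. (F (x + h n *\<^sub>R ?e) - F x) * inverse (h n)) \<longlonglongrightarrow> G x"
            using LIMSEQ_ignore_initial_segment[of _ _ N] elim unfolding h_def inverse_inverse_eq by blast
          then show ?thesis unfolding I2eq using True by (auto simp: G0_def intro: tendsto_intros)
        qed (simp add: I2eq \<phi>0)
      qed
      have "\<bar>I2 n x\<bar> \<le> indicator \<Omega> x * (L * C)" for n x
      proof (cases "\<phi> x = 0")
        case False
        then have "x \<in> \<Omega>" "x + h n *\<^sub>R ?e \<in> \<Omega>" using \<phi>0 in\<Omega> by auto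
        then have "\<bar>F (x + h n *\<^sub>R ?e) - F x\<bar> \<le> L * h n" using h[of n] by (intro shift) auto
        then have "\<bar>(F (x + h n *\<^sub>R ?e) - F x) * inverse (h n)\<bar> \<le> L"
          using h[of n] by (simp add: abs_mult field_simps)
        then show ?thesis
          using \<open>x \<in> \<Omega>\<close> C L0 unfolding I2eq abs_mult[of _ "\<phi> x"] by (auto intro!: mult_mono)
      qed (use L0 C[of x] in \<open>auto simp: I2eq indicator_def\<close>)
      then show "AE x in lebesgue. norm (I2 n x) \<le> indicator \<Omega> x * (L * C)" for n by simp
    qed (rule indl)
    \<comment> \<open>\<open>G\<close> is merely Lebesgue measurable, so the limits are taken over
      \<open>lebesgue\<close>, whereas translation is carried out over \<open>lborel\<close>; for
      the Borel functions \<open>I1 n\<close> and \<open>I2 n\<close> both integrals agree.\<close>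
    have "(LINT x|lebesgue. I1 n x) = - (LINT x|lebesgue. I2 n x)" for n
      using I12[of n] I1m I2m by (simp add: integral_completion)
    then have "(LINT x|lebesgue. F0 x * partial i \<phi> x) = - (LINT x|lebesgue. G0 x * \<phi> x)"
      using LIMSEQ_unique[OF lim1] tendsto_minus[OF lim2] by simp
    moreover have "(LINT x|lebesgue. F0 x * partial i \<phi> x) = (LINT x|lebesgue_on \<Omega>. F x * partial i \<phi> x)"
      by (subst Lebesgue_Measure.integral_restrict_UNIV[OF meas, symmetric])
        (auto simp: F0_def intro!: Bochner_Integration.integral_cong)
    moreover have "(LINT x|lebesgue. G0 x * \<phi> x) = (LINT x|lebesgue_on \<Omega>. G x * \<phi> x)"
      by (subst Lebesgue_Measure.integral_restrict_UNIV[OF meas, symmetric])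
        (auto simp: G0_def intro!: Bochner_Integration.integral_cong)
    ultimately show ?thesis by simp
  qed
  with si show ?thesis by (simp add: is_weak_partial_def)
qed

text \<open>Convexity turns the bounds on the partial derivatives into the Lipschitz bound that
  dominates the difference quotients.\<close>

lemma is_weak_partial_classical:
  fixes F :: "real^'n::finite \<Rightarrow> real"
  assumes \<Omega>: "open \<Omega>" "bounded \<Omega>" "convex \<Omega>"
    and F: "\<And>x. x \<in> \<Omega> \<Longrightarrow> (F has_derivative F' x) (at x)"
    and bound: "\<And>x j. x \<in> \<Omega> \<Longrightarrow> \<bar>F' x (axis j 1)\<bar> \<le> B"
    and cont: "continuous_on \<Omega> (\<lambda>x. F' x (axis i 1))"
  shows "is_weak_partial \<Omega> i F (\<lambda>x. F' x (axis i 1))"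
proof (rule is_weak_partial_lipschitz[OF \<Omega>(1,2)])
  \<comment> \<open>\<open>max B 0\<close>, since an empty \<Omega> would not force \<open>B\<close>
    to be nonnegative.\<close>
  have "(CARD('n) * max B 0)-lipschitz_on \<Omega> F"
    using bound by (intro lipschitz_on_partials_bounded[OF \<Omega>(3) F]) (auto simp: le_max_iff_disj)
  then show "(CARD('n) * max B 0)-lipschitz_on \<Omega> F" .
  show "(\<lambda>x. F' x (axis i 1)) \<in> borel_measurable (lebesgue_on \<Omega>)"
    using cont \<Omega>(1) by (intro continuous_imp_measurable_on_sets_lebesgue) (auto simp: borel_open sets_completionI_sets)
  show "AE x in lebesgue_on \<Omega>.
      (\<lambda>n. diff_quot F (axis i 1) n x) \<longlonglongrightarrow> F' x (axis i 1)"
    by (rule AE_I2) (simp add: F directional_quotient_tendsto del: of_nat_Suc)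
qed

lemma test_function_square_integrable:
  assumes "\<phi> \<in> test_functions \<Omega>" "open \<Omega>" "bounded \<Omega>"
  shows "square_integrable \<Omega> \<phi>"
proof -
  obtain L where L: "L-lipschitz_on UNIV \<phi>" using test_function_lipschitz[OF assms(1)] by blast
  have "bounded (\<phi> ` \<Omega>)"
    by (rule bounded_uniformly_continuous_image[OF lipschitz_on_uniformly_continuous assms(3)])
      (rule lipschitz_on_subset[OF L subset_UNIV])
  then obtain B where "\<And>x. x \<in> \<Omega> \<Longrightarrow> norm (\<phi> x) \<le> B" by (auto simp: bounded_iff)
  then show ?thesis
    using lmeasurable_open[OF assms(3,2)] lipschitz_on_continuous_on[OF L]
    by (intro square_integrable_bounded[of _ _ B] borel_measurable_lebesgue_on borel_measurable_continuous_onI)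
      (auto intro: AE_I2)
qed

lemma test_function_is_weak_partial:
  fixes \<phi> :: "real^'n::finite \<Rightarrow> real"
  assumes \<phi>: "\<phi> \<in> test_functions \<Omega>" and \<Omega>: "open \<Omega>" "bounded \<Omega>"
  shows "is_weak_partial \<Omega> i \<phi> (partial i \<phi>)"
proof -
  obtain L where L: "L-lipschitz_on UNIV \<phi>" using test_function_lipschitz[OF \<phi>] by blast
  show ?thesis
  proof (rule is_weak_partial_lipschitz[OF \<Omega> lipschitz_on_subset[OF L subset_UNIV]])
    show "partial i \<phi> \<in> borel_measurable (lebesgue_on \<Omega>)"
      by (intro borel_measurable_lebesgue_on borel_measurable_continuous_onI test_function_partial(1)[OF \<phi>])
    show "AE x in lebesgue_on \<Omega>.
        (\<lambda>n. diff_quot \<phi> (axis i 1) n x) \<longlonglongrightarrow> partial i \<phi> x"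
      unfolding partial_def
      by (intro AE_I2 directional_quotient_tendsto test_function_has_derivative[OF \<phi>])
  qed
qed

section \<open>Calculus of weak derivatives on bounded open sets\<close>

context
  fixes \<Omega> :: "(real^'n::finite) set"
  assumes \<Omega>: "open \<Omega>" "bounded \<Omega>"
begin

lemma weak_partial_unique:
  assumes "is_weak_partial \<Omega> i f g" "is_weak_partial \<Omega> i f g'"
  shows "ae_eq \<Omega> g g'"
proof -
  have si: "square_integrable \<Omega> g" "square_integrable \<Omega> g'"
    using assms by (auto simp: is_weak_partial_def)
  have "ae_eq \<Omega> (\<lambda>x. g x - g' x) (\<lambda>x. 0)"
  proof (rule AE_zero_if_orthogonal_to_test_functions[OF \<Omega>(1)])
    show "integrable (lebesgue_on \<Omega>) (\<lambda>x. g x - g' x)"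
      by (intro integrable_of_square_integrable[OF lmeasurable_open[OF \<Omega>(2,1)]] square_integrable_diff si)
    fix \<phi> assume \<phi>: "\<phi> \<in> test_functions \<Omega>"
    have "l2_inner \<Omega> (\<lambda>x. g x - g' x) \<phi> = l2_inner \<Omega> g \<phi> - l2_inner \<Omega> g' \<phi>"
      using si test_function_square_integrable[OF \<phi> \<Omega>] by (intro L2.ip_diff_left) auto
    also have "\<dots> = 0" using assms \<phi> by (simp add: l2_inner_def is_weak_partial_def)
    finally show "(LINT x|lebesgue_on \<Omega>. (g x - g' x) * \<phi> x) = 0" by (simp add: l2_inner_def)
  qed
  then show ?thesis by (simp add: ae_eq_def)
qed

lemma is_weak_partial_weak_partial:
  "is_weak_partial \<Omega> i f g \<Longrightarrow> is_weak_partial \<Omega> i f (weak_partial \<Omega> i f)"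
  unfolding weak_partial_def by (rule someI[of "is_weak_partial \<Omega> i f"])

lemma weak_partial_ae_eq:
  "is_weak_partial \<Omega> i f g \<Longrightarrow> ae_eq \<Omega> (weak_partial \<Omega> i f) g"
  using is_weak_partial_weak_partial weak_partial_unique by blast

lemma H1_is_weak_partial: "f \<in> H1 \<Omega> \<Longrightarrow> is_weak_partial \<Omega> i f (weak_partial \<Omega> i f)"
  using is_weak_partial_weak_partial unfolding H1_def by blast

lemma partial_test_function_square_integrable:
  "\<phi> \<in> test_functions \<Omega> \<Longrightarrow> square_integrable \<Omega> (partial i \<phi>)"
  using test_function_is_weak_partial[OF _ \<Omega>] by (auto simp: is_weak_partial_def)

text \<open>Phrasing by \<open>l2_inner\<close> lets the linearity rules below be read off the
  semi-inner product structure.\<close>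

lemma is_weak_partial_iff:
  "is_weak_partial \<Omega> i f g \<longleftrightarrow> square_integrable \<Omega> g \<and>
     (\<forall>\<phi>\<in>test_functions \<Omega>. l2_inner \<Omega> f (partial i \<phi>) = - l2_inner \<Omega> g \<phi>)"
  by (simp add: is_weak_partial_def l2_inner_def)

lemma is_weak_partial_add:
  assumes "is_weak_partial \<Omega> i f f'" "is_weak_partial \<Omega> i g g'"
    and "square_integrable \<Omega> f" "square_integrable \<Omega> g"
  shows "is_weak_partial \<Omega> i (\<lambda>x. f x + g x) (\<lambda>x. f' x + g' x)"
  using assms partial_test_function_square_integrable test_function_square_integrable[OF _ \<Omega>]
  by (auto simp: is_weak_partial_iff square_integrable_add L2.ip_add_left)

lemma is_weak_partial_scale:
  assumes "is_weak_partial \<Omega> i f f'" "square_integrable \<Omega> f"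
  shows "is_weak_partial \<Omega> i (\<lambda>x. c * f x) (\<lambda>x. c * f' x)"
proof -
  have si: "square_integrable \<Omega> f'" using assms by (simp add: is_weak_partial_def)
  have "l2_inner \<Omega> (\<lambda>x. c * f x) (partial i \<phi>) = - l2_inner \<Omega> (\<lambda>x. c * f' x) \<phi>"
    if "\<phi> \<in> test_functions \<Omega>" for \<phi>
    using assms that L2.ip_scale_left[of f \<Omega> "partial i \<phi>" c] L2.ip_scale_left[of f' \<Omega> \<phi> c] si
      partial_test_function_square_integrable[OF that] test_function_square_integrable[OF that \<Omega>]
    by (simp add: is_weak_partial_iff)
  then show ?thesis using square_integrable_scaleR[OF si, of c] by (simp add: is_weak_partial_iff)
qed

lemma is_weak_partial_zero: "is_weak_partial \<Omega> i (\<lambda>x. 0) (\<lambda>x. 0)"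
  by (simp add: is_weak_partial_def square_integrable_zero)

lemma is_weak_partial_const: "is_weak_partial \<Omega> i (\<lambda>x. c) (\<lambda>x. 0)"
  by (rule is_weak_partial_lipschitz[OF \<Omega>, of 0]) (auto simp: lipschitz_on_def)

lemma is_weak_partial_diff:
  assumes "is_weak_partial \<Omega> i f f'" "is_weak_partial \<Omega> i g g'"
    and "square_integrable \<Omega> f" "square_integrable \<Omega> g"
  shows "is_weak_partial \<Omega> i (\<lambda>x. f x - g x) (\<lambda>x. f' x - g' x)"
  using is_weak_partial_add[OF assms(1) is_weak_partial_scale[OF assms(2,4), of "-1"] assms(3)]
    square_integrable_scaleR[OF assms(4), of "-1"] by simp

lemma is_weak_partial_sum:
  assumes "\<And>a. a \<in> A \<Longrightarrow> is_weak_partial \<Omega> i (f a) (f' a)" "\<And>a. a \<in> A \<Longrightarrow> square_integrable \<Omega> (f a)"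
  shows "is_weak_partial \<Omega> i (\<lambda>x. \<Sum>a\<in>A. c a * f a x) (\<lambda>x. \<Sum>a\<in>A. c a * f' a x)"
  using assms
proof (induction A rule: infinite_finite_induct)
  case (insert a A)
  have si: "square_integrable \<Omega> (\<lambda>x. c b * f b x)" if "b \<in> insert a A" for b
    using square_integrable_scaleR[OF insert.prems(2)[OF that], of "c b"] by simp
  have "is_weak_partial \<Omega> i (\<lambda>x. c a * f a x + (\<Sum>a\<in>A. c a * f a x)) (\<lambda>x. c a * f' a x + (\<Sum>a\<in>A. c a * f' a x))"
    using insert.prems insert.IH si by (intro is_weak_partial_add is_weak_partial_scale square_integrable_sum) auto
  then show ?case using insert.hyps by simp
qed (simp_all add: is_weak_partial_zero)

lemma H1_I:
  "square_integrable \<Omega> f \<Longrightarrow> (\<And>i. is_weak_partial \<Omega> i f (g i)) \<Longrightarrow> f \<in> H1 \<Omega>"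
  by (auto simp: H1_def)

lemma test_function_H1: "\<phi> \<in> test_functions \<Omega> \<Longrightarrow> \<phi> \<in> H1 \<Omega>"
  using test_function_square_integrable[OF _ \<Omega>] test_function_is_weak_partial[OF _ \<Omega>] by (rule H1_I)

lemma H1_square_integrable: "f \<in> H1 \<Omega> \<Longrightarrow> square_integrable \<Omega> f"
  by (simp add: H1_def)

lemma H1_weak_partial_square_integrable: "f \<in> H1 \<Omega> \<Longrightarrow> square_integrable \<Omega> (weak_partial \<Omega> i f)"
  using H1_is_weak_partial by (auto simp: is_weak_partial_def)

lemma H1_add: "f \<in> H1 \<Omega> \<Longrightarrow> g \<in> H1 \<Omega> \<Longrightarrow> (\<lambda>x. f x + g x) \<in> H1 \<Omega>"
  by (rule H1_I[OF square_integrable_add is_weak_partial_add[OF H1_is_weak_partial H1_is_weak_partial]])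
    (simp_all add: H1_square_integrable)

lemma H1_scale: "f \<in> H1 \<Omega> \<Longrightarrow> (\<lambda>x. c * f x) \<in> H1 \<Omega>"
  using square_integrable_scaleR[of \<Omega> f c]
  by (intro H1_I[of _ "\<lambda>i x. c * weak_partial \<Omega> i f x"] is_weak_partial_scale)
    (auto intro: H1_is_weak_partial H1_square_integrable)

lemma H1_diff: "f \<in> H1 \<Omega> \<Longrightarrow> g \<in> H1 \<Omega> \<Longrightarrow> (\<lambda>x. f x - g x) \<in> H1 \<Omega>"
  using H1_add[OF _ H1_scale[of g "-1"], of f] by simp

lemma weak_partial_add:
  "f \<in> H1 \<Omega> \<Longrightarrow> g \<in> H1 \<Omega> \<Longrightarrow>
    ae_eq \<Omega> (weak_partial \<Omega> i (\<lambda>x. f x + g x)) (\<lambda>x. weak_partial \<Omega> i f x + weak_partial \<Omega> i g x)"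
  by (intro weak_partial_ae_eq is_weak_partial_add H1_is_weak_partial H1_square_integrable)

lemma weak_partial_scale:
  "f \<in> H1 \<Omega> \<Longrightarrow> ae_eq \<Omega> (weak_partial \<Omega> i (\<lambda>x. c * f x)) (\<lambda>x. c * weak_partial \<Omega> i f x)"
  by (intro weak_partial_ae_eq is_weak_partial_scale H1_is_weak_partial H1_square_integrable)

text \<open>The defining identity sees \<open>f\<close> only through integrals, so \<open>0\<close>
  is a weak derivative too. Consequently forms in weak derivatives respect almost everywhere
  equality.\<close>

lemma weak_partial_null:
  assumes "f \<in> H1 \<Omega>" "ae_eq \<Omega> f (\<lambda>x. 0)"
  shows "ae_eq \<Omega> (weak_partial \<Omega> i f) (\<lambda>x. 0)"
proof (rule weak_partial_ae_eq)
  have "l2_inner \<Omega> f (partial i \<phi>) = 0" if "\<phi> \<in> test_functions \<Omega>" for \<phi>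
    using l2_inner_cong_AE[OF assms(2) ae_eq_refl H1_square_integrable[OF assms(1)] square_integrable_zero]
      partial_test_function_square_integrable[OF that] by (simp add: l2_inner_def)
  then show "is_weak_partial \<Omega> i f (\<lambda>x. 0)"
    by (simp add: is_weak_partial_iff square_integrable_zero) (simp add: l2_inner_def)
qed

lemma weak_grad_square_integrable:
  "f \<in> H1 \<Omega> \<Longrightarrow> square_integrable \<Omega> (weak_grad \<Omega> f)"
  by (intro square_integrable_vec) (simp add: weak_grad_def H1_weak_partial_square_integrable)

lemma l2_norm_weak_partial_le:
  assumes "f \<in> H1 \<Omega>" shows "l2_norm \<Omega> (weak_partial \<Omega> i f) \<le> l2_norm \<Omega> (weak_grad \<Omega> f)"
proof -
  have "l2_inner \<Omega> (weak_partial \<Omega> i f) (weak_partial \<Omega> i f)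
      \<le> (\<Sum>i\<in>UNIV. l2_inner \<Omega> (weak_partial \<Omega> i f) (weak_partial \<Omega> i f))"
    by (rule member_le_sum) (auto simp: L2.ip_nonneg H1_weak_partial_square_integrable assms)
  also have "\<dots> = l2_inner \<Omega> (weak_grad \<Omega> f) (weak_grad \<Omega> f)"
    by (subst l2_inner_vec) (simp_all add: weak_grad_square_integrable assms weak_grad_def)
  finally show ?thesis by (simp add: l2_norm_def)
qed

text \<open>For a test function in place of \<open>v\<close> this is the definition of
  \<open>G\<close>. The defect is continuous in \<open>v\<close> for the H1 norm and test functions
  are dense in \<open>H1_0\<close>, so it vanishes; the boundary behaviour of \<open>F\<close> never
  enters.\<close>

lemma H1_0_integration_by_parts:
  assumes v: "v \<in> H1_0 \<Omega>" and F: "square_integrable \<Omega> F" and G: "is_weak_partial \<Omega> i F G"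
  shows "l2_inner \<Omega> F (weak_partial \<Omega> i v) = - l2_inner \<Omega> G v"
proof -
  have vH: "v \<in> H1 \<Omega>" using v by (simp add: H1_0_def)
  have Gs: "square_integrable \<Omega> G" using G by (simp add: is_weak_partial_def)
  have nn: "l2_norm \<Omega> F \<ge> 0" "l2_norm \<Omega> G \<ge> 0"
    using L2.ip_nonneg F Gs by (auto simp: l2_norm_def)
  let ?d = "l2_inner \<Omega> F (weak_partial \<Omega> i v) + l2_inner \<Omega> G v"
  have bound: "\<bar>?d\<bar> \<le> (l2_norm \<Omega> F + l2_norm \<Omega> G) * \<epsilon>" if \<epsilon>: "\<epsilon> > 0" for \<epsilon>
  proof -
    obtain \<phi> where \<phi>: "\<phi> \<in> test_functions \<Omega>"
      and less: "(l2_norm \<Omega> (\<lambda>x. v x - \<phi> x))\<^sup>2 + (l2_norm \<Omega> (weak_grad \<Omega> (\<lambda>x. v x - \<phi> x)))\<^sup>2 < \<epsilon>\<^sup>2"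
      using v \<epsilon> by (auto simp: H1_0_def)
    let ?w = "\<lambda>x. v x - \<phi> x"
    have w: "?w \<in> H1 \<Omega>" by (intro H1_diff vH test_function_H1 \<phi>)
    have le: "l2_norm \<Omega> ?w \<le> \<epsilon>" "l2_norm \<Omega> (weak_grad \<Omega> ?w) \<le> \<epsilon>"
      using less \<epsilon> by (smt (verit) power2_le_imp_le zero_le_power2)+
    have si: "square_integrable \<Omega> (weak_partial \<Omega> i v)" "square_integrable \<Omega> (partial i \<phi>)"
      "square_integrable \<Omega> v" "square_integrable \<Omega> \<phi>" "square_integrable \<Omega> (weak_partial \<Omega> i ?w)"
      "square_integrable \<Omega> ?w"
      using vH w \<phi> H1_weak_partial_square_integrable partial_test_function_square_integrable
        H1_square_integrable test_function_square_integrable[OF _ \<Omega>] by auto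
    have "ae_eq \<Omega> (weak_partial \<Omega> i ?w) (\<lambda>x. weak_partial \<Omega> i v x - partial i \<phi> x)"
      using H1_is_weak_partial[OF vH] test_function_is_weak_partial[OF \<phi> \<Omega>] si
      by (intro weak_partial_ae_eq is_weak_partial_diff)
    then have "l2_inner \<Omega> F (weak_partial \<Omega> i ?w) = l2_inner \<Omega> F (\<lambda>x. weak_partial \<Omega> i v x - partial i \<phi> x)"
      using F si by (intro l2_inner_cong_AE ae_eq_refl square_integrable_diff)
    also have "\<dots> = l2_inner \<Omega> F (weak_partial \<Omega> i v) - l2_inner \<Omega> F (partial i \<phi>)"
      using F si by (simp add: L2.ip_diff_right)
    also have "l2_inner \<Omega> F (partial i \<phi>) = - l2_inner \<Omega> G \<phi>"
      using G \<phi> by (simp add: is_weak_partial_iff)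
    finally have "?d = l2_inner \<Omega> F (weak_partial \<Omega> i ?w) + l2_inner \<Omega> G ?w"
      using Gs si by (simp add: L2.ip_diff_right)
    also have "\<bar>\<dots>\<bar> \<le> l2_norm \<Omega> F * l2_norm \<Omega> (weak_partial \<Omega> i ?w) + l2_norm \<Omega> G * l2_norm \<Omega> ?w"
      using l2_inner_abs_le[OF F si(5)] l2_inner_abs_le[OF Gs si(6)] by linarith
    also have "\<dots> \<le> l2_norm \<Omega> F * \<epsilon> + l2_norm \<Omega> G * \<epsilon>"
      using le l2_norm_weak_partial_le[OF w, of i] nn by (intro add_mono mult_left_mono) auto
    finally show ?thesis by (simp add: algebra_simps)
  qed
  have "?d = 0"
  proof (rule ccontr)
    assume ne: "?d \<noteq> 0"
    \<comment> \<open>One more than the factor in \<open>bound\<close>; with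
      \<open>\<bar>?d\<bar> / ?c\<close> as \<open>\<epsilon>\<close> the defect would be smaller
      than itself.\<close>
    let ?c = "l2_norm \<Omega> F + l2_norm \<Omega> G + 1"
    have c: "?c > 0" using nn by simp
    have "\<bar>?d\<bar> \<le> (?c - 1) * (\<bar>?d\<bar> / ?c)" using bound[of "\<bar>?d\<bar> / ?c"] ne c by simp
    also have "\<dots> < ?c * (\<bar>?d\<bar> / ?c)" using ne c by (intro mult_strict_right_mono) auto
    also have "\<dots> = \<bar>?d\<bar>" using c by simp
    finally show False by simp
  qed
  then show ?thesis by simp
qed

end

section \<open>Continuous piecewise polynomials\<close>

lemma finite_multi_indices: "finite {\<alpha> :: 'n::finite \<Rightarrow> nat. (\<Sum>i\<in>UNIV. \<alpha> i) \<le> k}"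
proof (rule finite_subset)
  show "{\<alpha> :: 'n \<Rightarrow> nat. (\<Sum>i\<in>UNIV. \<alpha> i) \<le> k} \<subseteq> PiE UNIV (\<lambda>_. {..k})"
  proof
    fix \<alpha> :: "'n \<Rightarrow> nat" assume "\<alpha> \<in> {\<alpha>. sum \<alpha> UNIV \<le> k}"
    then have "\<alpha> i \<le> k" for i using member_le_sum[of i UNIV \<alpha>] by simp
    then show "\<alpha> \<in> PiE UNIV (\<lambda>_. {..k})" by auto
  qed
qed (simp add: finite_PiE)

lemma poly_deg_le_mono:
  assumes "poly_deg_le m P" "m \<le> n" shows "poly_deg_le n P"
proof -
  obtain c where c: "\<And>x. P x = (\<Sum>\<alpha> | (\<Sum>i\<in>UNIV. \<alpha> i) \<le> m. c \<alpha> * (\<Prod>i\<in>UNIV. (x $ i) ^ \<alpha> i))"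
    using assms(1) by (auto simp: poly_deg_le_def)
  have "P x = (\<Sum>\<alpha> | (\<Sum>i\<in>UNIV. \<alpha> i) \<le> n. (if (\<Sum>i\<in>UNIV. \<alpha> i) \<le> m then c \<alpha> else 0) * (\<Prod>i\<in>UNIV. (x $ i) ^ \<alpha> i))" for x
    unfolding c using assms(2) by (intro sum.mono_neutral_cong_left finite_multi_indices) auto
  then show ?thesis unfolding poly_deg_le_def by (intro exI allI)
qed

lemma poly_deg_le_add:
  assumes "poly_deg_le n P" "poly_deg_le n R" shows "poly_deg_le n (\<lambda>x. P x + R x)"
proof -
  obtain c d where c: "\<And>x. P x = (\<Sum>\<alpha> | (\<Sum>i\<in>UNIV. \<alpha> i) \<le> n. c \<alpha> * (\<Prod>i\<in>UNIV. (x $ i) ^ \<alpha> i))"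
    and d: "\<And>x. R x = (\<Sum>\<alpha> | (\<Sum>i\<in>UNIV. \<alpha> i) \<le> n. d \<alpha> * (\<Prod>i\<in>UNIV. (x $ i) ^ \<alpha> i))"
    using assms by (auto simp: poly_deg_le_def)
  show ?thesis
    unfolding poly_deg_le_def by (intro exI[of _ "\<lambda>\<alpha>. c \<alpha> + d \<alpha>"]) (simp add: c d sum.distrib algebra_simps)
qed

lemma poly_deg_le_scale:
  assumes "poly_deg_le n P" shows "poly_deg_le n (\<lambda>x. b * P x)"
proof -
  obtain c where c: "\<And>x. P x = (\<Sum>\<alpha> | (\<Sum>i\<in>UNIV. \<alpha> i) \<le> n. c \<alpha> * (\<Prod>i\<in>UNIV. (x $ i) ^ \<alpha> i))"
    using assms by (auto simp: poly_deg_le_def)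
  show ?thesis
    unfolding poly_deg_le_def by (intro exI[of _ "\<lambda>\<alpha>. b * c \<alpha>"]) (simp add: c sum_distrib_left algebra_simps)
qed

lemma poly_deg_le_const: "poly_deg_le n (\<lambda>x. b)"
proof (rule poly_deg_le_mono)
  have "{\<alpha> :: 'a \<Rightarrow> nat. (\<Sum>i\<in>UNIV. \<alpha> i) \<le> 0} = {\<lambda>_. 0}" by auto
  then show "poly_deg_le 0 (\<lambda>x::real^'a. b)"
    unfolding poly_deg_le_def by (intro exI[of _ "\<lambda>_. b"]) simp
qed simp

lemma poly_deg_le_sum:
  "(\<And>a. a \<in> A \<Longrightarrow> poly_deg_le n (P a)) \<Longrightarrow> poly_deg_le n (\<lambda>x. \<Sum>a\<in>A. P a x)"
  by (induction A rule: infinite_finite_induct) (auto intro: poly_deg_le_const poly_deg_le_add)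

text \<open>Raising the \<open>j\<close>-th exponent is a bijection from the multi-indices of order
  at most \<open>n\<close> to those of order at most \<open>n + 1\<close> with positive
  \<open>j\<close>-th entry; monomials without that coordinate get the coefficient
  \<open>0\<close>.\<close>

lemma poly_deg_le_mult_coordinate:
  assumes "poly_deg_le n P" shows "poly_deg_le (Suc n) (\<lambda>x. x $ j * P x)"
proof -
  obtain c where c: "\<And>x. P x = (\<Sum>\<alpha> | (\<Sum>i\<in>UNIV. \<alpha> i) \<le> n. c \<alpha> * (\<Prod>i\<in>UNIV. (x $ i) ^ \<alpha> i))"
    using assms by (auto simp: poly_deg_le_def)
  let ?up = "\<lambda>\<alpha>::'a\<Rightarrow>nat. \<alpha>(j := Suc (\<alpha> j))" and ?dn = "\<lambda>\<alpha>::'a\<Rightarrow>nat. \<alpha>(j := \<alpha> j - 1)"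
  \<comment> \<open>Stated with additions on both sides, so that no truncated subtraction of natural
    numbers is involved.\<close>
  have S: "sum (\<alpha>(j := m)) UNIV + \<alpha> j = sum \<alpha> UNIV + m" for \<alpha> :: "'a \<Rightarrow> nat" and m
    using sum.remove[of UNIV j \<alpha>] sum.remove[of UNIV j "\<alpha>(j := m)"] by simp
  have M: "(\<Prod>i\<in>UNIV. (x $ i) ^ (?up \<alpha>) i) = x $ j * (\<Prod>i\<in>UNIV. (x $ i) ^ \<alpha> i)" for x :: "real^'a" and \<alpha>
    using prod.remove[of UNIV j "\<lambda>i. (x $ i) ^ \<alpha> i"] prod.remove[of UNIV j "\<lambda>i. (x $ i) ^ (?up \<alpha>) i"] by simp
  have bij: "bij_betw ?up {\<alpha>. sum \<alpha> UNIV \<le> n} {\<beta>. sum \<beta> UNIV \<le> Suc n \<and> \<beta> j > 0}"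
  proof (rule bij_betwI[of _ _ _ ?dn])
    show "?up \<in> {\<alpha>. sum \<alpha> UNIV \<le> n} \<rightarrow> {\<beta>. sum \<beta> UNIV \<le> Suc n \<and> \<beta> j > 0}"
    proof (intro Pi_I CollectI conjI)
      fix \<alpha> :: "'a \<Rightarrow> nat" assume "\<alpha> \<in> {\<alpha>. sum \<alpha> UNIV \<le> n}"
      then show "sum (?up \<alpha>) UNIV \<le> Suc n" using S[of \<alpha> "Suc (\<alpha> j)"] by simp
    qed simp
    show "?dn \<in> {\<beta>. sum \<beta> UNIV \<le> Suc n \<and> \<beta> j > 0} \<rightarrow> {\<alpha>. sum \<alpha> UNIV \<le> n}"
    proof (intro Pi_I CollectI)
      fix \<beta> :: "'a \<Rightarrow> nat" assume "\<beta> \<in> {\<beta>. sum \<beta> UNIV \<le> Suc n \<and> \<beta> j > 0}"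
      then have "0 < \<beta> j" "sum \<beta> UNIV \<le> Suc n" by auto
      then show "sum (?dn \<beta>) UNIV \<le> n" using S[of \<beta> "\<beta> j - 1"] by linarith
    qed
  qed (auto simp: fun_eq_iff)
  have "x $ j * P x = (\<Sum>\<beta> | (\<Sum>i\<in>UNIV. \<beta> i) \<le> Suc n.
      (if \<beta> j > 0 then c (?dn \<beta>) else 0) * (\<Prod>i\<in>UNIV. (x $ i) ^ \<beta> i))" for x
  proof -
    have "x $ j * P x = (\<Sum>\<alpha> | sum \<alpha> UNIV \<le> n. c (?dn (?up \<alpha>)) * (\<Prod>i\<in>UNIV. (x $ i) ^ (?up \<alpha>) i))"
      unfolding c M by (simp add: sum_distrib_left mult.left_commute)
    also have "\<dots> = (\<Sum>\<beta> | sum \<beta> UNIV \<le> Suc n \<and> \<beta> j > 0. c (?dn \<beta>) * (\<Prod>i\<in>UNIV. (x $ i) ^ \<beta> i))"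
      by (rule sum.reindex_bij_betw[OF bij])
    also have "\<dots> = (\<Sum>\<beta> | (\<Sum>i\<in>UNIV. \<beta> i) \<le> Suc n.
      (if \<beta> j > 0 then c (?dn \<beta>) else 0) * (\<Prod>i\<in>UNIV. (x $ i) ^ \<beta> i))"
      by (intro sum.mono_neutral_cong_left finite_multi_indices) auto
    finally show ?thesis .
  qed
  then show ?thesis unfolding poly_deg_le_def by (intro exI allI)
qed

lemma poly_deg_le_mult_affine:
  fixes P :: "real^'n::finite \<Rightarrow> real"
  assumes "poly_deg_le n P" shows "poly_deg_le (Suc n) (\<lambda>x. (a \<bullet> x + b) * P x)"
proof -
  have "poly_deg_le (Suc n) (\<lambda>x. (\<Sum>i\<in>UNIV. a $ i * (x $ i * P x)) + b * P x)"
    by (intro poly_deg_le_add poly_deg_le_sum poly_deg_le_scale poly_deg_le_mult_coordinate assms)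
      (rule poly_deg_le_mono[OF assms], simp)
  also have "(\<lambda>x. (\<Sum>i\<in>UNIV. a $ i * (x $ i * P x)) + b * P x) = (\<lambda>x. (a \<bullet> x + b) * P x)"
    by (simp add: inner_vec_def distrib_right sum_distrib_right mult.assoc)
  finally show ?thesis .
qed

text \<open>The degree is bounded by the number of factors; for a nodal function that number will be
  exactly \<open>k\<close>.\<close>

lemma poly_deg_le_prod_affine:
  fixes a :: "'i \<Rightarrow> real^'n::finite"
  assumes "finite I" shows "poly_deg_le (card I) (\<lambda>x. \<Prod>i\<in>I. a i \<bullet> x + b i)"
  using assms
proof (induction I rule: finite_induct)
  case empty
  show ?case by (simp add: poly_deg_le_const)
next
  case (insert i I)
  then show ?case using poly_deg_le_mult_affine[OF insert.IH, of "a i" "b i"] by simp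
qed

lemma smooth_on_open_coordinate: "smooth_on_open UNIV (\<lambda>x::real^'n::finite. x $ i)"
  unfolding smooth_on_open_def
proof
  fix k show "C_k_on k UNIV (\<lambda>x::real^'n. x $ i)"
  proof (cases k)
    case (Suc n)
    show ?thesis
      unfolding Suc
      by (rule C_k_on_SucI[of _ _ "\<lambda>_ h. h $ i"])
        (auto intro: C_k_on_const bounded_linear_imp_has_derivative bounded_linear_vec_nth)
  qed (simp add: continuous_intros)
qed

lemma smooth_on_open_poly:
  fixes P :: "real^'n::finite \<Rightarrow> real"
  assumes "poly_deg_le n P" shows "smooth_on_open UNIV P"
proof -
  obtain c where c: "\<And>x. P x = (\<Sum>\<alpha> | (\<Sum>i\<in>UNIV. \<alpha> i) \<le> n. c \<alpha> * (\<Prod>i\<in>UNIV. (x $ i) ^ \<alpha> i))"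
    using assms by (auto simp: poly_deg_le_def)
  have pow: "C_k_on k UNIV (\<lambda>x::real^'n. (x $ i) ^ m)" for k i m
    using smooth_on_open_coordinate[of i]
    by (induction m) (auto simp: smooth_on_open_def intro: C_k_on_const C_k_on_mult)
  have mon: "C_k_on k UNIV (\<lambda>x::real^'n. \<Prod>i\<in>UNIV. (x $ i) ^ \<alpha> i)" for k \<alpha>
    using smooth_on_open_prod[of UNIV UNIV "\<lambda>i x. (x $ i) ^ \<alpha> i"] pow by (simp add: smooth_on_open_def)
  have "C_k_on k UNIV (\<lambda>x::real^'n. \<Sum>\<alpha>\<in>A. c \<alpha> * (\<Prod>i\<in>UNIV. (x $ i) ^ \<alpha> i))" for k A
  proof (induction A rule: infinite_finite_induct)
    case (insert \<alpha> A)
    have "C_k_on k UNIV (\<lambda>x::real^'n. c \<alpha> * (\<Prod>i\<in>UNIV. (x $ i) ^ \<alpha> i) + (\<Sum>\<alpha>\<in>A. c \<alpha> * (\<Prod>i\<in>UNIV. (x $ i) ^ \<alpha> i)))"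
      by (intro C_k_on_add C_k_on_mult C_k_on_const mon insert.IH open_UNIV)
    then show ?case using insert.hyps by simp
  qed (auto intro: C_k_on_const)
  then show ?thesis by (simp add: smooth_on_open_def c[abs_def])
qed

lemma poly_deg_le_has_derivative:
  fixes P :: "real^'n::finite \<Rightarrow> real"
  assumes "poly_deg_le n P" shows "(P has_derivative frechet_derivative P (at x)) (at x)"
proof -
  have "C_k_on (Suc 0) UNIV P" using smooth_on_open_poly[OF assms] by (simp only: smooth_on_open_def)
  then show ?thesis by (simp add: frechet_derivative_works[symmetric])
qed

lemma poly_deg_le_continuous_on: "poly_deg_le n P \<Longrightarrow> continuous_on S P"
  using poly_deg_le_has_derivative has_derivative_continuous
  by (metis continuous_at_imp_continuous_on)

lemma poly_deg_le_lipschitz: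
  fixes P :: "real^'n::finite \<Rightarrow> real"
  assumes "poly_deg_le n P" "compact S" "convex S"
  shows "\<exists>L. L-lipschitz_on S P"
proof -
  have "\<exists>B. \<forall>x\<in>S. \<bar>frechet_derivative P (at x) (axis i 1)\<bar> \<le> B" for i
  proof -
    have "C_k_on (Suc 0) UNIV P" using smooth_on_open_poly[OF assms(1)] by (simp only: smooth_on_open_def)
    then have "continuous_on UNIV (\<lambda>x. frechet_derivative P (at x) (axis i 1))"
      by (simp add: axis_in_Basis_iff)
    then have "bounded ((\<lambda>x. frechet_derivative P (at x) (axis i 1)) ` S)"
      using assms(2) by (intro compact_imp_bounded compact_continuous_image) (auto intro: continuous_on_subset)
    then show ?thesis by (auto simp: bounded_iff)
  qed
  then obtain B where B: "\<And>i x. x \<in> S \<Longrightarrow> \<bar>frechet_derivative P (at x) (axis i 1)\<bar> \<le> B i" by metis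
  have "\<bar>frechet_derivative P (at x) (axis i 1)\<bar> \<le> (\<Sum>i\<in>UNIV. \<bar>B i\<bar>)" if "x \<in> S" for x i
    using B[OF that, of i] member_le_sum[of i UNIV "\<lambda>i. \<bar>B i\<bar>"] by simp
  then show ?thesis
    using lipschitz_on_partials_bounded[OF assms(3) poly_deg_le_has_derivative[OF assms(1)], of "\<Sum>i\<in>UNIV. \<bar>B i\<bar>"]
    by (auto simp: sum_nonneg)
qed

section \<open>Barycentric coordinates on simplices\<close>

lemma affine_coordinate_exists:
  fixes C :: "'a::euclidean_space set"
  assumes "\<not> affine_dependent C" "v \<in> C"
  shows "\<exists>a d. \<forall>w\<in>C. a \<bullet> w + d = (if w = v then 1 else 0)"
proof -
  have "\<not> affine_dependent (insert v (C - {v}))" using assms by (simp add: insert_absorb)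
  then have "independent ((\<lambda>x. - v + x) ` (C - {v}))"
    using affine_dependent_iff_dependent[of v "C - {v}"] by blast
  \<comment> \<open>Seen from \<open>v\<close> the other points are independent vectors; a linear
    functional equal to \<open>-1\<close> on all of them becomes the coordinate of \<open>v\<close>
    after centring at \<open>v\<close> and adding \<open>1\<close>.\<close>
  then obtain g :: "'a \<Rightarrow> real" where g: "linear g" "\<And>y. y \<in> (\<lambda>x. - v + x) ` (C - {v}) \<Longrightarrow> g y = -1"
    using linear_independent_extend[of _ "\<lambda>_. -1"] by metis
  let ?a = "adjoint g 1"
  have "g y = ?a \<bullet> y" for y
    using adjoint_works[OF g(1), of y 1] by (simp add: inner_commute)
  then have "?a \<bullet> (- v + w) = -1" if "w \<in> C" "w \<noteq> v" for w
    using g(2)[of "- v + w"] that by (metis Diff_iff empty_iff imageI insert_iff)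
  then have "?a \<bullet> w + (1 - ?a \<bullet> v) = (if w = v then 1 else 0)" if "w \<in> C" for w
    using that by (auto simp: inner_add_right inner_diff_right) (smt (verit))
  then show ?thesis by blast
qed

abbreviation vertices :: "'a::euclidean_space set \<Rightarrow> 'a set" where
  "vertices K \<equiv> {a. a extreme_point_of K}"

text \<open>An affine function, stored as normal vector and offset so that its coefficients are at
  hand when products of such functions are shown to be polynomials.\<close>

definition bary_coord :: "'a::euclidean_space set \<Rightarrow> 'a \<Rightarrow> 'a \<times> real" where
  "bary_coord K v = (SOME (a, d). \<forall>w\<in>vertices K. a \<bullet> w + d = (if w = v then 1 else 0))"

text \<open>The value \<open>0\<close> for a point that is not a vertex of \<open>K\<close> fits
  simplices that share a face: a vertex of the neighbour outside the face has coordinate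
  \<open>0\<close> on it. Formulas can then range over all vertices of the mesh.\<close>

definition bary :: "'a::euclidean_space set \<Rightarrow> 'a \<Rightarrow> 'a \<Rightarrow> real" where
  "bary K v x = (if v \<in> vertices K then fst (bary_coord K v) \<bullet> x + snd (bary_coord K v) else 0)"

lemma simplex_vertices:
  assumes "n simplex K"
  shows "finite (vertices K)" "\<not> affine_dependent (vertices K)" "K = convex hull (vertices K)"
proof -
  obtain C where C: "finite C" "\<not> affine_dependent C" "K = convex hull C"
    using assms by (auto simp: simplex)
  then have "vertices K = C" by (simp add: extreme_point_of_convex_hull_affine_independent)
  with C show "finite (vertices K)" "\<not> affine_dependent (vertices K)" "K = convex hull (vertices K)" by auto
qed

lemma bary_vertex:
  assumes "n simplex K" "w \<in> vertices K"
  shows "bary K v w = (if w = v then 1 else 0)"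
proof (cases "v \<in> vertices K")
  case True
  have "\<exists>ad. case ad of (a, d) \<Rightarrow> \<forall>w\<in>vertices K. a \<bullet> w + d = (if w = v then 1 else 0)"
    using affine_coordinate_exists[OF simplex_vertices(2)[OF assms(1)] True] by auto
  then have "case bary_coord K v of (a, d) \<Rightarrow> \<forall>w\<in>vertices K. a \<bullet> w + d = (if w = v then 1 else 0)"
    unfolding bary_coord_def by (rule someI_ex)
  then show ?thesis using True assms(2) by (auto simp: bary_def split: prod.splits)
next
  case False
  then show ?thesis using assms(2) by (auto simp: bary_def)
qed

text \<open>Affine functions respect affine combinations. \<open>F\<close> may be a proper subset of
  the vertices, since a common face of two simplices may have only some of them.\<close>

lemma bary_convex_combination:
  assumes K: "n simplex K" and "finite F" "F \<subseteq> vertices K" "sum u F = 1"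
  shows "bary K v (\<Sum>w\<in>F. u w *\<^sub>R w) = (if v \<in> F then u v else 0)"
proof (cases "v \<in> vertices K")
  case True
  let ?a = "fst (bary_coord K v)" and ?d = "snd (bary_coord K v)"
  have "bary K v (\<Sum>w\<in>F. u w *\<^sub>R w) = (\<Sum>w\<in>F. u w * (?a \<bullet> w)) + (\<Sum>w\<in>F. u w) * ?d"
    using True assms(4) by (simp add: bary_def inner_sum_right)
  also have "\<dots> = (\<Sum>w\<in>F. u w * bary K v w)"
    using True by (simp add: bary_def distrib_left sum.distrib sum_distrib_right)
  also have "\<dots> = (\<Sum>w\<in>F. if w = v then u w else 0)"
    using bary_vertex[OF K] assms(3) by (intro sum.cong) auto
  also have "\<dots> = (if v \<in> F then u v else 0)" using assms(2) by simp
  finally show ?thesis .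
next
  case False
  then show ?thesis using assms(3) by (auto simp: bary_def)
qed

text \<open>The intersection is a face of both simplices, so its extreme points are vertices of
  both. Weights that represent \<open>x\<close> by these points are then its barycentric coordinates
  in either simplex.\<close>

lemma bary_consistent:
  assumes \<T>: "triangulation \<T>" and K: "K \<in> \<T>" "K' \<in> \<T>" and x: "x \<in> K" "x \<in> K'"
  shows "bary K v x = bary K' v x"
proof -
  obtain n n' where s: "n simplex K" "n' simplex K'"
    using \<T> K unfolding triangulation_def by blast
  let ?F = "K \<inter> K'"
  have f: "?F face_of K" "?F face_of K'"
    using \<T> K unfolding triangulation_def by (blast, metis Int_commute)
  have cv: "compact ?F" "convex ?F"
    using compact_Int[OF compact_simplex[OF s(1)] compact_simplex[OF s(2)]]
      convex_Int[OF convex_simplex[OF s(1)] convex_simplex[OF s(2)]] by simp_all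
  have sub: "vertices ?F \<subseteq> vertices K" "vertices ?F \<subseteq> vertices K'"
    using extreme_point_of_face f by blast+
  have fin: "finite (vertices ?F)" using simplex_vertices(1)[OF s(1)] sub(1) finite_subset by blast
  have "x \<in> convex hull (vertices ?F)" using Krein_Milman_Minkowski[OF cv] x by blast
  then obtain u where u: "sum u (vertices ?F) = 1" "(\<Sum>w\<in>vertices ?F. u w *\<^sub>R w) = x"
    using convex_hull_finite[OF fin] by auto
  show ?thesis
    using bary_convex_combination[OF s(1) fin sub(1) u(1), of v]
      bary_convex_combination[OF s(2) fin sub(2) u(1), of v] u(2) by simp
qed

text \<open>The weights defining a node are its barycentric coordinates, so multiplication by
  \<open>k\<close> returns the integers \<open>m\<close>.\<close>

lemma bary_node:
  assumes "n simplex K" "k \<ge> 1" "(\<Sum>a\<in>vertices K. m a) = k"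
    and b: "b = (\<Sum>a\<in>vertices K. (real (m a) / real k) *\<^sub>R a)"
  shows "real k * bary K v b = (if v \<in> vertices K then m v else 0)" "b \<in> K"
proof -
  have s: "(\<Sum>a\<in>vertices K. real (m a) / real k) = 1"
    using assms(2,3) by (simp flip: sum_divide_distrib of_nat_sum)
  show "real k * bary K v b = (if v \<in> vertices K then m v else 0)"
    unfolding b using bary_convex_combination[OF assms(1) simplex_vertices(1)[OF assms(1)] _ s, of v] assms(2)
    by simp
  show "b \<in> K"
    using s simplex_vertices[OF assms(1)] unfolding b
    by (subst simplex_vertices(3)[OF assms(1)]) (auto simp: convex_hull_finite intro!: exI[of _ "\<lambda>a. real (m a) / real k"])
qed

section \<open>Nodal functions on a mesh\<close>

locale lagrange_mesh =
  fixes \<T> :: "(real^'n::finite) set set" and k :: nat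
  assumes \<T>: "triangulation \<T>" and k: "k \<ge> 1"
begin

text \<open>On any simplex containing \<open>x\<close>, the barycentric coordinate of \<open>x\<close> with respect to \<open>v\<close>,
  and \<open>0\<close> if \<open>v\<close> is not one of its vertices; this does not depend on the choice of the simplex.\<close>

definition hat :: "real^'n \<Rightarrow> real^'n \<Rightarrow> real" where
  "hat v x = bary (SOME K. K \<in> \<T> \<and> x \<in> K) v x"

lemma simplexE: assumes "K \<in> \<T>" obtains n where "n simplex K"
  using assms \<T> by (auto simp: triangulation_def)

lemma hat_eq: "K \<in> \<T> \<Longrightarrow> x \<in> K \<Longrightarrow> hat v x = bary K v x"
  unfolding hat_def by (rule someI2[of _ K]) (auto intro: bary_consistent[OF \<T>])

definition all_vertices :: "(real^'n) set" where
  "all_vertices = (\<Union>K\<in>\<T>. vertices K)"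

lemma finite_all_vertices: "finite all_vertices"
  unfolding all_vertices_def
  by (rule finite_UN_I) (use \<T> simplex_vertices(1) in \<open>unfold triangulation_def, blast+\<close>)

text \<open>At a node the floor is exact, as \<open>real k * hat v b\<close> is a natural number
  there; it serves only to obtain the type \<open>nat\<close>.\<close>

definition node_index :: "real^'n \<Rightarrow> real^'n \<Rightarrow> nat" where
  "node_index b v = nat \<lfloor>real k * hat v b\<rfloor>"

text \<open>The indices act as global lattice coordinates: they sum to \<open>k\<close> and
  determine the node, and a node shared by several simplices needs no separate treatment.\<close>

lemma node_index:
  assumes "b \<in> lagrange_nodes \<T> k"
  shows "real (node_index b v) = real k * hat v b"
    and "(\<Sum>v\<in>all_vertices. node_index b v) = k"
    and "b = (\<Sum>v\<in>all_vertices. (real (node_index b v) / real k) *\<^sub>R v)"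
    and "b \<in> \<Union>\<T>"
proof -
  obtain K m where K: "K \<in> \<T>" and m: "(\<Sum>a\<in>vertices K. m a) = k"
    and b: "b = (\<Sum>a\<in>vertices K. (real (m a) / real k) *\<^sub>R a)"
    using assms by (auto simp: lagrange_nodes_def simplex_nodes_def)
  obtain n where n: "n simplex K" using simplexE[OF K] .
  note bn = bary_node[OF n k m b]
  have h: "real k * hat v b = real (if v \<in> vertices K then m v else 0)" for v
    using hat_eq[OF K bn(2), of v] bn(1)[of v] by simp
  have i: "node_index b v = (if v \<in> vertices K then m v else 0)" for v
    unfolding node_index_def h by simp
  show "real (node_index b v) = real k * hat v b" using h i by simp
  have sub: "vertices K \<subseteq> all_vertices" using K by (auto simp: all_vertices_def)
  have "(\<Sum>v\<in>all_vertices. node_index b v) = (\<Sum>v\<in>vertices K. m v)"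
    using sub i by (intro sum.mono_neutral_cong_right finite_all_vertices) auto
  then show "(\<Sum>v\<in>all_vertices. node_index b v) = k" using m by simp
  have "(\<Sum>v\<in>all_vertices. (real (node_index b v) / real k) *\<^sub>R v) = (\<Sum>v\<in>vertices K. (real (m v) / real k) *\<^sub>R v)"
    using sub i by (intro sum.mono_neutral_cong_right finite_all_vertices) auto
  then show "b = (\<Sum>v\<in>all_vertices. (real (node_index b v) / real k) *\<^sub>R v)" using b by simp
  show "b \<in> \<Union>\<T>" using bn(2) K by blast
qed

text \<open>At a node other than \<open>a\<close> some index is smaller than that of \<open>a\<close>, since all indices sum up to \<open>k\<close>,
  and the corresponding factor vanishes.\<close>

definition nodal_fun :: "real^'n \<Rightarrow> real^'n \<Rightarrow> real" where
  "nodal_fun a x = (\<Prod>v\<in>all_vertices. \<Prod>j<node_index a v.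
     (real k * hat v x - real j) / (real (node_index a v) - real j))"

lemma nodal_fun_node:
  assumes a: "a \<in> lagrange_nodes \<T> k" and b: "b \<in> lagrange_nodes \<T> k"
  shows "nodal_fun a b = (if b = a then 1 else 0)"
proof (cases "b = a")
  case True
  then show ?thesis
    unfolding nodal_fun_def True node_index(1)[OF a, symmetric] by (auto intro!: prod.neutral)
next
  case False
  have "\<exists>v\<in>all_vertices. node_index b v < node_index a v"
  proof (rule ccontr)
    assume "\<not> ?thesis"
    then have le: "\<And>v. v \<in> all_vertices \<Longrightarrow> node_index a v \<le> node_index b v" by (auto simp: not_less)
    \<comment> \<open>Both families sum to \<open>k\<close>, so the pointwise inequality leaves no
      room for a strict one.\<close>
    have "node_index a v = node_index b v" if v: "v \<in> all_vertices" for v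
    proof (rule ccontr)
      assume "node_index a v \<noteq> node_index b v"
      then have "sum (node_index a) all_vertices < sum (node_index b) all_vertices"
        using le v by (intro sum_strict_mono_ex1 finite_all_vertices) (auto intro!: bexI[of _ v] simp: le_neq_trans)
      then show False using node_index(2)[OF a] node_index(2)[OF b] by simp
    qed
    then have "(\<Sum>v\<in>all_vertices. (real (node_index a v) / real k) *\<^sub>R v) = (\<Sum>v\<in>all_vertices. (real (node_index b v) / real k) *\<^sub>R v)"
      by (intro sum.cong) auto
    then show False using node_index(3)[OF a] node_index(3)[OF b] False by simp
  qed
  then obtain v where v: "v \<in> all_vertices" "node_index b v < node_index a v" by blast
  then have "(\<Prod>j<node_index a v. (real k * hat v b - real j) / (real (node_index a v) - real j)) = 0"
    using node_index(1)[OF b, of v] by (intro prod_zero) (auto intro!: bexI[of _ "node_index b v"])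
  then show ?thesis
    unfolding nodal_fun_def using v(1) False finite_all_vertices by (auto intro!: prod_zero)
qed

text \<open>If \<open>a\<close> has a positive index at a mesh vertex that is not a vertex of
  \<open>K\<close>, the factor with \<open>j = 0\<close> for that vertex vanishes on
  \<open>K\<close>. Otherwise all factors are affine on \<open>K\<close>, and their number is the
  sum of the indices, that is \<open>k\<close>.\<close>

lemma nodal_fun_poly:
  assumes a: "a \<in> lagrange_nodes \<T> k" and K: "K \<in> \<T>"
  shows "\<exists>P. poly_deg_le k P \<and> (\<forall>x\<in>K. nodal_fun a x = P x)"
proof (cases "\<exists>v\<in>all_vertices - vertices K. node_index a v > 0")
  case True
  then obtain v where v: "v \<in> all_vertices" "v \<notin> vertices K" "node_index a v > 0" by blast
  have "nodal_fun a x = 0" if "x \<in> K" for x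
  proof -
    have "hat v x = 0" using hat_eq[OF K that] v(2) by (simp add: bary_def)
    then have "(\<Prod>j<node_index a v. (real k * hat v x - real j) / (real (node_index a v) - real j)) = 0"
      using v(3) by (intro prod_zero) (auto intro!: bexI[of _ 0])
    then show ?thesis unfolding nodal_fun_def using v(1) finite_all_vertices by (auto intro!: prod_zero)
  qed
  then show ?thesis using poly_deg_le_const by blast
next
  case False
  let ?I = "SIGMA v:all_vertices. {..<node_index a v}"
  let ?g = "\<lambda>(v, j). (real k / (real (node_index a v) - real j)) *\<^sub>R fst (bary_coord K v)"
  let ?c = "\<lambda>(v, j). (real k * snd (bary_coord K v) - real j) / (real (node_index a v) - real j)"
  let ?P = "\<lambda>x. \<Prod>i\<in>?I. ?g i \<bullet> x + ?c i"
  have "card ?I = k" using node_index(2)[OF a] by (subst card_SigmaI) (auto simp: finite_all_vertices)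
  then have "poly_deg_le k ?P"
    using poly_deg_le_prod_affine[of ?I ?g ?c] finite_all_vertices by (simp add: finite_SigmaI)
  moreover have "nodal_fun a x = ?P x" if "x \<in> K" for x
  proof -
    have "nodal_fun a x = (\<Prod>(v, j)\<in>?I. (real k * hat v x - real j) / (real (node_index a v) - real j))"
      unfolding nodal_fun_def by (subst prod.Sigma) (auto simp: finite_all_vertices)
    also have "\<dots> = ?P x"
    proof (rule prod.cong[OF refl])
      fix i assume "i \<in> ?I"
      then obtain v j where i: "i = (v, j)" and vj: "v \<in> all_vertices" "j < node_index a v" by auto
      have "v \<in> vertices K" using False vj by (cases "v \<in> vertices K") auto
      then have "hat v x = fst (bary_coord K v) \<bullet> x + snd (bary_coord K v)"
        using hat_eq[OF K that] by (simp add: bary_def)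
      then show "(case i of (v, j) \<Rightarrow> (real k * hat v x - real j) / (real (node_index a v) - real j)) = ?g i \<bullet> x + ?c i"
        by (simp add: i add_divide_distrib[symmetric] distrib_left)
    qed
    finally show ?thesis .
  qed
  ultimately show ?thesis by blast
qed

section \<open>Membership and regularity in the Lagrange space\<close>

lemma continuous_on_piecewise_poly:
  assumes "\<And>K. K \<in> \<T> \<Longrightarrow> \<exists>P. poly_deg_le k P \<and> (\<forall>x\<in>K. w x = P x)"
  shows "continuous_on (\<Union>\<T>) w"
proof -
  have "continuous_on K w" if "K \<in> \<T>" for K
    using assms[OF that] poly_deg_le_continuous_on continuous_on_cong by metis
  moreover have "closed K" if "K \<in> \<T>" for K
    using simplexE[OF that] closed_simplex by blast
  moreover have "finite \<T>" using \<T> by (simp add: triangulation_def)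
  ultimately show ?thesis using continuous_on_closed_Union[of \<T> "\<lambda>K. K" w] by simp
qed

text \<open>The explicit \<open>nodal_fun\<close> shows that the description in
  \<open>nodal_basis\<close> is satisfiable, hence satisfied by the chosen function.\<close>

lemma nodal_basis_mem:
  assumes "a \<in> lagrange_nodes \<T> k" shows "nodal_basis \<T> k a \<in> lagrange_space \<T> k"
proof -
  have "nodal_fun a \<in> lagrange_space \<T> k \<and>
      (\<forall>b\<in>lagrange_nodes \<T> k. nodal_fun a b = (if b = a then 1 else 0))"
    using nodal_fun_poly[OF assms] nodal_fun_node[OF assms] continuous_on_piecewise_poly
    by (auto simp: lagrange_space_def)
  then show ?thesis unfolding nodal_basis_def
    by (rule someI2[where Q="\<lambda>\<phi>. \<phi> \<in> lagrange_space \<T> k"]) blast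
qed

lemma lagrange_space_add:
  assumes "v \<in> lagrange_space \<T> k" "w \<in> lagrange_space \<T> k"
  shows "(\<lambda>x. v x + w x) \<in> lagrange_space \<T> k"
  unfolding lagrange_space_def
proof (intro CollectI conjI ballI)
  show "continuous_on (\<Union>\<T>) (\<lambda>x. v x + w x)"
    using assms by (auto simp: lagrange_space_def intro: continuous_intros)
  fix K assume "K \<in> \<T>"
  then obtain P R where "poly_deg_le k P" "\<forall>x\<in>K. v x = P x" "poly_deg_le k R" "\<forall>x\<in>K. w x = R x"
    using assms by (auto simp: lagrange_space_def) metis
  then show "\<exists>P. poly_deg_le k P \<and> (\<forall>x\<in>K. v x + w x = P x)"
    by (intro exI[of _ "\<lambda>x. P x + R x"]) (auto intro: poly_deg_le_add)
qed

lemma lagrange_space_scale: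
  assumes "v \<in> lagrange_space \<T> k" shows "(\<lambda>x. c * v x) \<in> lagrange_space \<T> k"
  unfolding lagrange_space_def
proof (intro CollectI conjI ballI)
  show "continuous_on (\<Union>\<T>) (\<lambda>x. c * v x)"
    using assms by (auto simp: lagrange_space_def intro: continuous_intros)
  fix K assume "K \<in> \<T>"
  then obtain P where "poly_deg_le k P" "\<forall>x\<in>K. v x = P x"
    using assms by (auto simp: lagrange_space_def)
  then show "\<exists>P. poly_deg_le k P \<and> (\<forall>x\<in>K. c * v x = P x)"
    by (intro exI[of _ "\<lambda>x. c * P x"]) (auto intro: poly_deg_le_scale)
qed

lemma lagrange_space_const: "(\<lambda>x. c) \<in> lagrange_space \<T> k"
  unfolding lagrange_space_def by (auto intro!: poly_deg_le_const exI[of _ "\<lambda>x. c"])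

lemma lagrange_interp_mem: "lagrange_interp \<T> k q \<in> lagrange_space \<T> k"
proof -
  have "(\<lambda>x. \<Sum>a\<in>A. q a * nodal_basis \<T> k a x) \<in> lagrange_space \<T> k"
    if "A \<subseteq> lagrange_nodes \<T> k" for A
    using that
  proof (induction A rule: infinite_finite_induct)
    case (insert a A)
    then show ?case
      using lagrange_space_add[OF lagrange_space_scale[OF nodal_basis_mem, of a "q a"], of "\<lambda>x. \<Sum>a\<in>A. q a * nodal_basis \<T> k a x"]
      by simp
  qed (simp_all add: lagrange_space_const)
  then show ?thesis by (simp add: lagrange_interp_def[abs_def])
qed

text \<open>By convexity the segment from \<open>x\<close> to \<open>y\<close> stays in the mesh.
  Its parameter interval is covered by finitely many closed sets, one for each element, and a common
  Lipschitz constant on these sets is one on the whole interval.\<close>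

lemma lagrange_space_lipschitz:
  assumes w: "w \<in> lagrange_space \<T> k" and cvx: "convex (\<Union>\<T>)"
  shows "\<exists>L. L-lipschitz_on (\<Union>\<T>) w"
proof -
  have "\<exists>L. L-lipschitz_on K w" if K: "K \<in> \<T>" for K
  proof -
    obtain P where P: "poly_deg_le k P" "\<forall>x\<in>K. w x = P x" using w K by (auto simp: lagrange_space_def)
    obtain n where n: "n simplex K" using simplexE[OF K] .
    obtain L where "L-lipschitz_on K P"
      using poly_deg_le_lipschitz[OF P(1) compact_simplex[OF n] convex_simplex[OF n]] by blast
    then have "L-lipschitz_on K w" using P(2) by (auto simp: lipschitz_on_def)
    then show ?thesis by blast
  qed
  then obtain L where L: "\<And>K. K \<in> \<T> \<Longrightarrow> (L K)-lipschitz_on K w" by metis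
  have fin: "finite \<T>" using \<T> by (simp add: triangulation_def)
  define M where "M = (\<Sum>K\<in>\<T>. L K)"
  have L0: "L K \<ge> 0" if "K \<in> \<T>" for K using L[OF that] by (simp add: lipschitz_on_def)
  then have M0: "M \<ge> 0" by (simp add: M_def sum_nonneg)
  have LM: "M-lipschitz_on K w" if "K \<in> \<T>" for K
  proof -
    have "L K \<le> M" unfolding M_def using that L0 fin by (intro member_le_sum) auto
    then show ?thesis using L[OF that] lipschitz_on_le by blast
  qed
  have "M-lipschitz_on (\<Union>\<T>) w"
  proof (rule lipschitz_onI[OF _ M0])
    fix x y assume xy: "x \<in> \<Union>\<T>" "y \<in> \<Union>\<T>"
    define \<gamma> where "\<gamma> t = x + t *\<^sub>R (y - x)" for t :: real
    define U where "U K = {0..1} \<inter> \<gamma> -` K" for K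
    have \<gamma>c: "continuous_on A \<gamma>" for A unfolding \<gamma>_def by (intro continuous_intros)
    have \<gamma>l: "dist (\<gamma> s) (\<gamma> t) = dist x y * dist s t" for s t
    proof -
      have "\<gamma> s - \<gamma> t = (s - t) *\<^sub>R (y - x)" by (simp add: \<gamma>_def algebra_simps)
      then show ?thesis by (simp add: dist_norm norm_minus_commute)
    qed
    have "(M * dist x y)-lipschitz_on {0..1} (w \<circ> \<gamma>)"
    proof (rule lipschitz_on_closed_Union[of \<T> _ U])
      show "(M * dist x y)-lipschitz_on (U K) (w \<circ> \<gamma>)" if "K \<in> \<T>" for K
      proof (rule lipschitz_onI)
        fix s t assume "s \<in> U K" "t \<in> U K"
        then show "dist ((w \<circ> \<gamma>) s) ((w \<circ> \<gamma>) t) \<le> M * dist x y * dist s t"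
          using lipschitz_onD[OF LM[OF that], of "\<gamma> s" "\<gamma> t"] \<gamma>l by (simp add: U_def mult.assoc)
      qed (use M0 in simp)
      show "closed (U K)" if "K \<in> \<T>" for K
      proof -
        have "closed K" using simplexE[OF that] closed_simplex by blast
        then show ?thesis unfolding U_def using \<gamma>c by (intro continuous_closed_preimage) auto
      qed
      show "{0..1} \<subseteq> (\<Union>K\<in>\<T>. U K)"
      proof
        fix t :: real assume t: "t \<in> {0..1}"
        have "\<gamma> t = (1 - t) *\<^sub>R x + t *\<^sub>R y" by (simp add: \<gamma>_def algebra_simps)
        then have "\<gamma> t \<in> \<Union>\<T>" using convexD[OF cvx xy, of "1 - t" t] t by simp
        then show "t \<in> (\<Union>K\<in>\<T>. U K)" using t by (auto simp: U_def)
      qed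
    qed (use fin M0 in auto)
    from lipschitz_onD[OF this, of 0 1] show "dist (w x) (w y) \<le> M * dist x y"
      by (simp add: \<gamma>_def)
  qed
  then show ?thesis by blast
qed

text \<open>The candidate for the weak derivative is the \<open>lim\<close> of difference quotients,
  whose measurability is inherited from the quotients. Off the frontiers of the elements, a
  negligible set, it is the derivative of the local polynomial; across them the Lipschitz bound is
  enough.\<close>

lemma lagrange_space_H1:
  assumes w: "w \<in> lagrange_space \<T> k" and \<Omega>: "open \<Omega>" "bounded \<Omega>" "convex \<Omega>" "\<Union>\<T> = closure \<Omega>"
  shows "w \<in> H1 \<Omega>"
proof -
  have "convex (\<Union>\<T>)" using \<Omega> by (simp add: convex_closure)
  then obtain L where "L-lipschitz_on (\<Union>\<T>) w" using lagrange_space_lipschitz[OF w] by blast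
  then have L: "L-lipschitz_on \<Omega> w"
    by (rule lipschitz_on_subset) (simp add: \<Omega>(4) closure_subset)
  have meas: "\<Omega> \<in> sets lebesgue" using \<Omega>(1) by (simp add: borel_open sets_completionI_sets)
  have wm: "w \<in> borel_measurable (lebesgue_on \<Omega>)"
    using lipschitz_on_continuous_on[OF L] meas by (rule continuous_imp_measurable_on_sets_lebesgue)
  \<comment> \<open>The quotients of \<open>w\<close> may reach outside \<Omega>, where
    \<open>w\<close> is arbitrary; the zero extension is Borel measurable and at points of \<Omega>
    has eventually the same quotients.\<close>
  define F where "F = (\<lambda>x. if x \<in> \<Omega> then w x else 0)"
  have F: "F \<in> borel_measurable borel"
    unfolding F_def using \<Omega>(1) lipschitz_on_continuous_on[OF L]
    by (intro borel_measurable_continuous_on_if) auto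
  have "is_weak_partial \<Omega> i w
      (\<lambda>x. lim (\<lambda>n. diff_quot F (axis i 1) n x))" for i
  proof (rule is_weak_partial_lipschitz[OF \<Omega>(1,2) L])
    have "(\<lambda>x. F (x + c)) \<in> borel_measurable borel" for c by (rule measurable_compose[OF _ F]) simp
    then show "(\<lambda>x. lim (\<lambda>n. diff_quot F (axis i 1) n x))
        \<in> borel_measurable (lebesgue_on \<Omega>)"
      using F by (intro borel_measurable_lebesgue_on borel_measurable_lim_metric
          borel_measurable_times borel_measurable_diff) auto
    have "negligible (\<Union>K\<in>\<T>. frontier K)"
    proof (rule negligible_Union[OF finite_imageI])
      show "finite \<T>" using \<T> by (simp add: triangulation_def)
      show "negligible S" if "S \<in> frontier ` \<T>" for S
        using that simplexE convex_simplex negligible_convex_frontier by blast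
    qed
    then have "AE x in lebesgue. x \<notin> (\<Union>K\<in>\<T>. frontier K)"
      by (simp only: AE_not_in negligible_iff_null_sets)
    then have "AE x in lebesgue_on \<Omega>. x \<notin> (\<Union>K\<in>\<T>. frontier K)"
      using meas by (subst AE_restrict_space_iff) auto
    with AE_space show "AE x in lebesgue_on \<Omega>.
        (\<lambda>n. diff_quot w (axis i 1) n x) \<longlonglongrightarrow>
        lim (\<lambda>n. diff_quot F (axis i 1) n x)"
    proof eventually_elim
      case (elim x)
      then have x: "x \<in> \<Omega>" by simp
      then obtain K where K: "K \<in> \<T>" "x \<in> K" using \<Omega>(4) closure_subset by blast
      have cl: "closed K" using simplexE[OF K(1)] closed_simplex by blast
      have int: "x \<in> interior K" using elim(2) K cl by (auto simp: frontier_def)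
      obtain P where P: "poly_deg_le k P" "\<forall>x\<in>K. w x = P x" using w K by (auto simp: lagrange_space_def)
      have "(w has_derivative frechet_derivative P (at x)) (at x)"
        by (rule has_derivative_transform_within_open[OF poly_deg_le_has_derivative[OF P(1)] open_interior int])
          (use P(2) interior_subset[of K] in auto)
      from directional_quotient_tendsto[OF this, of "axis i 1"]
      have lim: "(\<lambda>n. diff_quot w (axis i 1) n x) \<longlonglongrightarrow>
          frechet_derivative P (at x) (axis i 1)" .
      have "(\<lambda>n. x + inverse (real (Suc n)) *\<^sub>R axis i 1) \<longlonglongrightarrow> x + 0 *\<^sub>R axis i (1::real)"
        by (intro tendsto_intros LIMSEQ_inverse_real_of_nat)
      then have "eventually (\<lambda>n. x + inverse (real (Suc n)) *\<^sub>R axis i 1 \<in> \<Omega>) sequentially"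
        using topological_tendstoD[OF _ \<Omega>(1)] x by fastforce
      then have "eventually (\<lambda>n. diff_quot w (axis i 1) n x =
          diff_quot F (axis i 1) n x) sequentially"
        by eventually_elim (use x in \<open>simp add: F_def\<close>)
      then show ?case using limI[OF Lim_transform_eventually[OF lim]] lim by simp
    qed
  qed
  moreover have "square_integrable \<Omega> w"
  proof -
    have "bounded (w ` \<Omega>)"
      by (rule bounded_uniformly_continuous_image[OF lipschitz_on_uniformly_continuous[OF L] \<Omega>(2)])
    then obtain B where "\<And>x. x \<in> \<Omega> \<Longrightarrow> norm (w x) \<le> B" by (auto simp: bounded_iff)
    then show ?thesis
      using lmeasurable_open[OF \<Omega>(2,1)] wm by (intro square_integrable_bounded[of _ _ B]) (auto intro: AE_I2)
  qed
  ultimately show ?thesis by (intro H1_I[OF \<Omega>(1,2)])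
qed

end

section \<open>Time-dependent fields and the energy argument\<close>

lemma smooth_on_open_has_derivative:
  assumes "smooth_on_open U g" "z \<in> U"
  shows "(g has_derivative frechet_derivative g (at z)) (at z)"
proof -
  have "C_k_on (Suc 0) U g" using assms(1) by (simp only: smooth_on_open_def)
  then show ?thesis using assms(2) by (simp add: frechet_derivative_works[symmetric])
qed

lemma smooth_on_open_partial:
  assumes "smooth_on_open U g" "b \<in> Basis"
  shows "smooth_on_open U (\<lambda>z. frechet_derivative g (at z) b)"
  unfolding smooth_on_open_def
proof
  fix k
  have "C_k_on (Suc k) U g" using assms(1) by (simp only: smooth_on_open_def)
  then show "C_k_on k U (\<lambda>z. frechet_derivative g (at z) b)" using assms(2) by simp
qed

lemma smooth_on_open_continuous_on: "smooth_on_open U g \<Longrightarrow> continuous_on U g"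
  unfolding smooth_on_open_def using C_k_on.simps(1) by blast

lemma space_axis_Basis: "(0::real, axis i 1 :: real^'n::finite) \<in> Basis"
  by (simp add: Basis_prod_def axis_in_Basis_iff)

lemma time_Basis: "(1::real, 0 :: real^'n::finite) \<in> Basis"
  by (simp add: Basis_prod_def)

text \<open>The chain rule for the slice of the extension \<open>g\<close>; agreement of
  \<open>v\<close> with it on an open set determines the derivative there.\<close>

lemma smooth_slice_has_derivative:
  fixes g :: "real \<times> (real^'n::finite) \<Rightarrow> 'b::real_normed_vector"
  assumes g: "smooth_on_open U g" and \<Omega>: "open \<Omega>" "{t} \<times> \<Omega> \<subseteq> U"
    and v: "\<And>x. x \<in> \<Omega> \<Longrightarrow> v x = g (t, x)" and x: "x \<in> \<Omega>"
  shows "(v has_derivative (\<lambda>h. frechet_derivative g (at (t, x)) (0, h))) (at x)"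
proof (rule has_derivative_transform_within_open[OF _ \<Omega>(1) x])
  have "(t, x) \<in> U" using \<Omega>(2) x by blast
  from smooth_on_open_has_derivative[OF g this]
  show "((\<lambda>x. g (t, x)) has_derivative (\<lambda>h. frechet_derivative g (at (t, x)) (0, h))) (at x)"
    by (rule has_derivative_compose[rotated]) (auto intro!: derivative_eq_intros)
qed (simp add: v)

lemma smooth_slice_partial:
  fixes g :: "real \<times> (real^'n::finite) \<Rightarrow> 'b::real_normed_vector"
  assumes "smooth_on_open U g" "open \<Omega>" "{t} \<times> \<Omega> \<subseteq> U"
    and "\<And>x. x \<in> \<Omega> \<Longrightarrow> v x = g (t, x)" and "x \<in> \<Omega>"
  shows "partial i v x = frechet_derivative g (at (t, x)) (0, axis i 1)"
  unfolding partial_def using frechet_derivative_at[OF smooth_slice_has_derivative[OF assms]] by metis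

text \<open>The extension is smooth near the compact set
  \<open>{t} \<times> closure \<Omega>\<close>, which supplies the bounds on the partial
  derivatives. Pairing with \<open>c\<close> selects a component of a vector field, and
  \<open>c = 1\<close> covers scalars.\<close>

lemma smooth_slice_is_weak_partial:
  fixes g :: "real \<times> (real^'n::finite) \<Rightarrow> 'b::real_inner"
  assumes \<Omega>: "open \<Omega>" "bounded \<Omega>" "convex \<Omega>"
    and g: "smooth_on_open U g" and U: "{t} \<times> closure \<Omega> \<subseteq> U"
    and v: "\<And>x. x \<in> \<Omega> \<Longrightarrow> v x = g (t, x)"
  shows "is_weak_partial \<Omega> i (\<lambda>x. v x \<bullet> c) (\<lambda>x. partial i v x \<bullet> c)"
proof -
  let ?g = "\<lambda>j x. frechet_derivative g (at (t, x)) (0, axis j 1)"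
  have U': "{t} \<times> \<Omega> \<subseteq> U" using U closure_subset by fastforce
  have cont: "continuous_on (closure \<Omega>) (?g j)" for j
    using U by (intro continuous_on_compose2[OF smooth_on_open_continuous_on[OF smooth_on_open_partial[OF g space_axis_Basis[of j]]]])
      (auto intro!: continuous_intros)
  have part: "partial j v x = ?g j x" if "x \<in> \<Omega>" for j x
    by (rule smooth_slice_partial[OF g \<Omega>(1) U' v that])
  have "\<exists>B. \<forall>x\<in>closure \<Omega>. \<bar>?g j x \<bullet> c\<bar> \<le> B" for j
  proof -
    have "bounded ((\<lambda>x. ?g j x \<bullet> c) ` closure \<Omega>)"
      using cont[of j] \<Omega>(2) by (intro compact_imp_bounded compact_continuous_image continuous_intros) auto
    then show ?thesis by (auto simp: bounded_iff)
  qed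
  then obtain B where B: "\<And>j x. x \<in> closure \<Omega> \<Longrightarrow> \<bar>?g j x \<bullet> c\<bar> \<le> B j" by metis
  have "is_weak_partial \<Omega> i (\<lambda>x. v x \<bullet> c) (\<lambda>x. frechet_derivative v (at x) (axis i 1) \<bullet> c)"
  proof (rule is_weak_partial_classical[OF \<Omega>, where F'="\<lambda>x h. frechet_derivative v (at x) h \<bullet> c"])
    fix x assume x: "x \<in> \<Omega>"
    have "(v has_derivative frechet_derivative v (at x)) (at x)"
      using smooth_slice_has_derivative[OF g \<Omega>(1) U' v x] frechet_derivative_works
      by (metis differentiable_def)
    then show "((\<lambda>x. v x \<bullet> c) has_derivative (\<lambda>h. frechet_derivative v (at x) h \<bullet> c)) (at x)"
      by (rule has_derivative_inner_left)
    fix j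
    have "x \<in> closure \<Omega>" using x closure_subset by blast
    then show "\<bar>frechet_derivative v (at x) (axis j 1) \<bullet> c\<bar> \<le> (\<Sum>j\<in>UNIV. \<bar>B j\<bar>)"
      using B[of x j] part[OF x, of j] member_le_sum[of j UNIV "\<lambda>j. \<bar>B j\<bar>"] by (simp add: partial_def)
  next
    have "continuous_on \<Omega> (\<lambda>x. ?g i x \<bullet> c)"
      using continuous_on_subset[OF cont closure_subset] by (intro continuous_intros)
    then show "continuous_on \<Omega> (\<lambda>x. frechet_derivative v (at x) (axis i 1) \<bullet> c)"
      using part[unfolded partial_def] by (simp cong: continuous_on_cong)
  qed
  then show ?thesis by (simp add: partial_def)
qed

lemma smooth_time_derivative:
  fixes g :: "real \<times> (real^'n::finite) \<Rightarrow> 'b::real_normed_vector"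
  assumes g: "smooth_on_open U g" and z: "(t, x) \<in> U"
  shows "((\<lambda>s. g (s, x)) has_vector_derivative frechet_derivative g (at (t, x)) (1, 0)) (at t within S)"
proof -
  from smooth_on_open_has_derivative[OF g z]
  have "((\<lambda>s. g (s, x)) has_derivative (\<lambda>h. frechet_derivative g (at (t, x)) (h, 0))) (at t)"
    by (rule has_derivative_compose[rotated]) (auto intro!: derivative_eq_intros)
  moreover have "frechet_derivative g (at (t, x)) (h, 0) = h *\<^sub>R frechet_derivative g (at (t, x)) (1, 0)" for h
    using linear_cmul[OF has_derivative_linear[OF smooth_on_open_has_derivative[OF g z]], of h "(1, 0)"] by simp
  ultimately show ?thesis
    unfolding has_vector_derivative_def using has_derivative_at_withinI by (metis (no_types, lifting) ext)
qed

lemma continuous_slice_square_integrable: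
  fixes h :: "real \<times> (real^'n::finite) \<Rightarrow> 'b::euclidean_space"
  assumes \<Omega>: "open \<Omega>" "bounded \<Omega>" and h: "continuous_on (I \<times> closure \<Omega>) h" and t: "t \<in> I"
  shows "square_integrable \<Omega> (\<lambda>x. h (t, x))"
proof -
  have c: "continuous_on (closure \<Omega>) (\<lambda>x. h (t, x))"
    using t by (intro continuous_on_compose2[OF h]) (auto intro!: continuous_intros)
  then have "bounded ((\<lambda>x. h (t, x)) ` closure \<Omega>)"
    using \<Omega>(2) by (intro compact_imp_bounded compact_continuous_image) auto
  then obtain B where B: "\<And>x. x \<in> closure \<Omega> \<Longrightarrow> norm (h (t, x)) \<le> B" by (auto simp: bounded_iff)
  show ?thesis
  proof (rule square_integrable_bounded[OF lmeasurable_open[OF \<Omega>(2,1)]])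
    show "(\<lambda>x. h (t, x)) \<in> borel_measurable (lebesgue_on \<Omega>)"
      using continuous_on_subset[OF c closure_subset] \<Omega>(1)
      by (intro continuous_imp_measurable_on_sets_lebesgue) (auto simp: borel_open sets_completionI_sets)
    show "AE x in lebesgue_on \<Omega>. norm (h (t, x)) \<le> B"
      using B closure_subset[of \<Omega>] by (intro AE_I2) auto
  qed
qed

text \<open>Dominated convergence along sequences of times, with a bound of \<open>h\<close> on the
  compact cylinder times \<open>norm (w x)\<close> as majorant.\<close>

lemma continuous_on_l2_inner_slice:
  fixes h :: "real \<times> (real^'n::finite) \<Rightarrow> 'b::euclidean_space"
  assumes \<Omega>: "open \<Omega>" "bounded \<Omega>" and h: "continuous_on ({0..T} \<times> closure \<Omega>) h"
    and w: "square_integrable \<Omega> w"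
  shows "continuous_on {0..T} (\<lambda>t. l2_inner \<Omega> (\<lambda>x. h (t, x)) w)"
proof -
  have "compact ({0..T} \<times> closure \<Omega>)" using \<Omega>(2) by (intro compact_Times) auto
  then have "bounded (h ` ({0..T} \<times> closure \<Omega>))"
    using h by (intro compact_imp_bounded compact_continuous_image)
  then obtain B where B: "\<And>t x. t \<in> {0..T} \<Longrightarrow> x \<in> closure \<Omega> \<Longrightarrow> norm (h (t, x)) \<le> B"
    unfolding bounded_iff by blast
  have si: "square_integrable \<Omega> (\<lambda>x. h (t, x))" if "t \<in> {0..T}" for t
    by (rule continuous_slice_square_integrable[OF \<Omega> h that])
  have wn: "integrable (lebesgue_on \<Omega>) (\<lambda>x. B * norm (w x))"
  proof -
    have "square_integrable \<Omega> (\<lambda>x. norm (w x))" using w by (auto simp: square_integrable_def)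
    from integrable_of_square_integrable[OF lmeasurable_open[OF \<Omega>(2,1)] this] show ?thesis by simp
  qed
  show ?thesis
    unfolding continuous_on_sequentially
  proof (intro allI ballI impI)
    fix s t assume t: "t \<in> {0..T}" and s: "(\<forall>n. s n \<in> {0..T}) \<and> s \<longlonglongrightarrow> t"
    have "(\<lambda>n. LINT x|lebesgue_on \<Omega>. h (s n, x) \<bullet> w x) \<longlonglongrightarrow> (LINT x|lebesgue_on \<Omega>. h (t, x) \<bullet> w x)"
    proof (rule integral_dominated_convergence[where w="\<lambda>x. B * norm (w x)"])
      show "(\<lambda>x. h (t, x) \<bullet> w x) \<in> borel_measurable (lebesgue_on \<Omega>)"
        using square_integrable_integrable_inner[OF si[OF t] w] by simp
      show "(\<lambda>x. h (s n, x) \<bullet> w x) \<in> borel_measurable (lebesgue_on \<Omega>)" for n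
        using square_integrable_integrable_inner[OF si w] s by simp
      show "AE x in lebesgue_on \<Omega>. (\<lambda>n. h (s n, x) \<bullet> w x) \<longlonglongrightarrow> h (t, x) \<bullet> w x"
      proof (rule AE_I2)
        fix x assume "x \<in> space (lebesgue_on \<Omega>)"
        then have x: "x \<in> closure \<Omega>" using closure_subset by auto
        have "continuous_on {0..T} (\<lambda>t. h (t, x))"
          using x by (intro continuous_on_compose2[OF h]) (auto intro!: continuous_intros)
        then have "(\<lambda>n. h (s n, x)) \<longlonglongrightarrow> h (t, x)"
          using s t unfolding continuous_on_sequentially o_def by blast
        then show "(\<lambda>n. h (s n, x) \<bullet> w x) \<longlonglongrightarrow> h (t, x) \<bullet> w x" by (intro tendsto_intros)
      qed
      show "AE x in lebesgue_on \<Omega>. norm (h (s n, x) \<bullet> w x) \<le> B * norm (w x)" for n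
      proof (rule AE_I2)
        fix x assume "x \<in> space (lebesgue_on \<Omega>)"
        then have "x \<in> closure \<Omega>" using closure_subset by auto
        then have "norm (h (s n, x)) \<le> B" using B s by blast
        then show "norm (h (s n, x) \<bullet> w x) \<le> B * norm (w x)"
          using Cauchy_Schwarz_ineq2[of "h (s n, x)" "w x"]
          by (smt (verit) mult_right_mono norm_ge_zero real_norm_def)
      qed
    qed (rule wn)
    then show "((\<lambda>t. l2_inner \<Omega> (\<lambda>x. h (t, x)) w) \<circ> s) \<longlonglongrightarrow> l2_inner \<Omega> (\<lambda>x. h (t, x)) w"
      by (simp add: l2_inner_def o_def)
  qed
qed

text \<open>Differentiation under the integral: the mean value inequality in time bounds the
  difference quotients by a bound of the time derivative on the compact cylinder.\<close>

lemma l2_inner_slice_has_derivative: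
  fixes g :: "real \<times> (real^'n::finite) \<Rightarrow> 'b::euclidean_space"
  assumes \<Omega>: "open \<Omega>" "bounded \<Omega>" and g: "smooth_on_open U g" and U: "{0..T} \<times> closure \<Omega> \<subseteq> U"
    and w: "square_integrable \<Omega> w" and t: "t \<in> {0..T}"
  shows "((\<lambda>t. l2_inner \<Omega> (\<lambda>x. g (t, x)) w) has_real_derivative
      l2_inner \<Omega> (\<lambda>x. frechet_derivative g (at (t, x)) (1, 0)) w) (at t within {0..T})"
proof -
  let ?d = "\<lambda>z. frechet_derivative g (at z) (1, 0)"
  have gc: "continuous_on ({0..T} \<times> closure \<Omega>) g"
    using continuous_on_subset[OF smooth_on_open_continuous_on[OF g] U] .
  have dc: "continuous_on ({0..T} \<times> closure \<Omega>) ?d"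
    using continuous_on_subset[OF smooth_on_open_continuous_on[OF smooth_on_open_partial[OF g time_Basis]] U] .
  have "compact ({0..T} \<times> closure \<Omega>)" using \<Omega>(2) by (intro compact_Times) auto
  then have "bounded (?d ` ({0..T} \<times> closure \<Omega>))"
    using dc by (intro compact_imp_bounded compact_continuous_image)
  then obtain B where B: "\<And>t x. t \<in> {0..T} \<Longrightarrow> x \<in> closure \<Omega> \<Longrightarrow> norm (?d (t, x)) \<le> B"
    unfolding bounded_iff by blast
  have si: "square_integrable \<Omega> (\<lambda>x. g (t, x))" if "t \<in> {0..T}" for t
    by (rule continuous_slice_square_integrable[OF \<Omega> gc that])
  have sid: "square_integrable \<Omega> (\<lambda>x. ?d (t, x))"
    by (rule continuous_slice_square_integrable[OF \<Omega> dc t])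
  have wn: "integrable (lebesgue_on \<Omega>) (\<lambda>x. B * norm (w x))"
  proof -
    have "square_integrable \<Omega> (\<lambda>x. norm (w x))" using w by (auto simp: square_integrable_def)
    from integrable_of_square_integrable[OF lmeasurable_open[OF \<Omega>(2,1)] this] show ?thesis by simp
  qed
  have lip: "norm (g (s, x) - g (t, x)) \<le> B * norm (s - t)" if "s \<in> {0..T}" "x \<in> closure \<Omega>" for s x
  proof (rule differentiable_bound[of "{0..T}" "\<lambda>s. g (s, x)" "\<lambda>s h. h *\<^sub>R ?d (s, x)"])
    fix r assume r: "r \<in> {0..T}"
    show "((\<lambda>s. g (s, x)) has_derivative (\<lambda>h. h *\<^sub>R ?d (r, x))) (at r within {0..T})"
    proof -
      have "(r, x) \<in> U" using U r that(2) by blast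
      from smooth_time_derivative[OF g this] show ?thesis by (simp add: has_vector_derivative_def)
    qed
    show "onorm (\<lambda>h. h *\<^sub>R ?d (r, x)) \<le> B"
      using B[OF r that(2)] by (intro onorm_le) (simp add: mult.commute[of B] mult_left_mono)
  qed (use that t in auto)
  show ?thesis
    unfolding has_field_derivative_iff tendsto_at_iff_sequentially
  proof (intro allI impI)
    fix s assume s: "\<forall>n. s n \<in> {0..T} - {t}" "s \<longlonglongrightarrow> t"
    let ?q = "\<lambda>n x. (g (s n, x) - g (t, x)) /\<^sub>R (s n - t)"
    have siq: "square_integrable \<Omega> (?q n)" for n
      using s t by (intro square_integrable_scaleR square_integrable_diff si) auto
    have "(\<lambda>n. LINT x|lebesgue_on \<Omega>. ?q n x \<bullet> w x) \<longlonglongrightarrow> (LINT x|lebesgue_on \<Omega>. ?d (t, x) \<bullet> w x)"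
    proof (rule integral_dominated_convergence[where w="\<lambda>x. B * norm (w x)"])
      show "(\<lambda>x. ?d (t, x) \<bullet> w x) \<in> borel_measurable (lebesgue_on \<Omega>)"
        using square_integrable_integrable_inner[OF sid w] by simp
      show "(\<lambda>x. ?q n x \<bullet> w x) \<in> borel_measurable (lebesgue_on \<Omega>)" for n
        using square_integrable_integrable_inner[OF siq w] by blast
      show "AE x in lebesgue_on \<Omega>. (\<lambda>n. ?q n x \<bullet> w x) \<longlonglongrightarrow> ?d (t, x) \<bullet> w x"
      proof (rule AE_I2)
        fix x assume "x \<in> space (lebesgue_on \<Omega>)"
        then have x: "x \<in> closure \<Omega>" using closure_subset by auto
        then have "(t, x) \<in> U" using U t by blast
        from smooth_time_derivative[OF g this, of "{0..T}"]
        have "((\<lambda>s. g (s, x) \<bullet> w x) has_derivative (\<lambda>h. (h *\<^sub>R ?d (t, x)) \<bullet> w x)) (at t within {0..T})"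
          unfolding has_vector_derivative_def by (rule has_derivative_inner_left)
        then have "((\<lambda>s. g (s, x) \<bullet> w x) has_real_derivative ?d (t, x) \<bullet> w x) (at t within {0..T})"
          by (simp add: has_field_derivative_def mult.commute[of _ "?d (t, x) \<bullet> w x"])
        then have "(\<lambda>n. (g (s n, x) \<bullet> w x - g (t, x) \<bullet> w x) / (s n - t)) \<longlonglongrightarrow> ?d (t, x) \<bullet> w x"
          using s unfolding has_field_derivative_iff tendsto_at_iff_sequentially o_def by blast
        then show "(\<lambda>n. ?q n x \<bullet> w x) \<longlonglongrightarrow> ?d (t, x) \<bullet> w x"
          by (simp add: inner_diff_left divide_inverse mult.commute)
      qed
      show "AE x in lebesgue_on \<Omega>. norm (?q n x \<bullet> w x) \<le> B * norm (w x)" for n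
      proof (rule AE_I2)
        fix x assume "x \<in> space (lebesgue_on \<Omega>)"
        then have x: "x \<in> closure \<Omega>" using closure_subset by auto
        have ne: "s n \<noteq> t" "s n \<in> {0..T}" using s by auto
        have "norm (?q n x) \<le> B"
          using lip[OF ne(2) x] ne by (simp add: divide_simps mult.commute)
        then show "norm (?q n x \<bullet> w x) \<le> B * norm (w x)"
          using Cauchy_Schwarz_ineq2[of "?q n x" "w x"]
          by (smt (verit) mult_right_mono norm_ge_zero real_norm_def)
      qed
    qed (rule wn)
    moreover have "(LINT x|lebesgue_on \<Omega>. ?q n x \<bullet> w x) =
        (l2_inner \<Omega> (\<lambda>x. g (s n, x)) w - l2_inner \<Omega> (\<lambda>x. g (t, x)) w) / (s n - t)" for n
    proof -
      have sn: "s n \<in> {0..T}" using s by auto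
      have "l2_inner \<Omega> (?q n) w = inverse (s n - t) * l2_inner \<Omega> (\<lambda>x. g (s n, x) - g (t, x)) w"
        using w si[OF sn] si[OF t] by (intro L2.ip_scale_left) (auto intro: square_integrable_diff)
      also have "\<dots> = inverse (s n - t) * (l2_inner \<Omega> (\<lambda>x. g (s n, x)) w - l2_inner \<Omega> (\<lambda>x. g (t, x)) w)"
        using w si[OF sn] si[OF t] by (subst L2.ip_diff_left) auto
      finally show ?thesis by (simp add: l2_inner_def divide_inverse mult.commute)
    qed
    ultimately show "((\<lambda>s. (l2_inner \<Omega> (\<lambda>x. g (s, x)) w - l2_inner \<Omega> (\<lambda>x. g (t, x)) w) / (s - t)) \<circ> s)
        \<longlonglongrightarrow> l2_inner \<Omega> (\<lambda>x. ?d (t, x)) w"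
      by (simp add: o_def l2_inner_def)
  qed
qed

text \<open>Pairing with a fixed field is Lipschitz for the L2 norm, so norm regularity in time
  becomes ordinary calculus for scalar functions.\<close>

lemma l2_continuous_on_l2_inner:
  assumes w: "l2_continuous_on \<Omega> I w" and si: "\<And>t. t \<in> I \<Longrightarrow> square_integrable \<Omega> (w t)"
    and b: "square_integrable \<Omega> b"
  shows "continuous_on I (\<lambda>t. l2_inner \<Omega> (w t) b)"
  unfolding continuous_on_def
proof
  fix t assume t: "t \<in> I"
  have "((\<lambda>s. l2_norm \<Omega> (\<lambda>x. w s x - w t x) * l2_norm \<Omega> b) \<longlongrightarrow> 0) (at t within I)"
    using w t by (intro tendsto_mult_left_zero) (auto simp: l2_continuous_on_def)
  moreover have "eventually (\<lambda>s. norm (l2_inner \<Omega> (w s) b - l2_inner \<Omega> (w t) b)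
      \<le> l2_norm \<Omega> (\<lambda>x. w s x - w t x) * l2_norm \<Omega> b) (at t within I)"
    unfolding eventually_at_filter
  proof (intro always_eventually allI impI)
    fix s assume s: "s \<in> I"
    have d: "square_integrable \<Omega> (\<lambda>x. w s x - w t x)" by (intro square_integrable_diff si s t)
    have "l2_inner \<Omega> (w s) b - l2_inner \<Omega> (w t) b = l2_inner \<Omega> (\<lambda>x. w s x - w t x) b"
      using si s t b by (subst L2.ip_diff_left) auto
    then show "norm (l2_inner \<Omega> (w s) b - l2_inner \<Omega> (w t) b) \<le> l2_norm \<Omega> (\<lambda>x. w s x - w t x) * l2_norm \<Omega> b"
      using l2_inner_abs_le[OF d b] by simp
  qed
  ultimately have "((\<lambda>s. l2_inner \<Omega> (w s) b - l2_inner \<Omega> (w t) b) \<longlongrightarrow> 0) (at t within I)"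
    by (rule Lim_null_comparison[rotated])
  then show "((\<lambda>s. l2_inner \<Omega> (w s) b) \<longlongrightarrow> l2_inner \<Omega> (w t) b) (at t within I)"
    by (simp add: LIM_zero_iff)
qed

lemma l2_has_time_derivative_l2_inner:
  assumes w: "l2_has_time_derivative \<Omega> w w' (at t within I) t" and t: "t \<in> I"
    and si: "\<And>t. t \<in> I \<Longrightarrow> square_integrable \<Omega> (w t)" "square_integrable \<Omega> w'"
    and b: "square_integrable \<Omega> b"
  shows "((\<lambda>t. l2_inner \<Omega> (w t) b) has_real_derivative l2_inner \<Omega> w' b) (at t within I)"
  unfolding has_field_derivative_iff
proof -
  let ?r = "\<lambda>s x. (w s x - w t x) /\<^sub>R (s - t) - w' x"
  have "((\<lambda>s. l2_norm \<Omega> (?r s) * l2_norm \<Omega> b) \<longlongrightarrow> 0) (at t within I)"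
    using w by (intro tendsto_mult_left_zero) (simp add: l2_has_time_derivative_def)
  moreover have "eventually (\<lambda>s. norm ((l2_inner \<Omega> (w s) b - l2_inner \<Omega> (w t) b) / (s - t) - l2_inner \<Omega> w' b)
      \<le> l2_norm \<Omega> (?r s) * l2_norm \<Omega> b) (at t within I)"
    unfolding eventually_at_filter
  proof (intro always_eventually allI impI)
    fix s assume s: "s \<in> I"
    have d: "square_integrable \<Omega> (\<lambda>x. w s x - w t x)" using si s t by (intro square_integrable_diff) auto
    then have d': "square_integrable \<Omega> (\<lambda>x. (w s x - w t x) /\<^sub>R (s - t))" by (rule square_integrable_scaleR)
    have "l2_inner \<Omega> (?r s) b = l2_inner \<Omega> (\<lambda>x. (w s x - w t x) /\<^sub>R (s - t)) b - l2_inner \<Omega> w' b"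
      using d' si b by (subst L2.ip_diff_left) auto
    also have "l2_inner \<Omega> (\<lambda>x. (w s x - w t x) /\<^sub>R (s - t)) b = inverse (s - t) * l2_inner \<Omega> (\<lambda>x. w s x - w t x) b"
      using d b by (intro L2.ip_scale_left) auto
    also have "l2_inner \<Omega> (\<lambda>x. w s x - w t x) b = l2_inner \<Omega> (w s) b - l2_inner \<Omega> (w t) b"
      using si s t b by (subst L2.ip_diff_left) auto
    finally have "(l2_inner \<Omega> (w s) b - l2_inner \<Omega> (w t) b) / (s - t) - l2_inner \<Omega> w' b = l2_inner \<Omega> (?r s) b"
      by (simp add: divide_inverse mult.commute)
    then show "norm ((l2_inner \<Omega> (w s) b - l2_inner \<Omega> (w t) b) / (s - t) - l2_inner \<Omega> w' b)
      \<le> l2_norm \<Omega> (?r s) * l2_norm \<Omega> b"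
      using l2_inner_abs_le[OF square_integrable_diff[OF d' si(2)] b] by simp
  qed
  ultimately have "((\<lambda>s. (l2_inner \<Omega> (w s) b - l2_inner \<Omega> (w t) b) / (s - t) - l2_inner \<Omega> w' b) \<longlongrightarrow> 0) (at t within I)"
    by (rule Lim_null_comparison[rotated])
  then show "((\<lambda>s. (l2_inner \<Omega> (w s) b - l2_inner \<Omega> (w t) b) / (s - t)) \<longlongrightarrow> l2_inner \<Omega> w' b) (at t within I)"
    by (simp add: LIM_zero_iff)
qed

text \<open>The integrating factor \<open>exp (- (t / T))\<close> removes the term
  \<open>E t / T\<close>. On \<open>[0,T]\<close> it lies between \<open>exp (-1)\<close> and
  \<open>1\<close>: the lower bound is used in front of \<open>N\<close>, the upper one in front of
  \<open>a\<close>, and the ratio of the two is the constant.\<close>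

lemma gronwall_energy:
  fixes E E' N a :: "real \<Rightarrow> real"
  assumes T: "T > 0" and \<nu>: "\<nu> \<ge> 0"
    and cont: "continuous_on {0..T} E" "continuous_on {0..T} N" "continuous_on {0..T} a"
    and E': "\<And>t. 0 < t \<Longrightarrow> t < T \<Longrightarrow> (E has_real_derivative E' t) (at t)"
    and le: "\<And>t. 0 < t \<Longrightarrow> t < T \<Longrightarrow> E' t + \<nu> * N t \<le> a t + E t / T"
    and nonneg: "\<And>t. t \<in> {0..T} \<Longrightarrow> 0 \<le> N t" "\<And>t. t \<in> {0..T} \<Longrightarrow> 0 \<le> a t"
    and E0: "E 0 = 0"
  shows "E T + \<nu> * integral {0..T} N \<le> exp 1 * integral {0..T} a"
proof -
  let ?w = "\<lambda>t. exp (- (t / T))"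
  have wc: "continuous_on {0..T} ?w" using T by (auto intro!: continuous_intros)
  let ?b = "\<lambda>t. ?w t * (\<nu> * N t - a t)"
  have bc: "continuous_on {0..T} ?b" using T wc cont by (intro continuous_intros) auto
  \<comment> \<open>Adding the integral of the continuous function \<open>?b\<close> gives a
    nonincreasing quantity by pointwise differentiation, so \<open>E'\<close> itself is never
    integrated.\<close>
  define \<Phi> where "\<Phi> t = ?w t * E t + integral {0..t} ?b" for t
  have "\<Phi> T \<le> \<Phi> 0"
  proof (rule DERIV_nonpos_imp_decreasing_open[of 0 T \<Phi>])
    show "\<exists>y. (\<Phi> has_real_derivative y) (at t) \<and> y \<le> 0" if t: "0 < t" "t < T" for t
    proof (intro exI conjI)
      have "((\<lambda>t. integral {0..t} ?b) has_real_derivative ?b t) (at t within {0..T})"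
        using t by (intro integral_has_real_derivative bc) auto
      then have "((\<lambda>t. integral {0..t} ?b) has_real_derivative ?b t) (at t)"
        using t by (simp add: at_within_Icc_at)
      then show "(\<Phi> has_real_derivative ?w t * (- (1 / T)) * E t + ?w t * E' t + ?b t) (at t)"
        unfolding \<Phi>_def using E'[OF t] T by (auto intro!: derivative_eq_intros)
      have "?w t * (E' t + \<nu> * N t - a t - E t / T) \<le> 0"
        using le[OF t] by (intro mult_nonneg_nonpos) auto
      then show "?w t * (- (1 / T)) * E t + ?w t * E' t + ?b t \<le> 0"
        by (simp add: algebra_simps)
    qed
    show "continuous_on {0..T} \<Phi>"
      unfolding \<Phi>_def using T wc cont indefinite_integral_continuous_1[OF integrable_continuous_interval[OF bc]]
      by (intro continuous_intros) auto
  qed (use T in simp)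
  then have main: "exp (-1) * E T + integral {0..T} ?b \<le> 0" using T E0 by (simp add: \<Phi>_def)
  have "integral {0..T} (\<lambda>t. exp (-1) * \<nu> * N t - a t) \<le> integral {0..T} ?b"
  proof (rule integral_le)
    show "(\<lambda>t. exp (-1) * \<nu> * N t - a t) integrable_on {0..T}"
      using cont by (intro integrable_continuous_interval continuous_intros)
    show "?b integrable_on {0..T}" by (rule integrable_continuous_interval[OF bc])
    fix t assume t: "t \<in> {0..T}"
    have w: "exp (-1) \<le> ?w t" "?w t \<le> 1" using t T by (auto simp: field_simps)
    have "exp (-1) * (\<nu> * N t) \<le> ?w t * (\<nu> * N t)" "?w t * a t \<le> 1 * a t"
      using w nonneg[OF t] \<nu> by (intro mult_right_mono; simp)+
    then show "exp (-1) * \<nu> * N t - a t \<le> ?b t" by (simp add: algebra_simps)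
  qed
  moreover have "integral {0..T} (\<lambda>t. exp (-1) * \<nu> * N t - a t) = exp (-1) * \<nu> * integral {0..T} N - integral {0..T} a"
    using cont by (subst integral_diff) (auto intro!: integrable_continuous_interval continuous_intros)
  ultimately have "exp (-1) * (E T + \<nu> * integral {0..T} N) \<le> integral {0..T} a"
    using main by (simp add: algebra_simps)
  then have "exp 1 * (exp (-1) * (E T + \<nu> * integral {0..T} N)) \<le> exp 1 * integral {0..T} a"
    by (intro mult_left_mono) auto
  then show ?thesis unfolding mult.assoc[symmetric] mult_exp_exp by simp
qed

section \<open>Discrete spaces and projections\<close>

definition H1_vec :: "(real^'n::finite) set \<Rightarrow> (real^'n \<Rightarrow> real^'n) set" where
  "H1_vec \<Omega> = {v. \<forall>i. (\<lambda>x. v x $ i) \<in> H1 \<Omega>}"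

definition grad_ip :: "(real^'n::finite) set \<Rightarrow> (real^'n \<Rightarrow> real^'n) \<Rightarrow> (real^'n \<Rightarrow> real^'n) \<Rightarrow> real" where
  "grad_ip \<Omega> v w = l2_inner \<Omega> (weak_Grad \<Omega> v) (weak_Grad \<Omega> w)"

lemma ae_eq_vec:
  fixes f g :: "real^'n::finite \<Rightarrow> 'b^'m::finite"
  assumes "\<And>i. ae_eq \<Omega> (\<lambda>x. f x $ i) (\<lambda>x. g x $ i)" shows "ae_eq \<Omega> f g"
proof -
  have "AE x in lebesgue_on \<Omega>. \<forall>i. f x $ i = g x $ i"
    using assms by (simp add: ae_eq_def AE_all_countable)
  then show ?thesis unfolding ae_eq_def by eventually_elim (simp add: vec_eq_iff)
qed

context
  fixes \<Omega> :: "(real^'n::finite) set"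
  assumes \<Omega>: "open \<Omega>" "bounded \<Omega>"
begin

lemma weak_Grad_component:
  "weak_Grad \<Omega> v x $ i $ j = weak_partial \<Omega> j (\<lambda>x. v x $ i) x"
  by (simp add: weak_Grad_def weak_grad_def)

lemma H1_vec_square_integrable: "v \<in> H1_vec \<Omega> \<Longrightarrow> square_integrable \<Omega> v"
  using H1_square_integrable[OF \<Omega>] by (intro square_integrable_vec) (simp add: H1_vec_def)

lemma weak_Grad_square_integrable:
  assumes "v \<in> H1_vec \<Omega>" shows "square_integrable \<Omega> (weak_Grad \<Omega> v)"
proof (intro square_integrable_vec)
  fix i j
  show "square_integrable \<Omega> (\<lambda>x. weak_Grad \<Omega> v x $ i $ j)"
    unfolding weak_Grad_component
    using H1_weak_partial_square_integrable[OF \<Omega>] assms by (simp add: H1_vec_def)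
qed

lemma grad_ip_sum:
  assumes "v \<in> H1_vec \<Omega>" "w \<in> H1_vec \<Omega>"
  shows "grad_ip \<Omega> v w = (\<Sum>i\<in>UNIV. \<Sum>j\<in>UNIV.
    l2_inner \<Omega> (weak_partial \<Omega> j (\<lambda>x. v x $ i)) (weak_partial \<Omega> j (\<lambda>x. w x $ i)))"
  unfolding grad_ip_def
  by (subst l2_inner_vec[OF weak_Grad_square_integrable[OF assms(1)] weak_Grad_square_integrable[OF assms(2)]],
      intro sum.cong refl, subst l2_inner_vec)
    (simp_all add: weak_Grad_component square_integrable_component weak_Grad_square_integrable assms)

lemma weak_Grad_add:
  assumes "v \<in> H1_vec \<Omega>" "w \<in> H1_vec \<Omega>"
  shows "ae_eq \<Omega> (weak_Grad \<Omega> (\<lambda>x. v x + w x)) (\<lambda>x. weak_Grad \<Omega> v x + weak_Grad \<Omega> w x)"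
  using weak_partial_add[OF \<Omega>] assms
  by (intro ae_eq_vec) (simp add: weak_Grad_component H1_vec_def)

lemma weak_Grad_scale:
  assumes "v \<in> H1_vec \<Omega>"
  shows "ae_eq \<Omega> (weak_Grad \<Omega> (\<lambda>x. c *\<^sub>R v x)) (\<lambda>x. c *\<^sub>R weak_Grad \<Omega> v x)"
  using weak_partial_scale[OF \<Omega>] assms
  by (intro ae_eq_vec) (simp add: weak_Grad_component H1_vec_def)

lemma H1_vec_add: "v \<in> H1_vec \<Omega> \<Longrightarrow> w \<in> H1_vec \<Omega> \<Longrightarrow> (\<lambda>x. v x + w x) \<in> H1_vec \<Omega>"
  using H1_add[OF \<Omega>] by (simp add: H1_vec_def)

lemma H1_vec_scale: "v \<in> H1_vec \<Omega> \<Longrightarrow> (\<lambda>x. c *\<^sub>R v x) \<in> H1_vec \<Omega>"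
  using H1_scale[OF \<Omega>] by (simp add: H1_vec_def)

lemma H1_vec_zero: "(\<lambda>x. 0) \<in> H1_vec \<Omega>"
  using is_weak_partial_zero[OF \<Omega>] by (auto simp: H1_vec_def H1_def square_integrable_zero)

text \<open>The weak gradients of a sum and of its terms are separate choices, so linearity is known
  only almost everywhere; inside the integrals this is enough.\<close>

lemma semi_inner_space_grad: "semi_inner_space (H1_vec \<Omega>) (grad_ip \<Omega>)"
proof
  fix u v w :: "real^'n \<Rightarrow> real^'n" and c :: real
  assume u: "u \<in> H1_vec \<Omega>" and v: "v \<in> H1_vec \<Omega>" and w: "w \<in> H1_vec \<Omega>"
  note si = weak_Grad_square_integrable
  have "grad_ip \<Omega> (\<lambda>x. u x + v x) w = l2_inner \<Omega> (\<lambda>x. weak_Grad \<Omega> u x + weak_Grad \<Omega> v x) (weak_Grad \<Omega> w)"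
    unfolding grad_ip_def using u v w
    by (intro l2_inner_cong_AE weak_Grad_add ae_eq_refl si H1_vec_add square_integrable_add)
  then show "grad_ip \<Omega> (\<lambda>x. u x + v x) w = grad_ip \<Omega> u w + grad_ip \<Omega> v w"
    using u v w by (simp add: grad_ip_def L2.ip_add_left si)
next
  fix v w :: "real^'n \<Rightarrow> real^'n" and c :: real
  assume v: "v \<in> H1_vec \<Omega>" and w: "w \<in> H1_vec \<Omega>"
  note si = weak_Grad_square_integrable
  have "grad_ip \<Omega> (\<lambda>x. c *\<^sub>R v x) w = l2_inner \<Omega> (\<lambda>x. c *\<^sub>R weak_Grad \<Omega> v x) (weak_Grad \<Omega> w)"
    unfolding grad_ip_def using v w
    by (intro l2_inner_cong_AE weak_Grad_scale ae_eq_refl si H1_vec_scale square_integrable_scaleR)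
  then show "grad_ip \<Omega> (\<lambda>x. c *\<^sub>R v x) w = c * grad_ip \<Omega> v w"
    using v w by (simp add: grad_ip_def L2.ip_scale_left si)
qed (auto simp: H1_vec_zero H1_vec_add H1_vec_scale grad_ip_def weak_Grad_square_integrable
    L2.ip_commute L2.ip_nonneg)

text \<open>This links the two semi-inner products: a remainder that is null for L2 is null for the
  Dirichlet form, so an L2 expansion can be inserted into gradient terms.\<close>

lemma grad_ip_null:
  assumes "v \<in> H1_vec \<Omega>" "l2_inner \<Omega> v v = 0" shows "grad_ip \<Omega> v v = 0"
proof -
  have z: "ae_eq \<Omega> v (\<lambda>x. 0)"
    using assms H1_vec_square_integrable by (intro ae_eq_zero_of_l2_null)
  have "ae_eq \<Omega> (\<lambda>x. v x $ i) (\<lambda>x. 0)" for i using z unfolding ae_eq_def by eventually_elim simp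
  then have "ae_eq \<Omega> (weak_Grad \<Omega> v) (\<lambda>x. 0)"
    using weak_partial_null[OF \<Omega>] assms(1)
    by (intro ae_eq_vec) (simp add: weak_Grad_component H1_vec_def)
  then have "grad_ip \<Omega> v v = l2_inner \<Omega> (\<lambda>x. 0) (weak_Grad \<Omega> v)"
    unfolding grad_ip_def using assms(1)
    by (intro l2_inner_cong_AE ae_eq_refl weak_Grad_square_integrable square_integrable_zero)
  then show ?thesis by (simp add: l2_inner_def)
qed

section \<open>Pairings with the weak divergence\<close>

lemma weak_div_square_integrable:
  "v \<in> H1_vec \<Omega> \<Longrightarrow> square_integrable \<Omega> (weak_div \<Omega> v)"
  unfolding weak_div_def[abs_def] using H1_weak_partial_square_integrable[OF \<Omega>]
  by (intro square_integrable_sum) (simp add: H1_vec_def)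

lemma l2_inner_weak_div:
  assumes "v \<in> H1_vec \<Omega>" "square_integrable \<Omega> q"
  shows "l2_inner \<Omega> (weak_div \<Omega> v) q = (\<Sum>i\<in>UNIV. l2_inner \<Omega> (weak_partial \<Omega> i (\<lambda>x. v x $ i)) q)"
  unfolding weak_div_def[abs_def]
  using L2.ip_sum_left[of UNIV "\<lambda>i. weak_partial \<Omega> i (\<lambda>x. v x $ i)" \<Omega> q "\<lambda>_. 1"]
    assms H1_weak_partial_square_integrable[OF \<Omega>] by (simp add: H1_vec_def)

lemma l2_inner_weak_div_add:
  assumes v: "v \<in> H1_vec \<Omega>" and w: "w \<in> H1_vec \<Omega>" and q: "square_integrable \<Omega> q"
  shows "l2_inner \<Omega> (weak_div \<Omega> (\<lambda>x. v x + w x)) q = l2_inner \<Omega> (weak_div \<Omega> v) q + l2_inner \<Omega> (weak_div \<Omega> w) q"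
proof -
  have "l2_inner \<Omega> (weak_partial \<Omega> i (\<lambda>x. v x $ i + w x $ i)) q =
      l2_inner \<Omega> (weak_partial \<Omega> i (\<lambda>x. v x $ i)) q + l2_inner \<Omega> (weak_partial \<Omega> i (\<lambda>x. w x $ i)) q" for i
  proof -
    have H: "(\<lambda>x. v x $ i) \<in> H1 \<Omega>" "(\<lambda>x. w x $ i) \<in> H1 \<Omega>" using v w by (auto simp: H1_vec_def)
    note si = H1_weak_partial_square_integrable[OF \<Omega>]
    have "l2_inner \<Omega> (weak_partial \<Omega> i (\<lambda>x. v x $ i + w x $ i)) q =
        l2_inner \<Omega> (\<lambda>x. weak_partial \<Omega> i (\<lambda>x. v x $ i) x + weak_partial \<Omega> i (\<lambda>x. w x $ i) x) q"
      using H q by (intro l2_inner_cong_AE weak_partial_add[OF \<Omega>] ae_eq_refl si square_integrable_add H1_add[OF \<Omega>])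
    then show ?thesis using H q si by (simp add: L2.ip_add_left)
  qed
  then show ?thesis
    using assms by (simp add: l2_inner_weak_div H1_vec_add sum.distrib)
qed

lemma l2_inner_weak_div_scale:
  assumes v: "v \<in> H1_vec \<Omega>" and q: "square_integrable \<Omega> q"
  shows "l2_inner \<Omega> (weak_div \<Omega> (\<lambda>x. c *\<^sub>R v x)) q = c * l2_inner \<Omega> (weak_div \<Omega> v) q"
proof -
  have "l2_inner \<Omega> (weak_partial \<Omega> i (\<lambda>x. c * v x $ i)) q =
      c * l2_inner \<Omega> (weak_partial \<Omega> i (\<lambda>x. v x $ i)) q" for i
  proof -
    have H: "(\<lambda>x. v x $ i) \<in> H1 \<Omega>" using v by (auto simp: H1_vec_def)
    note si = H1_weak_partial_square_integrable[OF \<Omega>]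
    have "l2_inner \<Omega> (weak_partial \<Omega> i (\<lambda>x. c * v x $ i)) q =
        l2_inner \<Omega> (\<lambda>x. c *\<^sub>R weak_partial \<Omega> i (\<lambda>x. v x $ i) x) q"
      using H q weak_partial_scale[OF \<Omega> H, of i c]
      by (intro l2_inner_cong_AE ae_eq_refl si square_integrable_scaleR H1_scale[OF \<Omega>]) simp_all
    also have "\<dots> = c * l2_inner \<Omega> (weak_partial \<Omega> i (\<lambda>x. v x $ i)) q"
      using H q si by (intro L2.ip_scale_left) auto
    finally show ?thesis .
  qed
  then show ?thesis
    using assms by (simp add: l2_inner_weak_div H1_vec_scale sum_distrib_left)
qed

text \<open>Integration by parts in each component, with the zero boundary values carried by
  \<open>v\<close>. \<open>G\<close> may be any representative of the weak gradient, classical or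
  chosen.\<close>

lemma l2_inner_weak_grad_eq_minus_weak_div:
  assumes q: "square_integrable \<Omega> q" and G: "\<And>i. is_weak_partial \<Omega> i q (\<lambda>x. G x $ i)"
    and v: "v \<in> H1_0_vec \<Omega>"
  shows "l2_inner \<Omega> G v = - l2_inner \<Omega> q (weak_div \<Omega> v)"
proof -
  have vH: "v \<in> H1_vec \<Omega>" using v by (auto simp: H1_0_vec_def H1_vec_def H1_0_def)
  have "square_integrable \<Omega> G" using G by (intro square_integrable_vec) (auto simp: is_weak_partial_def)
  then have "l2_inner \<Omega> G v = (\<Sum>i\<in>UNIV. l2_inner \<Omega> (\<lambda>x. G x $ i) (\<lambda>x. v x $ i))"
    using H1_vec_square_integrable[OF vH] by (intro l2_inner_vec)
  also have "\<dots> = (\<Sum>i\<in>UNIV. - l2_inner \<Omega> q (weak_partial \<Omega> i (\<lambda>x. v x $ i)))"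
    using H1_0_integration_by_parts[OF \<Omega> _ q G] v by (simp add: H1_0_vec_def)
  also have "\<dots> = - l2_inner \<Omega> q (weak_div \<Omega> v)"
    using l2_inner_weak_div[OF vH q] H1_weak_partial_square_integrable[OF \<Omega>] vH q weak_div_square_integrable[OF vH]
    by (simp add: L2.ip_commute[of q] H1_vec_def sum_negf)
  finally show ?thesis .
qed

end

section \<open>The discretely divergence-free space and its projections\<close>

locale stokes_discretization =
  fixes \<Omega> :: "(real^'n::finite) set" and \<T> :: "(real^'n) set set" and k :: nat
    and V :: "(real^'n \<Rightarrow> real^'n) set" and Q :: "(real^'n \<Rightarrow> real) set"
  assumes open_domain: "open \<Omega>" and bounded_domain: "bounded \<Omega>" and convex_domain: "convex \<Omega>"
    and nonempty_domain: "\<Omega> \<noteq> {}"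
    and triangulation: "triangulation \<T>" "\<Union>\<T> = closure \<Omega>" and order_pos: "k \<ge> 1"
    and conforming: "conforming_pair \<Omega> V Q"
    and lagrange: "contains_lagrange_space \<Omega> Q \<T> k"
begin

sublocale mesh: lagrange_mesh \<T> k
  using triangulation order_pos by unfold_locales

sublocale grad: semi_inner_space "H1_vec \<Omega>" "grad_ip \<Omega>"
  by (rule semi_inner_space_grad[OF open_domain bounded_domain])

lemmas domain = open_domain bounded_domain

abbreviation V0 :: "(real^'n \<Rightarrow> real^'n) set" where
  "V0 \<equiv> discretely_div_free \<Omega> V Q"

lemma V_subset_H1_0_vec: "V \<subseteq> H1_0_vec \<Omega>"
  using conforming by (simp add: conforming_pair_def)

lemma V_subset: "V \<subseteq> H1_vec \<Omega>"
  using V_subset_H1_0_vec by (auto simp: H1_0_vec_def H1_vec_def H1_0_def)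

lemma V0_subset_V: "V0 \<subseteq> V"
  by (auto simp: discretely_div_free_def)

lemma V_square_integrable: "v \<in> V \<Longrightarrow> square_integrable \<Omega> v"
  using V_subset H1_vec_square_integrable[OF domain] by blast

lemma Q_square_integrable: "q \<in> Q \<Longrightarrow> square_integrable \<Omega> q"
  using conforming by (auto simp: conforming_pair_def L2_0_def)

lemma V_closed:
  "(\<lambda>x. 0) \<in> V" "v \<in> V \<Longrightarrow> w \<in> V \<Longrightarrow> (\<lambda>x. v x + w x) \<in> V" "v \<in> V \<Longrightarrow> (\<lambda>x. c *\<^sub>R v x) \<in> V"
  using conforming by (auto simp: conforming_pair_def finite_dim_function_space_def)

lemma V_diff: "v \<in> V \<Longrightarrow> w \<in> V \<Longrightarrow> (\<lambda>x. v x - w x) \<in> V"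
  using V_closed(2)[OF _ V_closed(3)[of w "-1"], of v] by simp

lemma V0_closed:
  "(\<lambda>x. 0) \<in> V0" "v \<in> V0 \<Longrightarrow> w \<in> V0 \<Longrightarrow> (\<lambda>x. v x + w x) \<in> V0" "v \<in> V0 \<Longrightarrow> (\<lambda>x. c *\<^sub>R v x) \<in> V0"
proof -
  show sc: "(\<lambda>x. c *\<^sub>R v x) \<in> V0" if "v \<in> V0" for v c
    using that V_closed(3) V_subset l2_inner_weak_div_scale[OF domain _ Q_square_integrable]
    by (auto simp: discretely_div_free_def subset_iff)
  show "(\<lambda>x. v x + w x) \<in> V0" if "v \<in> V0" "w \<in> V0" for v w
    using that V_closed(2) V_subset l2_inner_weak_div_add[OF domain _ _ Q_square_integrable]
    by (auto simp: discretely_div_free_def subset_iff)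
  have "l2_inner \<Omega> (weak_div \<Omega> (\<lambda>x. 0)) q = 0" if "q \<in> Q" for q
    using l2_inner_weak_div_scale[OF domain _ Q_square_integrable[OF that], of "\<lambda>x. 0" 0] H1_vec_zero[OF domain]
    by simp
  then show "(\<lambda>x. 0) \<in> V0" using V_closed(1) by (simp add: discretely_div_free_def)
qed

lemma V0_diff: "v \<in> V0 \<Longrightarrow> w \<in> V0 \<Longrightarrow> (\<lambda>x. v x - w x) \<in> V0"
  using V0_closed(2)[OF _ V0_closed(3)[of w "-1"], of v] by simp

lemma V0_square_integrable: "v \<in> V0 \<Longrightarrow> square_integrable \<Omega> v"
  using V0_subset_V V_square_integrable by blast

lemma V0_subset: "V0 \<subseteq> H1_vec \<Omega>"
  using V0_subset_V V_subset by blast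

lemma V0_subsp_L2: "L2.subsp \<Omega> V0"
  unfolding L2.subsp_def using V0_closed V0_square_integrable by auto

lemma V0_subsp_grad: "grad.subsp V0"
  unfolding grad.subsp_def using V0_closed V0_subset by auto

text \<open>The generators span \<open>V\<close> up to almost everywhere equality, and a remainder
  that vanishes almost everywhere is null for both forms. They may fail to be discretely divergence
  free, hence the detour through \<open>null_span\<close>.\<close>

lemma bases_exist:
  "\<exists>E. L2.orthonormal_basis \<Omega> V0 E" "\<exists>E. grad.orthonormal_basis V0 E"
proof -
  have "\<exists>B. finite B \<and> B \<subseteq> V \<and> (\<forall>v\<in>V. \<exists>c. ae_eq \<Omega> v (\<lambda>x. \<Sum>b\<in>B. c b *\<^sub>R b x))"
    using conforming unfolding conforming_pair_def finite_dim_function_space_def by (elim conjE)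
  then obtain B where B0: "finite B \<and> B \<subseteq> V \<and> (\<forall>v\<in>V. \<exists>c. ae_eq \<Omega> v (\<lambda>x. \<Sum>b\<in>B. c b *\<^sub>R b x))" ..
  have B: "finite B" "B \<subseteq> V" using B0 by simp_all
  have span: "\<exists>c. ae_eq \<Omega> v (\<lambda>x. \<Sum>b\<in>B. c b *\<^sub>R b x)" if "v \<in> V" for v
    by (rule bspec[OF conjunct2[OF conjunct2[OF B0]] that])
  have BH: "B \<subseteq> H1_vec \<Omega>" using B V_subset by blast
  have BL: "B \<subseteq> Collect (square_integrable \<Omega>)" using B V_square_integrable by auto
  have null: "\<exists>c. l2_inner \<Omega> (\<lambda>x. v x - (\<Sum>b\<in>B. c b *\<^sub>R b x)) (\<lambda>x. v x - (\<Sum>b\<in>B. c b *\<^sub>R b x)) = 0 \<and>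
      (\<lambda>x. v x - (\<Sum>b\<in>B. c b *\<^sub>R b x)) \<in> H1_vec \<Omega>" if v: "v \<in> V" for v
  proof -
    obtain c where c: "ae_eq \<Omega> v (\<lambda>x. \<Sum>b\<in>B. c b *\<^sub>R b x)" using span[OF v] ..
    let ?d = "\<lambda>x. v x - (\<Sum>b\<in>B. c b *\<^sub>R b x)"
    have H: "?d \<in> H1_vec \<Omega>" using v V_subset BH by (intro grad.diff_mem grad.sum_mem) auto
    then have s: "square_integrable \<Omega> ?d" by (rule H1_vec_square_integrable[OF domain])
    have z: "ae_eq \<Omega> ?d (\<lambda>x. 0)" using c unfolding ae_eq_def by eventually_elim simp
    have "l2_inner \<Omega> ?d ?d = l2_inner \<Omega> (\<lambda>x. 0) (\<lambda>x. 0 :: real^'n)"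
      by (rule l2_inner_cong_AE[OF z z s square_integrable_zero s square_integrable_zero])
    also have "\<dots> = 0" by (simp add: l2_inner_def)
    finally show ?thesis using H by (intro exI[of _ c] conjI)
  qed
  have "v \<in> L2.null_span \<Omega> B \<inter> grad.null_span B" if "v \<in> V0" for v
  proof -
    have v: "v \<in> V" "square_integrable \<Omega> v" "v \<in> H1_vec \<Omega>"
      using that V0_subset_V V0_square_integrable V0_subset by auto
    from null[OF v(1)] obtain c where c0: "l2_inner \<Omega> (\<lambda>x. v x - (\<Sum>b\<in>B. c b *\<^sub>R b x)) (\<lambda>x. v x - (\<Sum>b\<in>B. c b *\<^sub>R b x)) = 0 \<and>
      (\<lambda>x. v x - (\<Sum>b\<in>B. c b *\<^sub>R b x)) \<in> H1_vec \<Omega>" ..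
    note c = conjunct1[OF c0] conjunct2[OF c0]
    show ?thesis
      unfolding L2.null_span_def grad.null_span_def
      using v c(1) grad_ip_null[OF domain c(2,1)] by (intro IntI CollectI conjI exI[of _ c]) simp_all
  qed
  then have "V0 \<subseteq> L2.null_span \<Omega> B" "V0 \<subseteq> grad.null_span B" by blast+
  then show "\<exists>E. L2.orthonormal_basis \<Omega> V0 E" "\<exists>E. grad.orthonormal_basis V0 E"
    using L2.orthonormal_basis_exists[OF B(1) BL V0_subsp_L2]
      grad.orthonormal_basis_exists[OF B(1) BH V0_subsp_grad] by blast+
qed

definition l2_basis :: "(real^'n \<Rightarrow> real^'n) set" where
  "l2_basis = (SOME E. L2.orthonormal_basis \<Omega> V0 E)"

definition grad_basis :: "(real^'n \<Rightarrow> real^'n) set" where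
  "grad_basis = (SOME E. grad.orthonormal_basis V0 E)"

lemma l2_basis: "L2.orthonormal_basis \<Omega> V0 l2_basis"
  unfolding l2_basis_def by (rule someI_ex[OF bases_exist(1)])

lemma grad_basis: "grad.orthonormal_basis V0 grad_basis"
  unfolding grad_basis_def by (rule someI_ex[OF bases_exist(2)])

lemma l2_basis_V0: "e \<in> l2_basis \<Longrightarrow> e \<in> V0"
  using l2_basis by (auto simp: L2.orthonormal_basis_def)

lemma grad_basis_V0: "c \<in> grad_basis \<Longrightarrow> c \<in> V0"
  using grad_basis by (auto simp: grad.orthonormal_basis_def)

lemma l2_inner_l2_basis:
  assumes "z \<in> V0" "square_integrable \<Omega> w"
  shows "l2_inner \<Omega> z w = (\<Sum>e\<in>l2_basis. l2_inner \<Omega> z e * l2_inner \<Omega> e w)"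
  using assms V0_square_integrable by (intro L2.orthonormal_basis_ip[OF l2_basis]) auto

lemma grad_ip_grad_basis:
  assumes "z \<in> V0"
  shows "grad_ip \<Omega> z z = (\<Sum>c\<in>grad_basis. (grad_ip \<Omega> z c)\<^sup>2)"
proof -
  have "grad_ip \<Omega> z z = (\<Sum>c\<in>grad_basis. grad_ip \<Omega> z c * grad_ip \<Omega> c z)"
    using assms V0_subset by (intro grad.orthonormal_basis_ip[OF grad_basis]) auto
  also have "\<dots> = (\<Sum>c\<in>grad_basis. (grad_ip \<Omega> z c)\<^sup>2)"
    using assms V0_subset grad_basis_V0
    by (intro sum.cong) (auto simp: power2_eq_square subset_iff grad.ip_commute[of _ z])
  finally show ?thesis .
qed

text \<open>The remainder of the L2 expansion is null for the Dirichlet form too. Gradients are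
  thereby expressed through the L2 coefficients, whose dependence on time is accessible.\<close>

lemma grad_ip_l2_basis:
  assumes z: "z \<in> V0" and c: "c \<in> H1_vec \<Omega>"
  shows "grad_ip \<Omega> z c = (\<Sum>e\<in>l2_basis. l2_inner \<Omega> z e * grad_ip \<Omega> e c)"
proof -
  let ?s = "\<lambda>x. \<Sum>e\<in>l2_basis. l2_inner \<Omega> z e *\<^sub>R e x"
  have zH: "z \<in> H1_vec \<Omega>" using z V0_subset by blast
  have sH: "?s \<in> H1_vec \<Omega>" using l2_basis_V0 V0_subset by (intro grad.sum_mem) auto
  have dH: "(\<lambda>x. z x - ?s x) \<in> H1_vec \<Omega>" by (rule grad.diff_mem[OF zH sH])
  have "l2_inner \<Omega> (\<lambda>x. z x - ?s x) (\<lambda>x. z x - ?s x) = 0"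
    using l2_basis z by (auto simp: L2.orthonormal_basis_def)
  then have "grad_ip \<Omega> (\<lambda>x. z x - ?s x) (\<lambda>x. z x - ?s x) = 0" by (rule grad_ip_null[OF domain dH])
  then have "grad_ip \<Omega> (\<lambda>x. z x - ?s x) c = 0" by (rule grad.ip_null_left[OF dH c])
  then have "grad_ip \<Omega> z c = grad_ip \<Omega> ?s c" using grad.ip_diff_left[OF zH sH c] by simp
  also have "\<dots> = (\<Sum>e\<in>l2_basis. l2_inner \<Omega> z e * grad_ip \<Omega> e c)"
    using l2_basis_V0 V0_subset c by (intro grad.ip_sum_left) auto
  finally show ?thesis .
qed

text \<open>Riesz representation of \<open>l2_inner \<Omega> w\<close> shows that the description in
  the definition is satisfiable, so the chosen field satisfies it.\<close>

lemma helmholtz_proj: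
  assumes w: "square_integrable \<Omega> w"
  shows "helmholtz_proj \<Omega> V Q w \<in> V0"
    and "v \<in> V0 \<Longrightarrow> l2_inner \<Omega> (helmholtz_proj \<Omega> V Q w) v = l2_inner \<Omega> w v"
proof -
  have "\<exists>z\<in>V0. \<forall>v\<in>V0. l2_inner \<Omega> z v = l2_inner \<Omega> w v"
  proof (rule L2.representer_exists[OF l2_basis V0_subsp_L2, of "l2_inner \<Omega> w"])
    fix u v c assume u: "u \<in> V0" and v: "v \<in> V0"
    show "l2_inner \<Omega> w (\<lambda>x. u x + v x) = l2_inner \<Omega> w u + l2_inner \<Omega> w v"
      using w u v V0_square_integrable by (simp add: L2.ip_add_right)
    show "l2_inner \<Omega> w (\<lambda>x. c *\<^sub>R u x) = c * l2_inner \<Omega> w u"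
      using w u V0_square_integrable by (simp add: L2.ip_scale_right)
    show "l2_inner \<Omega> w u = 0" if "l2_inner \<Omega> u u = 0"
      using that w u V0_square_integrable by (simp add: L2.ip_null_right)
  qed
  from someI_ex[OF this[unfolded Bex_def], folded helmholtz_proj_def]
  show "helmholtz_proj \<Omega> V Q w \<in> V0"
    and "v \<in> V0 \<Longrightarrow> l2_inner \<Omega> (helmholtz_proj \<Omega> V Q w) v = l2_inner \<Omega> w v" by auto
qed

lemma stokes_proj:
  assumes w: "w \<in> H1_vec \<Omega>"
  shows "stokes_proj \<Omega> V Q w \<in> V0"
    and "v \<in> V0 \<Longrightarrow> grad_ip \<Omega> (stokes_proj \<Omega> V Q w) v = grad_ip \<Omega> w v"
proof -
  have "\<exists>z\<in>V0. \<forall>v\<in>V0. grad_ip \<Omega> z v = grad_ip \<Omega> w v"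
  proof (rule grad.representer_exists[OF grad_basis V0_subsp_grad, of "grad_ip \<Omega> w"])
    fix u v c assume "u \<in> V0" and "v \<in> V0"
    then have u: "u \<in> H1_vec \<Omega>" and v: "v \<in> H1_vec \<Omega>" using V0_subset by auto
    show "grad_ip \<Omega> w (\<lambda>x. u x + v x) = grad_ip \<Omega> w u + grad_ip \<Omega> w v"
      by (rule grad.ip_add_right[OF u v w])
    show "grad_ip \<Omega> w (\<lambda>x. c *\<^sub>R u x) = c * grad_ip \<Omega> w u"
      by (rule grad.ip_scale_right[OF u w])
    show "grad_ip \<Omega> w u = 0" if "grad_ip \<Omega> u u = 0"
      by (rule grad.ip_null_right[OF u w that])
  qed
  from someI_ex[OF this[unfolded Bex_def], folded stokes_proj_def[unfolded grad_ip_def[symmetric]]]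
  show "stokes_proj \<Omega> V Q w \<in> V0"
    and "v \<in> V0 \<Longrightarrow> grad_ip \<Omega> (stokes_proj \<Omega> V Q w) v = grad_ip \<Omega> w v" by auto
qed

text \<open>Up to its mean, \<open>q\<close> belongs to \<open>Q\<close>, and constants are orthogonal to divergences of \<open>H1_0\<close> fields.\<close>

lemma lagrange_space_weak_div:
  assumes q: "q \<in> lagrange_space \<T> k" and v: "v \<in> V0"
  shows "l2_inner \<Omega> q (weak_div \<Omega> v) = 0"
proof -
  let ?M = "lebesgue_on \<Omega>"
  have lm: "\<Omega> \<in> lmeasurable" by (rule lmeasurable_open[OF bounded_domain open_domain])
  interpret finite_measure ?M by (rule finite_measure_lebesgue_on[OF lm])
  have vH: "v \<in> H1_vec \<Omega>" using v V0_subset by blast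
  have v0: "v \<in> H1_0_vec \<Omega>" using v V0_subset_V V_subset_H1_0_vec by blast
  have div: "square_integrable \<Omega> (weak_div \<Omega> v)" by (rule weak_div_square_integrable[OF domain vH])
  have const: "square_integrable \<Omega> (\<lambda>x. c)" for c :: real
    by (rule square_integrable_bounded[OF lm, of _ "\<bar>c\<bar>"]) auto
  have mpos: "measure ?M \<Omega> > 0"
  proof -
    have "\<not> negligible \<Omega>" using open_not_negligible[OF open_domain nonempty_domain] .
    then have "measure lebesgue \<Omega> \<noteq> 0" using lm by (simp add: negligible_iff_measure)
    then show ?thesis using lm by (simp add: measure_restrict_space zero_less_measure_iff fmeasurable_def)
  qed
  define m where "m = (LINT x|?M. q x) / measure ?M \<Omega>"
  have qs: "square_integrable \<Omega> q"
    using mesh.lagrange_space_H1[OF q open_domain bounded_domain convex_domain triangulation(2)] by (simp add: H1_def)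
  have L: "(\<lambda>x. q x + - m) \<in> lagrange_space \<T> k"
    by (intro mesh.lagrange_space_add q mesh.lagrange_space_const)
  have qi: "integrable ?M q" by (rule integrable_of_square_integrable[OF lm qs])
  have "(LINT x|?M. q x + - m) = 0"
    using qi mpos by (simp add: m_def)
  then obtain r where r: "r \<in> Q" "ae_eq \<Omega> r (\<lambda>x. q x + - m)"
    using lagrange L unfolding contains_lagrange_space_def by blast
  have rs: "square_integrable \<Omega> r" by (rule Q_square_integrable[OF r(1)])
  have qm: "square_integrable \<Omega> (\<lambda>x. q x + - m)" by (rule square_integrable_add[OF qs const])
  have "l2_inner \<Omega> (\<lambda>x. q x + - m) (weak_div \<Omega> v) = l2_inner \<Omega> r (weak_div \<Omega> v)"
    using r rs qm div by (intro l2_inner_cong_AE ae_eq_refl ae_eq_sym[OF r(2)])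
  also have "\<dots> = 0" using v r(1) rs div by (simp add: discretely_div_free_def L2.ip_commute[of r])
  also have "l2_inner \<Omega> (\<lambda>x. q x + - m) (weak_div \<Omega> v) = l2_inner \<Omega> q (weak_div \<Omega> v) + l2_inner \<Omega> (\<lambda>x. - m) (weak_div \<Omega> v)"
    using qs const div by (intro L2.ip_add_left) auto
  also have "l2_inner \<Omega> (\<lambda>x. - m) (weak_div \<Omega> v) = - l2_inner \<Omega> (\<lambda>x. 0) v"
    using l2_inner_weak_grad_eq_minus_weak_div[OF domain const, of "- m" "\<lambda>x. 0" v] is_weak_partial_const[OF domain] v0
    by simp
  finally show ?thesis by (simp add: l2_inner_def)
qed

text \<open>Integration by parts, removal of \<open>q\<close> by its orthogonality to the divergence
  of \<open>v\<close>, and integration by parts back. \<open>G\<close> will be the classical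
  pressure gradient, while the right-hand side has the chosen weak one.\<close>

lemma pressure_gradient_test:
  assumes p: "square_integrable \<Omega> p" "\<And>i. is_weak_partial \<Omega> i p (\<lambda>x. G x $ i)"
    and q: "q \<in> lagrange_space \<T> k" and v: "v \<in> V0"
  shows "l2_inner \<Omega> G v = l2_inner \<Omega> (weak_grad \<Omega> (\<lambda>x. p x - q x)) v"
proof -
  have vH: "v \<in> H1_vec \<Omega>" using v V0_subset by blast
  have v0: "v \<in> H1_0_vec \<Omega>" using v V0_subset_V V_subset_H1_0_vec by blast
  have div: "square_integrable \<Omega> (weak_div \<Omega> v)" by (rule weak_div_square_integrable[OF domain vH])
  have qH: "q \<in> H1 \<Omega>"
    by (rule mesh.lagrange_space_H1[OF q open_domain bounded_domain convex_domain triangulation(2)])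
  have pH: "p \<in> H1 \<Omega>" using p by (rule H1_I[OF domain])
  have wH: "(\<lambda>x. p x - q x) \<in> H1 \<Omega>" by (rule H1_diff[OF domain pH qH])
  have "l2_inner \<Omega> (weak_grad \<Omega> (\<lambda>x. p x - q x)) v = - l2_inner \<Omega> (\<lambda>x. p x - q x) (weak_div \<Omega> v)"
    using H1_is_weak_partial[OF domain wH] v0 H1_square_integrable[OF domain wH]
    by (intro l2_inner_weak_grad_eq_minus_weak_div[OF domain]) (simp_all add: weak_grad_def)
  also have "\<dots> = - l2_inner \<Omega> p (weak_div \<Omega> v) + l2_inner \<Omega> q (weak_div \<Omega> v)"
    using p(1) H1_square_integrable[OF domain qH] div by (simp add: L2.ip_diff_left)
  also have "\<dots> = l2_inner \<Omega> G v"
    using lagrange_space_weak_div[OF q v] l2_inner_weak_grad_eq_minus_weak_div[OF domain p v0] by simp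
  finally show ?thesis by simp
qed

end

section \<open>The error estimate\<close>

lemma l2_inner_cong:
  "(\<And>x. x \<in> \<Omega> \<Longrightarrow> f x = f' x) \<Longrightarrow> (\<And>x. x \<in> \<Omega> \<Longrightarrow> g x = g' x) \<Longrightarrow> l2_inner \<Omega> f g = l2_inner \<Omega> f' g'"
  unfolding l2_inner_def by (intro Bochner_Integration.integral_cong) auto

lemma square_integrable_cong:
  assumes "\<And>x. x \<in> \<Omega> \<Longrightarrow> f x = f' x" "square_integrable \<Omega> f'" shows "square_integrable \<Omega> f"
proof -
  have "f \<in> borel_measurable (lebesgue_on \<Omega>)"
    using assms by (subst measurable_cong[of _ f f']) (auto simp: square_integrable_def)
  moreover have "integrable (lebesgue_on \<Omega>) (\<lambda>x. (norm (f x))\<^sup>2)"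
    using assms by (subst Bochner_Integration.integrable_cong[OF refl, of _ _ "\<lambda>x. (norm (f' x))\<^sup>2"]) (auto simp: square_integrable_def)
  ultimately show ?thesis by (simp add: square_integrable_def)
qed

text \<open>Agreement with the extension is asked on \<Omega> only: derivatives of
  \<open>u t\<close> at boundary points depend on arbitrary values outside, so this is the form that
  survives the passage to partial derivatives.\<close>

locale smooth_evolution =
  fixes \<Omega> :: "(real^'n::finite) set" and T :: real
    and u :: "real \<Rightarrow> real^'n \<Rightarrow> 'b::euclidean_space" and U and g
  assumes \<Omega>: "open \<Omega>" "bounded \<Omega>" "convex \<Omega>"
    and smooth: "smooth_on_open U g" and sub: "{0..T} \<times> closure \<Omega> \<subseteq> U"
    and eq: "t \<in> {0..T} \<Longrightarrow> x \<in> \<Omega> \<Longrightarrow> u t x = g (t, x)"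
begin

lemma partial_eq:
  assumes "t \<in> {0..T}" "x \<in> \<Omega>"
  shows "partial i (u t) x = frechet_derivative g (at (t, x)) (0, axis i 1)"
  using assms sub closure_subset[of \<Omega>]
  by (intro smooth_slice_partial[OF smooth \<Omega>(1) _ eq]) auto

text \<open>The derivative of the extension is the new extension, so the class is closed under
  spatial derivatives; applied twice this covers the Laplacian.\<close>

lemma partial_evolution:
  "smooth_evolution \<Omega> T (\<lambda>t. partial i (u t)) U (\<lambda>z. frechet_derivative g (at z) (0, axis i 1))"
  by unfold_locales (use \<Omega> sub in \<open>auto simp: partial_eq intro: smooth_on_open_partial[OF smooth space_axis_Basis]\<close>)

lemma square_integrable:
  assumes t: "t \<in> {0..T}" shows "square_integrable \<Omega> (u t)"
proof (rule square_integrable_cong[OF eq[OF t]])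
  show "square_integrable \<Omega> (\<lambda>x. g (t, x))"
    by (rule continuous_slice_square_integrable[OF \<Omega>(1,2)
          continuous_on_subset[OF smooth_on_open_continuous_on[OF smooth] sub] t])
qed

lemma is_weak_partial:
  assumes t: "t \<in> {0..T}"
  shows "is_weak_partial \<Omega> i (\<lambda>x. u t x \<bullet> c) (\<lambda>x. partial i (u t) x \<bullet> c)"
  by (rule smooth_slice_is_weak_partial[OF \<Omega> smooth _ eq[OF t]]) (use t sub in auto)

lemma continuous_on_l2_inner:
  assumes "square_integrable \<Omega> w"
  shows "continuous_on {0..T} (\<lambda>t. l2_inner \<Omega> (u t) w)"
proof -
  have "continuous_on {0..T} (\<lambda>t. l2_inner \<Omega> (\<lambda>x. g (t, x)) w)"
    by (rule continuous_on_l2_inner_slice[OF \<Omega>(1,2) continuous_on_subset[OF smooth_on_open_continuous_on[OF smooth] sub] assms])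
  then show ?thesis
    by (rule continuous_on_eq) (auto intro: l2_inner_cong simp: eq)
qed

lemma continuous_on_l2_inner_component:
  fixes w :: "real^'n \<Rightarrow> real"
  assumes "square_integrable \<Omega> w"
  shows "continuous_on {0..T} (\<lambda>t. l2_inner \<Omega> (\<lambda>x. u t x \<bullet> c) w)"
proof -
  have "square_integrable \<Omega> (\<lambda>x. w x *\<^sub>R c)"
    using assms unfolding square_integrable_def by (auto simp: power_mult_distrib)
  from continuous_on_l2_inner[OF this] show ?thesis by (simp add: l2_inner_def mult.commute)
qed

text \<open>The squared norm is the pairing of \<open>g \<bullet> g\<close> with the constant
  \<open>1\<close>, which reduces it to the case of a fixed second factor.\<close>

lemma continuous_on_l2_inner_self: "continuous_on {0..T} (\<lambda>t. l2_inner \<Omega> (u t) (u t))"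
proof -
  have "continuous_on ({0..T} \<times> closure \<Omega>) (\<lambda>z. g z \<bullet> g z)"
    using continuous_on_subset[OF smooth_on_open_continuous_on[OF smooth] sub] by (intro continuous_intros)
  moreover have "square_integrable \<Omega> (\<lambda>x. 1::real)"
    using lmeasurable_open[OF \<Omega>(2,1)] by (intro square_integrable_bounded[of _ _ 1]) auto
  ultimately have "continuous_on {0..T} (\<lambda>t. l2_inner \<Omega> (\<lambda>x. g (t, x) \<bullet> g (t, x)) (\<lambda>x. 1::real))"
    by (rule continuous_on_l2_inner_slice[OF \<Omega>(1,2)])
  then show ?thesis
    by (rule continuous_on_eq) (auto simp: l2_inner_def eq intro!: Bochner_Integration.integral_cong)
qed

definition time_deriv :: "real \<Rightarrow> real^'n \<Rightarrow> 'b" where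
  "time_deriv t x = vector_derivative (\<lambda>s. u s x) (at t within {0..T})"

text \<open>\<open>T > 0\<close> makes every time a limit point of the interval, so that the
  derivative within the interval is unique at the ends too.\<close>

lemma time_deriv_eq:
  assumes "T > 0" "t \<in> {0..T}" "x \<in> \<Omega>"
  shows "time_deriv t x = frechet_derivative g (at (t, x)) (1, 0)"
proof -
  have "(t, x) \<in> U" using sub assms closure_subset[of \<Omega>] by auto
  then have "((\<lambda>s. g (s, x)) has_vector_derivative frechet_derivative g (at (t, x)) (1, 0)) (at t within {0..T})"
    by (rule smooth_time_derivative[OF smooth])
  then have "((\<lambda>s. u s x) has_vector_derivative frechet_derivative g (at (t, x)) (1, 0)) (at t within {0..T})"
    by (rule has_vector_derivative_transform[rotated 2]) (use assms eq in auto)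
  then show ?thesis
    unfolding time_deriv_def using assms by (intro vector_derivative_within_cbox[of 0 T, unfolded cbox_interval]) auto
qed

lemma time_deriv_square_integrable:
  assumes "T > 0" "t \<in> {0..T}" shows "square_integrable \<Omega> (time_deriv t)"
proof (rule square_integrable_cong[OF time_deriv_eq[OF assms]])
  show "square_integrable \<Omega> (\<lambda>x. frechet_derivative g (at (t, x)) (1, 0))"
    by (rule continuous_slice_square_integrable[OF \<Omega>(1,2) continuous_on_subset[OF
          smooth_on_open_continuous_on[OF smooth_on_open_partial[OF smooth time_Basis]] sub] assms(2)])
qed

lemma l2_inner_has_derivative:
  assumes T: "T > 0" and t: "t \<in> {0..T}" and w: "square_integrable \<Omega> w"
  shows "((\<lambda>t. l2_inner \<Omega> (u t) w) has_real_derivative l2_inner \<Omega> (time_deriv t) w) (at t within {0..T})"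
proof -
  have "((\<lambda>t. l2_inner \<Omega> (\<lambda>x. g (t, x)) w) has_real_derivative
      l2_inner \<Omega> (\<lambda>x. frechet_derivative g (at (t, x)) (1, 0)) w) (at t within {0..T})"
    by (rule l2_inner_slice_has_derivative[OF \<Omega>(1,2) smooth sub w t])
  also have "l2_inner \<Omega> (\<lambda>x. frechet_derivative g (at (t, x)) (1, 0)) w = l2_inner \<Omega> (time_deriv t) w"
    by (rule l2_inner_cong) (simp_all add: time_deriv_eq[OF T t])
  finally show ?thesis
    by (rule has_field_derivative_transform_within[OF _ zero_less_one t]) (auto intro: l2_inner_cong simp: eq)
qed

end

text \<open>For the pressure, agreement with its extension reaches up to the closure: interpolation
  nodes may lie on the boundary, and the pressure at a node has to be continuous in time.\<close>

locale semidiscrete_stokes =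
  stokes_discretization \<Omega> \<T> k V Q +
  u: smooth_evolution \<Omega> T u U\<^sub>u g\<^sub>u + p: smooth_evolution \<Omega> T p U\<^sub>p g\<^sub>p
  for \<Omega> :: "(real^'n::finite) set" and \<T> k V Q T
    and u :: "real \<Rightarrow> real^'n \<Rightarrow> real^'n" and U\<^sub>u g\<^sub>u and p :: "real \<Rightarrow> real^'n \<Rightarrow> real" and U\<^sub>p g\<^sub>p +
  fixes \<nu> :: real and f :: "real \<Rightarrow> real^'n \<Rightarrow> real^'n" and u\<^sub>0 :: "real^'n \<Rightarrow> real^'n"
    and u\<^sub>h u\<^sub>h' :: "real \<Rightarrow> real^'n \<Rightarrow> real^'n" and p\<^sub>h :: "real \<Rightarrow> real^'n \<Rightarrow> real"
  assumes T_pos: "T > 0" and \<nu>_pos: "\<nu> > 0"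
    and p_closure: "t \<in> {0..T} \<Longrightarrow> x \<in> closure \<Omega> \<Longrightarrow> p t x = g\<^sub>p (t, x)"
    and exact: "smooth_stokes_solution \<Omega> T \<nu> f u\<^sub>0 u p"
    and semidiscrete: "semidiscrete_stokes_solution \<Omega> V Q T \<nu> f u\<^sub>0 u\<^sub>h u\<^sub>h' p\<^sub>h"
begin

abbreviation Ph :: "real \<Rightarrow> real^'n \<Rightarrow> real^'n" where
  "Ph t \<equiv> helmholtz_proj \<Omega> V Q (u t)"

abbreviation Sh :: "real \<Rightarrow> real^'n \<Rightarrow> real^'n" where
  "Sh t \<equiv> stokes_proj \<Omega> V Q (u t)"

definition err :: "real \<Rightarrow> real^'n \<Rightarrow> real^'n" where
  "err t = (\<lambda>x. u\<^sub>h t x - Ph t x)"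

definition proj_diff :: "real \<Rightarrow> real^'n \<Rightarrow> real^'n" where
  "proj_diff t = (\<lambda>x. Sh t x - Ph t x)"

definition interp_err :: "real \<Rightarrow> real^'n \<Rightarrow> real" where
  "interp_err t = (\<lambda>x. p t x - lagrange_interp \<T> k (p t) x)"

abbreviation err_sq :: "real \<Rightarrow> real" where
  "err_sq t \<equiv> l2_inner \<Omega> (err t) (err t)"

abbreviation err_grad_sq :: "real \<Rightarrow> real" where
  "err_grad_sq t \<equiv> grad_ip \<Omega> (err t) (err t)"

abbreviation proj_diff_sq :: "real \<Rightarrow> real" where
  "proj_diff_sq t \<equiv> grad_ip \<Omega> (proj_diff t) (proj_diff t)"

abbreviation interp_err_sq :: "real \<Rightarrow> real" where
  "interp_err_sq t \<equiv> l2_inner \<Omega> (weak_grad \<Omega> (interp_err t)) (weak_grad \<Omega> (interp_err t))"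

lemma u_component_is_weak_partial:
  "t \<in> {0..T} \<Longrightarrow> is_weak_partial \<Omega> i (\<lambda>x. u t x $ j) (\<lambda>x. partial i (u t) x $ j)"
  using u.is_weak_partial[of t i "axis j 1"] by (simp add: inner_axis)

lemma u_H1_vec:
  assumes t: "t \<in> {0..T}" shows "u t \<in> H1_vec \<Omega>"
  unfolding H1_vec_def
  using H1_I[OF domain square_integrable_component[OF u.square_integrable[OF t]] u_component_is_weak_partial[OF t]]
  by simp

text \<open>The chosen weak derivatives of \<open>u t\<close> are exchanged for the classical ones,
  whose pairings are continuous in time.\<close>

lemma grad_ip_u:
  assumes t: "t \<in> {0..T}" and c: "c \<in> H1_vec \<Omega>"
  shows "grad_ip \<Omega> (u t) c = (\<Sum>j\<in>UNIV. \<Sum>i\<in>UNIV.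
    l2_inner \<Omega> (\<lambda>x. partial i (u t) x $ j) (weak_partial \<Omega> i (\<lambda>x. c x $ j)))"
proof -
  have "l2_inner \<Omega> (weak_partial \<Omega> i (\<lambda>x. u t x $ j)) (weak_partial \<Omega> i (\<lambda>x. c x $ j)) =
      l2_inner \<Omega> (\<lambda>x. partial i (u t) x $ j) (weak_partial \<Omega> i (\<lambda>x. c x $ j))" for i j
  proof -
    note wp = u_component_is_weak_partial[OF t, of i j]
    have "(\<lambda>x. u t x $ j) \<in> H1 \<Omega>" "(\<lambda>x. c x $ j) \<in> H1 \<Omega>" using u_H1_vec[OF t] c by (auto simp: H1_vec_def)
    then show ?thesis
      using weak_partial_ae_eq[OF domain wp] wp H1_weak_partial_square_integrable[OF domain]
      by (intro l2_inner_cong_AE ae_eq_refl) (auto simp: is_weak_partial_def)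
  qed
  then show ?thesis by (simp add: grad_ip_sum[OF domain u_H1_vec[OF t] c])
qed

text \<open>Each pure second derivative is the weak derivative of a smooth first derivative; there
  is no boundary term because the components of \<open>v\<close> belong to
  \<open>H1_0\<close>.\<close>

lemma laplacian_test:
  assumes t: "t \<in> {0..T}" and v: "v \<in> H1_0_vec \<Omega>"
  shows "square_integrable \<Omega> (laplacian (u t))" "l2_inner \<Omega> (laplacian (u t)) v = - grad_ip \<Omega> (u t) v"
proof -
  have vH: "v \<in> H1_vec \<Omega>" using v by (auto simp: H1_0_vec_def H1_vec_def H1_0_def)
  have vs: "square_integrable \<Omega> (\<lambda>x. v x $ j)" for j
    using square_integrable_component[OF H1_vec_square_integrable[OF domain vH]] .
  have si: "square_integrable \<Omega> (partial i (u t))" "square_integrable \<Omega> (partial i (partial i (u t)))" for i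
    using smooth_evolution.square_integrable[OF u.partial_evolution t]
      smooth_evolution.square_integrable[OF smooth_evolution.partial_evolution[OF u.partial_evolution] t] by auto
  show lap: "square_integrable \<Omega> (laplacian (u t))"
    unfolding laplacian_def[abs_def] by (intro square_integrable_sum si)
  have wp: "is_weak_partial \<Omega> i (\<lambda>x. partial i (u t) x $ j) (\<lambda>x. partial i (partial i (u t)) x $ j)" for i j
    using smooth_evolution.is_weak_partial[OF u.partial_evolution t, of i i "axis j 1"] by (simp add: inner_axis)
  have "l2_inner \<Omega> (laplacian (u t)) v = (\<Sum>j\<in>UNIV. l2_inner \<Omega> (\<lambda>x. \<Sum>i\<in>UNIV. 1 *\<^sub>R partial i (partial i (u t)) x $ j) (\<lambda>x. v x $ j))"
    using l2_inner_vec[OF lap H1_vec_square_integrable[OF domain vH]] by (simp add: laplacian_def)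
  also have "\<dots> = (\<Sum>j\<in>UNIV. \<Sum>i\<in>UNIV. 1 * l2_inner \<Omega> (\<lambda>x. partial i (partial i (u t)) x $ j) (\<lambda>x. v x $ j))"
    using si vs by (intro sum.cong refl L2.ip_sum_left) (auto intro: square_integrable_component)
  also have "\<dots> = (\<Sum>j\<in>UNIV. \<Sum>i\<in>UNIV. - l2_inner \<Omega> (\<lambda>x. partial i (u t) x $ j) (weak_partial \<Omega> i (\<lambda>x. v x $ j)))"
    using H1_0_integration_by_parts[OF domain _ square_integrable_component[OF si(1)] wp] v
    by (simp add: H1_0_vec_def)
  also have "\<dots> = - grad_ip \<Omega> (u t) v" using grad_ip_u[OF t vH] by (simp add: sum_negf)
  finally show "l2_inner \<Omega> (laplacian (u t)) v = - grad_ip \<Omega> (u t) v" .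
qed

lemma pressure_square_integrable:
  assumes t: "t \<in> {0..T}" shows "square_integrable \<Omega> (p t)" "square_integrable \<Omega> (gradient (p t))"
proof -
  show "square_integrable \<Omega> (p t)" by (rule p.square_integrable[OF t])
  show "square_integrable \<Omega> (gradient (p t))"
    using smooth_evolution.square_integrable[OF p.partial_evolution t]
    by (intro square_integrable_vec) (simp add: gradient_def)
qed

lemma pressure_is_weak_partial: "t \<in> {0..T} \<Longrightarrow> is_weak_partial \<Omega> i (p t) (partial i (p t))"
  using p.is_weak_partial[of t i 1] by simp

lemma interp_mem: "lagrange_interp \<T> k q \<in> lagrange_space \<T> k"
  by (rule mesh.lagrange_interp_mem)

lemma interp_err_H1: "t \<in> {0..T} \<Longrightarrow> interp_err t \<in> H1 \<Omega>"
  unfolding interp_err_def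
  by (intro H1_diff[OF domain] H1_I[OF domain pressure_square_integrable(1) pressure_is_weak_partial]
      mesh.lagrange_space_H1[OF interp_mem open_domain bounded_domain convex_domain triangulation(2)])

section \<open>The tested equations\<close>

lemma weak_form:
  assumes "t \<in> {0<..T}" "v \<in> V" "q \<in> Q"
  shows "l2_inner \<Omega> (u\<^sub>h' t) v + \<nu> * grad_ip \<Omega> (u\<^sub>h t) v
          - l2_inner \<Omega> (p\<^sub>h t) (weak_div \<Omega> v) + l2_inner \<Omega> (weak_div \<Omega> (u\<^sub>h t)) q
        = l2_inner \<Omega> (f t) v"
  using semidiscrete assms unfolding semidiscrete_stokes_solution_def grad_ip_def by blast

lemma u\<^sub>h_V: "t \<in> {0..T} \<Longrightarrow> u\<^sub>h t \<in> V"
  using semidiscrete by (simp add: semidiscrete_stokes_solution_def)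

lemma u\<^sub>h'_V: "t \<in> {0<..T} \<Longrightarrow> u\<^sub>h' t \<in> V"
  using semidiscrete by (simp add: semidiscrete_stokes_solution_def)

lemma p\<^sub>h_Q: "t \<in> {0<..T} \<Longrightarrow> p\<^sub>h t \<in> Q"
  using semidiscrete by (simp add: semidiscrete_stokes_solution_def)

text \<open>Testing with \<open>v = 0\<close> leaves the constraint alone. It is available for
  positive times only, where the discrete equation is posed.\<close>

lemma u\<^sub>h_V0:
  assumes t: "t \<in> {0<..T}" shows "u\<^sub>h t \<in> V0"
proof -
  have uV: "u\<^sub>h t \<in> V" using u\<^sub>h_V t by simp
  have "l2_inner \<Omega> (weak_div \<Omega> (u\<^sub>h t)) q = 0" if q: "q \<in> Q" for q
  proof -
    have "grad_ip \<Omega> (u\<^sub>h t) (\<lambda>x. 0) = 0"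
      using grad.ip_null_right[of "\<lambda>x. 0" "u\<^sub>h t"] grad.ip_zero_left[OF grad.zero_mem] grad.zero_mem uV V_subset by auto
    moreover have "l2_inner \<Omega> (p\<^sub>h t) (weak_div \<Omega> (\<lambda>x. 0)) = 0"
      using V0_closed(1) p\<^sub>h_Q[OF t] Q_square_integrable weak_div_square_integrable[OF domain grad.zero_mem]
      by (simp add: discretely_div_free_def L2.ip_commute[of "p\<^sub>h t"])
    ultimately show ?thesis using weak_form[OF t V_closed(1) q] by (simp add: l2_inner_def)
  qed
  with uV show ?thesis by (simp add: discretely_div_free_def)
qed

text \<open>The exact equation is used as a formula for \<open>f\<close>. \<open>Sh t\<close> stands
  for \<open>u t\<close> by the definition of the Stokes projection; the time derivative of
  \<open>u\<close> stays unprojected, since only its pairings with fields of \<open>V0\<close>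
  occur.\<close>

lemma error_equation:
  assumes t: "t \<in> {0<..T}" and v: "v \<in> V0"
  shows "l2_inner \<Omega> (u\<^sub>h' t) v - l2_inner \<Omega> (u.time_deriv t) v =
    \<nu> * grad_ip \<Omega> (Sh t) v - \<nu> * grad_ip \<Omega> (u\<^sub>h t) v + l2_inner \<Omega> (weak_grad \<Omega> (interp_err t)) v"
proof -
  have t': "t \<in> {0..T}" using t by simp
  have vV: "v \<in> V" and v0: "v \<in> H1_0_vec \<Omega>" and vs: "square_integrable \<Omega> v" and vH: "v \<in> H1_vec \<Omega>"
    using v V0_subset_V V_subset_H1_0_vec V0_square_integrable V0_subset by auto
  have "(\<lambda>x. 0) \<in> Q" using conforming by (simp add: conforming_pair_def finite_dim_function_space_def)
  from weak_form[OF t vV this]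
  have "l2_inner \<Omega> (u\<^sub>h' t) v + \<nu> * grad_ip \<Omega> (u\<^sub>h t) v - l2_inner \<Omega> (p\<^sub>h t) (weak_div \<Omega> v) = l2_inner \<Omega> (f t) v"
    by (simp add: l2_inner_def)
  moreover have "l2_inner \<Omega> (p\<^sub>h t) (weak_div \<Omega> v) = 0"
    using v p\<^sub>h_Q[OF t] Q_square_integrable weak_div_square_integrable[OF domain vH]
    by (simp add: discretely_div_free_def L2.ip_commute[of "p\<^sub>h t"])
  moreover have "l2_inner \<Omega> (f t) v = l2_inner \<Omega> (u.time_deriv t) v + \<nu> * grad_ip \<Omega> (Sh t) v
      + l2_inner \<Omega> (weak_grad \<Omega> (interp_err t)) v"
  proof -
    have "l2_inner \<Omega> (f t) v = l2_inner \<Omega> (\<lambda>x. (u.time_deriv t x - \<nu> *\<^sub>R laplacian (u t) x) + gradient (p t) x) v"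
      using exact t unfolding smooth_stokes_solution_def u.time_deriv_def by (intro l2_inner_cong) auto
    also have "\<dots> = l2_inner \<Omega> (u.time_deriv t) v - \<nu> * l2_inner \<Omega> (laplacian (u t)) v + l2_inner \<Omega> (gradient (p t)) v"
      using u.time_deriv_square_integrable[OF T_pos t'] laplacian_test(1)[OF t' v0] pressure_square_integrable(2)[OF t'] vs
      by (simp add: L2.ip_add_left L2.ip_diff_left L2.ip_scale_left square_integrable_diff square_integrable_scaleR)
    also have "l2_inner \<Omega> (laplacian (u t)) v = - grad_ip \<Omega> (Sh t) v"
      using laplacian_test(2)[OF t' v0] stokes_proj(2)[OF u_H1_vec[OF t'] v] by simp
    also have "l2_inner \<Omega> (gradient (p t)) v = l2_inner \<Omega> (weak_grad \<Omega> (interp_err t)) v"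
      unfolding interp_err_def
      by (intro pressure_gradient_test interp_mem v pressure_square_integrable(1) t')
        (use pressure_is_weak_partial[OF t'] in \<open>simp add: gradient_def\<close>)
    finally show ?thesis by simp
  qed
  ultimately show ?thesis by simp
qed

lemma Ph: "t \<in> {0..T} \<Longrightarrow> Ph t \<in> V0"
  by (rule helmholtz_proj(1)[OF u.square_integrable])

lemma Sh: "t \<in> {0..T} \<Longrightarrow> Sh t \<in> V0"
  by (rule stokes_proj(1)[OF u_H1_vec])

lemma err_V0: "t \<in> {0<..T} \<Longrightarrow> err t \<in> V0"
  unfolding err_def by (intro V0_diff u\<^sub>h_V0 Ph) auto

text \<open>At \<open>t = 0\<close> membership in \<open>V0\<close> is not delivered by the discrete
  equation; membership in \<open>V\<close> is enough there because the error is null.\<close>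

lemma err_V: "t \<in> {0..T} \<Longrightarrow> err t \<in> V"
  unfolding err_def using Ph V0_subset_V by (intro V_diff u\<^sub>h_V) auto

text \<open>\<open>u\<^sub>0\<close> and \<open>u 0\<close> have the same pairings on \<Omega>, so
  both projections are choices from the same predicate and hence equal as functions. The discrete
  initial value agrees with them almost everywhere.\<close>

lemma err_0: "ae_eq \<Omega> (err 0) (\<lambda>x. 0)" "err_sq 0 = 0"
proof -
  have "l2_inner \<Omega> u\<^sub>0 v = l2_inner \<Omega> (u 0) v" for v
    using exact closure_subset[of \<Omega>] by (intro l2_inner_cong) (auto simp: smooth_stokes_solution_def)
  then have "helmholtz_proj \<Omega> V Q u\<^sub>0 = Ph 0" by (simp add: helmholtz_proj_def)
  then have "ae_eq \<Omega> (u\<^sub>h 0) (Ph 0)" using semidiscrete by (simp add: semidiscrete_stokes_solution_def)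
  then show z: "ae_eq \<Omega> (err 0) (\<lambda>x. 0)" by (auto simp: err_def ae_eq_def)
  have s: "square_integrable \<Omega> (err 0)" using err_V[of 0] T_pos V_square_integrable by simp
  have "err_sq 0 = l2_inner \<Omega> (\<lambda>x. 0) (\<lambda>x. 0 :: real^'n)"
    by (rule l2_inner_cong_AE[OF z z s square_integrable_zero s square_integrable_zero])
  then show "err_sq 0 = 0" by (simp add: l2_inner_def)
qed

text \<open>For \<open>e\<close> in \<open>V0\<close> this is the L2 coefficient of the error,
  written without the projection: the latter is chosen anew at each time, while \<open>u\<close> and
  \<open>u\<^sub>h\<close> come with regularity in time.\<close>

definition coef :: "(real^'n \<Rightarrow> real^'n) \<Rightarrow> real \<Rightarrow> real" where
  "coef e t = l2_inner \<Omega> (u\<^sub>h t) e - l2_inner \<Omega> (u t) e"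

lemma err_coef:
  assumes t: "t \<in> {0..T}" and e: "e \<in> V0" shows "l2_inner \<Omega> (err t) e = coef e t"
  unfolding err_def coef_def
  using V_square_integrable[OF u\<^sub>h_V[OF t]] V0_square_integrable[OF Ph[OF t]] V0_square_integrable[OF e]
    helmholtz_proj(2)[OF u.square_integrable[OF t] e]
  by (simp add: L2.ip_diff_left)

lemma coef_continuous: "e \<in> V0 \<Longrightarrow> continuous_on {0..T} (coef e)"
  unfolding coef_def[abs_def]
  using semidiscrete V_square_integrable u\<^sub>h_V V0_square_integrable
  by (intro continuous_on_diff u.continuous_on_l2_inner l2_continuous_on_l2_inner)
    (auto simp: semidiscrete_stokes_solution_def)

lemma coef_has_derivative:
  assumes t: "t \<in> {0<..<T}" and e: "e \<in> V0"
  shows "(coef e has_real_derivative l2_inner \<Omega> (u\<^sub>h' t) e - l2_inner \<Omega> (u.time_deriv t) e) (at t)"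
proof -
  have "(coef e has_real_derivative l2_inner \<Omega> (u\<^sub>h' t) e - l2_inner \<Omega> (u.time_deriv t) e) (at t within {0..T})"
    unfolding coef_def[abs_def]
    using semidiscrete t V_square_integrable u\<^sub>h_V u\<^sub>h'_V V0_square_integrable[OF e] T_pos
    by (intro DERIV_diff u.l2_inner_has_derivative l2_has_time_derivative_l2_inner)
      (auto simp: semidiscrete_stokes_solution_def)
  then show ?thesis using t by (simp add: at_within_Icc_at)
qed

text \<open>Parseval for positive times. At \<open>t = 0\<close>, where the error is placed in
  \<open>V\<close> only, all coefficients vanish together with its norm.\<close>

lemma err_l2:
  assumes t: "t \<in> {0..T}"
  shows "err_sq t = (\<Sum>e\<in>l2_basis. (coef e t)\<^sup>2)"
proof (cases "t = 0")
  case True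
  have "coef e 0 = 0" if "e \<in> l2_basis" for e
    using err_coef[of 0 e] l2_basis_V0[OF that] L2.ip_null_left[of "err 0" \<Omega> e] err_0(2) err_V[of 0] T_pos
      V_square_integrable V0_square_integrable by simp
  then show ?thesis using True err_0(2) by simp
next
  case False
  then have V: "err t \<in> V0" using t by (intro err_V0) simp
  have "err_sq t = (\<Sum>e\<in>l2_basis. l2_inner \<Omega> (err t) e * l2_inner \<Omega> e (err t))"
    by (rule l2_inner_l2_basis[OF V V0_square_integrable[OF V]])
  also have "\<dots> = (\<Sum>e\<in>l2_basis. (coef e t)\<^sup>2)"
    using err_coef[OF t] l2_basis_V0 V V0_square_integrable
    by (intro sum.cong) (auto simp: power2_eq_square L2.ip_commute[of _ \<Omega> "err t"])
  finally show ?thesis .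
qed

text \<open>Two bases are combined: Parseval in the gradient basis outside, and inside the L2
  coefficients, which carry the time dependence.\<close>

lemma err_grad:
  assumes t: "t \<in> {0..T}"
  shows "err_grad_sq t = (\<Sum>c\<in>grad_basis. (\<Sum>e\<in>l2_basis. coef e t * grad_ip \<Omega> e c)\<^sup>2)"
proof (cases "t = 0")
  case True
  have "coef e 0 = 0" if "e \<in> l2_basis" for e
    using err_coef[of 0 e] l2_basis_V0[OF that] L2.ip_null_left[of "err 0" \<Omega> e] err_0(2) err_V[of 0] T_pos
      V_square_integrable V0_square_integrable by simp
  moreover have "err 0 \<in> H1_vec \<Omega>" using err_V[of 0] T_pos V_subset by auto
  ultimately show ?thesis using True grad_ip_null[OF domain _ err_0(2)] by simp
next
  case False
  then have V: "err t \<in> V0" using t by (intro err_V0) simp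
  have "grad_ip \<Omega> (err t) c = (\<Sum>e\<in>l2_basis. coef e t * grad_ip \<Omega> e c)" if "c \<in> grad_basis" for c
    using grad_ip_l2_basis[OF V] err_coef[OF t] l2_basis_V0 grad_basis_V0[OF that] V0_subset by auto
  then show ?thesis using grad_ip_grad_basis[OF V] by simp
qed

lemma proj_diff_V0: "t \<in> {0..T} \<Longrightarrow> proj_diff t \<in> V0"
  unfolding proj_diff_def by (intro V0_diff Sh Ph)

text \<open>Both projections disappear: tested with a gradient basis field the Stokes projection
  gives back \<open>u\<close>, and the L2 coefficients of the Helmholtz projection are those of
  \<open>u\<close>.\<close>

lemma proj_diff_grad:
  assumes t: "t \<in> {0..T}"
  shows "proj_diff_sq t =
    (\<Sum>c\<in>grad_basis. (grad_ip \<Omega> (u t) c - (\<Sum>e\<in>l2_basis. l2_inner \<Omega> (u t) e * grad_ip \<Omega> e c))\<^sup>2)"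
proof -
  have "grad_ip \<Omega> (proj_diff t) c = grad_ip \<Omega> (u t) c - (\<Sum>e\<in>l2_basis. l2_inner \<Omega> (u t) e * grad_ip \<Omega> e c)"
    if c: "c \<in> grad_basis" for c
  proof -
    have cH: "c \<in> H1_vec \<Omega>" using grad_basis_V0[OF c] V0_subset by blast
    have "grad_ip \<Omega> (proj_diff t) c = grad_ip \<Omega> (Sh t) c - grad_ip \<Omega> (Ph t) c"
      unfolding proj_diff_def using Sh[OF t] Ph[OF t] V0_subset cH by (intro grad.ip_diff_left) auto
    also have "grad_ip \<Omega> (Sh t) c = grad_ip \<Omega> (u t) c"
      by (rule stokes_proj(2)[OF u_H1_vec[OF t] grad_basis_V0[OF c]])
    also have "grad_ip \<Omega> (Ph t) c = (\<Sum>e\<in>l2_basis. l2_inner \<Omega> (u t) e * grad_ip \<Omega> e c)"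
      using grad_ip_l2_basis[OF Ph[OF t] cH] helmholtz_proj(2)[OF u.square_integrable[OF t]] l2_basis_V0 by simp
    finally show ?thesis .
  qed
  then show ?thesis using grad_ip_grad_basis[OF proj_diff_V0[OF t]] by simp
qed

section \<open>Continuity in time of the integrands\<close>

lemma continuous_err_l2: "continuous_on {0..T} err_sq"
proof (rule continuous_on_eq)
  show "continuous_on {0..T} (\<lambda>t. \<Sum>e\<in>l2_basis. (coef e t)\<^sup>2)"
    using coef_continuous l2_basis_V0 by (intro continuous_intros) auto
qed (simp add: err_l2)

lemma continuous_err_grad: "continuous_on {0..T} err_grad_sq"
proof (rule continuous_on_eq)
  show "continuous_on {0..T} (\<lambda>t. \<Sum>c\<in>grad_basis. (\<Sum>e\<in>l2_basis. coef e t * grad_ip \<Omega> e c)\<^sup>2)"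
    using coef_continuous l2_basis_V0 by (intro continuous_intros) auto
qed (simp add: err_grad)

lemma continuous_grad_ip_u:
  assumes c: "c \<in> H1_vec \<Omega>" shows "continuous_on {0..T} (\<lambda>t. grad_ip \<Omega> (u t) c)"
proof (rule continuous_on_eq)
  have "continuous_on {0..T} (\<lambda>t. l2_inner \<Omega> (\<lambda>x. partial i (u t) x $ j) (weak_partial \<Omega> i (\<lambda>x. c x $ j)))" for i j
    using smooth_evolution.continuous_on_l2_inner_component[OF u.partial_evolution[of i], of "weak_partial \<Omega> i (\<lambda>x. c x $ j)" "axis j 1"]
      H1_weak_partial_square_integrable[OF domain] c by (simp add: inner_axis H1_vec_def)
  then show "continuous_on {0..T} (\<lambda>t. \<Sum>j\<in>UNIV. \<Sum>i\<in>UNIV.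
      l2_inner \<Omega> (\<lambda>x. partial i (u t) x $ j) (weak_partial \<Omega> i (\<lambda>x. c x $ j)))"
    by (intro continuous_on_sum)
qed (simp add: grad_ip_u[OF _ c])

lemma continuous_proj_diff: "continuous_on {0..T} proj_diff_sq"
proof (rule continuous_on_eq)
  show "continuous_on {0..T} (\<lambda>t. \<Sum>c\<in>grad_basis. (grad_ip \<Omega> (u t) c -
      (\<Sum>e\<in>l2_basis. l2_inner \<Omega> (u t) e * grad_ip \<Omega> e c))\<^sup>2)"
    using l2_basis_V0 grad_basis_V0 V0_square_integrable V0_subset
    by (intro continuous_intros continuous_grad_ip_u u.continuous_on_l2_inner) auto
qed (simp add: proj_diff_grad)

text \<open>The weak gradient of the interpolation error is a fresh choice at each time. It is
  replaced by the classical gradient of \<open>p\<close> minus a combination of fixed weak gradients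
  of nodal functions; expanding the square leaves nodal values and inner products that are
  continuous in \<open>t\<close>.\<close>

lemma continuous_interp_err:
  "continuous_on {0..T} interp_err_sq"
proof -
  let ?A = "lagrange_nodes \<T> k" and ?W = "\<lambda>i a. weak_partial \<Omega> i (nodal_basis \<T> k a)"
  have bH: "nodal_basis \<T> k a \<in> H1 \<Omega>" if "a \<in> ?A" for a
    by (rule mesh.lagrange_space_H1[OF mesh.nodal_basis_mem[OF that] open_domain bounded_domain convex_domain triangulation(2)])
  have Ws: "square_integrable \<Omega> (?W i a)" if "a \<in> ?A" for i a
    by (rule H1_weak_partial_square_integrable[OF domain bH[OF that]])
  have ps: "square_integrable \<Omega> (partial i (p t))" if "t \<in> {0..T}" for t i
    by (rule smooth_evolution.square_integrable[OF p.partial_evolution that])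
  have pc: "continuous_on {0..T} (\<lambda>t. p t a)" if "a \<in> ?A" for a
  proof -
    have a: "a \<in> closure \<Omega>" using mesh.node_index(4)[OF that] triangulation(2) by blast
    have "continuous_on {0..T} (\<lambda>t. g\<^sub>p (t, a))"
      using p.sub a by (intro continuous_on_compose2[OF smooth_on_open_continuous_on[OF p.smooth]])
        (auto intro!: continuous_intros)
    then show ?thesis by (rule continuous_on_eq) (simp add: p_closure[OF _ a])
  qed
  have eq: "interp_err_sq t =
     (\<Sum>i\<in>UNIV. l2_inner \<Omega> (partial i (p t)) (partial i (p t))
        - 2 * (\<Sum>a\<in>?A. p t a * l2_inner \<Omega> (partial i (p t)) (?W i a))
        + (\<Sum>a\<in>?A. p t a * (\<Sum>b\<in>?A. p t b * l2_inner \<Omega> (?W i a) (?W i b))))" if t: "t \<in> {0..T}" for t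
  proof -
    have "l2_inner \<Omega> (weak_partial \<Omega> i (interp_err t)) (weak_partial \<Omega> i (interp_err t)) =
        l2_inner \<Omega> (partial i (p t)) (partial i (p t))
        - 2 * (\<Sum>a\<in>?A. p t a * l2_inner \<Omega> (partial i (p t)) (?W i a))
        + (\<Sum>a\<in>?A. p t a * (\<Sum>b\<in>?A. p t b * l2_inner \<Omega> (?W i a) (?W i b)))" for i
    proof -
      let ?z = "\<lambda>x. \<Sum>a\<in>?A. p t a *\<^sub>R ?W i a x"
      let ?q = "partial i (p t)"
      have q: "square_integrable \<Omega> ?q" by (rule ps[OF t])
      have z: "square_integrable \<Omega> ?z" using L2.sum_mem[of ?A "?W i" \<Omega> "p t"] Ws by auto
      have "is_weak_partial \<Omega> i (\<lambda>x. \<Sum>a\<in>?A. p t a * nodal_basis \<T> k a x) (\<lambda>x. \<Sum>a\<in>?A. p t a * ?W i a x)"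
        by (intro is_weak_partial_sum[OF domain] H1_is_weak_partial[OF domain] H1_square_integrable[OF domain] bH)
      moreover have "square_integrable \<Omega> (lagrange_interp \<T> k (p t))"
        using mesh.lagrange_space_H1[OF interp_mem open_domain bounded_domain convex_domain triangulation(2)]
        by (rule H1_square_integrable[OF domain])
      ultimately have "is_weak_partial \<Omega> i (interp_err t) (\<lambda>x. ?q x - ?z x)"
        unfolding interp_err_def using pressure_is_weak_partial[OF t] pressure_square_integrable(1)[OF t]
        by (intro is_weak_partial_diff[OF domain]) (simp_all add: lagrange_interp_def[abs_def])
      from weak_partial_ae_eq[OF domain this]
      have "l2_inner \<Omega> (weak_partial \<Omega> i (interp_err t)) (weak_partial \<Omega> i (interp_err t)) =
          l2_inner \<Omega> (\<lambda>x. ?q x - ?z x) (\<lambda>x. ?q x - ?z x)"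
        using H1_weak_partial_square_integrable[OF domain interp_err_H1[OF t]] square_integrable_diff[OF q z]
        by (intro l2_inner_cong_AE)
      also have "\<dots> = l2_inner \<Omega> ?q ?q - 2 * l2_inner \<Omega> ?q ?z + l2_inner \<Omega> ?z ?z"
      proof -
        have m: "?q \<in> Collect (square_integrable \<Omega>)" "?z \<in> Collect (square_integrable \<Omega>)"
          "(\<lambda>x. ?q x - ?z x) \<in> Collect (square_integrable \<Omega>)"
          using q z square_integrable_diff[OF q z] by simp_all
        show ?thesis
          using L2.ip_diff_left[OF m(1,2,3)] L2.ip_diff_right[OF m(1,2,1)] L2.ip_diff_right[OF m(1,2,2)]
            L2.ip_commute[OF m(1,2)] by linarith
      qed
      also have "l2_inner \<Omega> ?q ?z = (\<Sum>a\<in>?A. p t a * l2_inner \<Omega> ?q (?W i a))"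
        using Ws q by (intro L2.ip_sum_right) auto
      also have "l2_inner \<Omega> ?z ?z = (\<Sum>a\<in>?A. p t a * l2_inner \<Omega> (?W i a) ?z)"
        using Ws z by (intro L2.ip_sum_left) auto
      also have "\<dots> = (\<Sum>a\<in>?A. p t a * (\<Sum>b\<in>?A. p t b * l2_inner \<Omega> (?W i a) (?W i b)))"
      proof (rule sum.cong[OF refl])
        fix a assume "a \<in> ?A"
        then have "l2_inner \<Omega> (?W i a) ?z = (\<Sum>b\<in>?A. p t b * l2_inner \<Omega> (?W i a) (?W i b))"
          using Ws by (intro L2.ip_sum_right) auto
        then show "p t a * l2_inner \<Omega> (?W i a) ?z = p t a * (\<Sum>b\<in>?A. p t b * l2_inner \<Omega> (?W i a) (?W i b))" by simp
      qed
      finally show ?thesis .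
    qed
    then show ?thesis
      using weak_grad_square_integrable[OF domain interp_err_H1[OF t]]
      by (subst l2_inner_vec) (simp_all add: weak_grad_def)
  qed
  show ?thesis
  proof (rule continuous_on_eq)
    show "continuous_on {0..T} (\<lambda>t. \<Sum>i\<in>UNIV. l2_inner \<Omega> (partial i (p t)) (partial i (p t))
        - 2 * (\<Sum>a\<in>?A. p t a * l2_inner \<Omega> (partial i (p t)) (?W i a))
        + (\<Sum>a\<in>?A. p t a * (\<Sum>b\<in>?A. p t b * l2_inner \<Omega> (?W i a) (?W i b))))"
      using pc Ws
      by (intro continuous_intros smooth_evolution.continuous_on_l2_inner_self[OF p.partial_evolution]
          smooth_evolution.continuous_on_l2_inner[OF p.partial_evolution])
  qed (simp add: eq)
qed

text \<open>The factor \<open>2\<close> anticipates the derivative of the squared error. The viscous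
  term then supplies twice \<open>\<nu> * err_grad_sq t\<close>, of which one half absorbs the mixed
  term in Young's inequality.\<close>

lemma energy_inequality:
  assumes t: "t \<in> {0<..T}"
  shows "2 * (l2_inner \<Omega> (u\<^sub>h' t) (err t) - l2_inner \<Omega> (u.time_deriv t) (err t)) + \<nu> * err_grad_sq t
    \<le> (\<nu> * proj_diff_sq t
        + T * interp_err_sq t)
      + err_sq t / T"
proof -
  let ?e = "err t" and ?d = "proj_diff t" and ?w = "weak_grad \<Omega> (interp_err t)"
  have t': "t \<in> {0..T}" using t by simp
  have H: "?e \<in> H1_vec \<Omega>" "?d \<in> H1_vec \<Omega>" "Sh t \<in> H1_vec \<Omega>" "Ph t \<in> H1_vec \<Omega>" "u\<^sub>h t \<in> H1_vec \<Omega>"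
    using err_V0[OF t] proj_diff_V0[OF t'] Sh[OF t'] Ph[OF t'] u\<^sub>h_V0[OF t] V0_subset by auto
  have e: "square_integrable \<Omega> ?e" and w: "square_integrable \<Omega> ?w"
    using V0_square_integrable[OF err_V0[OF t]] weak_grad_square_integrable[OF domain interp_err_H1[OF t']] by auto
  have "grad_ip \<Omega> (Sh t) ?e - grad_ip \<Omega> (u\<^sub>h t) ?e = grad_ip \<Omega> ?d ?e - grad_ip \<Omega> ?e ?e"
    using H grad.ip_diff_left[of "Sh t" "Ph t" ?e] grad.ip_diff_left[of "u\<^sub>h t" "Ph t" ?e]
    by (simp add: proj_diff_def err_def)
  then have eq: "l2_inner \<Omega> (u\<^sub>h' t) ?e - l2_inner \<Omega> (u.time_deriv t) ?e =
      \<nu> * (grad_ip \<Omega> ?d ?e - grad_ip \<Omega> ?e ?e) + l2_inner \<Omega> ?w ?e"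
    using error_equation[OF t err_V0[OF t]] by (simp flip: right_diff_distrib)
  have "2 * grad_ip \<Omega> ?d ?e \<le> grad_ip \<Omega> ?d ?d + grad_ip \<Omega> ?e ?e"
  proof -
    have "0 \<le> grad_ip \<Omega> (\<lambda>x. ?d x + (-1) *\<^sub>R ?e x) (\<lambda>x. ?d x + (-1) *\<^sub>R ?e x)"
      using H by (intro grad.ip_nonneg grad.add_mem grad.scale_mem)
    then show ?thesis using grad.ip_scale_add_self[OF H(2,1), of "-1"] by simp
  qed
  then have 1: "\<nu> * (2 * grad_ip \<Omega> ?d ?e) \<le> \<nu> * (grad_ip \<Omega> ?d ?d + grad_ip \<Omega> ?e ?e)"
    using \<nu>_pos by (intro mult_left_mono) auto
  have 2: "2 * l2_inner \<Omega> ?w ?e \<le> T * l2_inner \<Omega> ?w ?w + l2_inner \<Omega> ?e ?e / T"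
  proof -
    \<comment> \<open>Expanding this square and multiplying by \<open>T\<close> gives Young's
      inequality with the weights \<open>T\<close> and \<open>1 / T\<close>.\<close>
    have "0 \<le> l2_inner \<Omega> (\<lambda>x. ?w x + (- (1 / T)) *\<^sub>R ?e x) (\<lambda>x. ?w x + (- (1 / T)) *\<^sub>R ?e x)"
      by (intro L2.ip_nonneg L2.add_mem L2.scale_mem) (use e w in simp_all)
    also have "\<dots> = l2_inner \<Omega> ?w ?w + 2 * (- (1 / T)) * l2_inner \<Omega> ?w ?e + (- (1 / T))\<^sup>2 * l2_inner \<Omega> ?e ?e"
      using e w by (intro L2.ip_scale_add_self) auto
    finally have "0 \<le> T * (l2_inner \<Omega> ?w ?w + 2 * (- (1 / T)) * l2_inner \<Omega> ?w ?e + (- (1 / T))\<^sup>2 * l2_inner \<Omega> ?e ?e)"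
      using T_pos by simp
    also have "\<dots> = T * l2_inner \<Omega> ?w ?w - 2 * l2_inner \<Omega> ?w ?e + l2_inner \<Omega> ?e ?e / T"
      using T_pos by (simp add: field_simps power2_eq_square)
    finally show ?thesis by simp
  qed
  show ?thesis unfolding eq using 1 2 by (simp add: algebra_simps)
qed

theorem error_estimate:
  "err_sq T + \<nu> * integral {0..T} err_grad_sq
    \<le> exp 1 * \<nu> * integral {0..T} proj_diff_sq
      + exp 1 * T * integral {0..T} interp_err_sq"
proof -
  let ?a = "\<lambda>t. \<nu> * proj_diff_sq t
        + T * interp_err_sq t"
  have "err_sq T + \<nu> * integral {0..T} err_grad_sq \<le> exp 1 * integral {0..T} ?a"
  proof (rule gronwall_energy[where E="\<lambda>t. err_sq t" and
        E'="\<lambda>t. 2 * (l2_inner \<Omega> (u\<^sub>h' t) (err t) - l2_inner \<Omega> (u.time_deriv t) (err t))"])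
    show "continuous_on {0..T} err_sq" by (rule continuous_err_l2)
    show "continuous_on {0..T} err_grad_sq" by (rule continuous_err_grad)
    show "continuous_on {0..T} ?a"
      by (intro continuous_intros continuous_proj_diff continuous_interp_err)
    show "err_sq 0 = 0" by (rule err_0(2))
    show "0 \<le> err_grad_sq t" if "t \<in> {0..T}" for t
      using err_V[OF that] V_subset by (intro grad.ip_nonneg) auto
    show "0 \<le> ?a t" if t: "t \<in> {0..T}" for t
    proof -
      have "0 \<le> proj_diff_sq t"
        using proj_diff_V0[OF t] V0_subset by (intro grad.ip_nonneg) auto
      moreover have "0 \<le> interp_err_sq t"
        using weak_grad_square_integrable[OF domain interp_err_H1[OF t]] by (intro L2.ip_nonneg) auto
      ultimately show ?thesis using T_pos \<nu>_pos by simp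
    qed
    fix t assume t: "0 < t" "t < T"
    then have t0: "t \<in> {0<..T}" and t': "t \<in> {0..T}" and t'': "t \<in> {0<..<T}" by auto
    show "2 * (l2_inner \<Omega> (u\<^sub>h' t) (err t) - l2_inner \<Omega> (u.time_deriv t) (err t)) + \<nu> * err_grad_sq t
        \<le> ?a t + err_sq t / T"
      by (rule energy_inequality[OF t0])
    have V: "err t \<in> V0" by (rule err_V0[OF t0])
    \<comment> \<open>Parseval with the error as second factor turns the derivative of the sum of
      squares back into a pairing with \<open>err t\<close>.\<close>
    have expand: "l2_inner \<Omega> w (err t) = (\<Sum>e\<in>l2_basis. coef e t * l2_inner \<Omega> w e)"
      if w: "square_integrable \<Omega> w" for w
    proof -
      have "l2_inner \<Omega> w (err t) = l2_inner \<Omega> (err t) w"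
        using w V0_square_integrable[OF V] by (intro L2.ip_commute) auto
      also have "\<dots> = (\<Sum>e\<in>l2_basis. l2_inner \<Omega> (err t) e * l2_inner \<Omega> e w)" by (rule l2_inner_l2_basis[OF V w])
      also have "\<dots> = (\<Sum>e\<in>l2_basis. coef e t * l2_inner \<Omega> w e)"
      proof (rule sum.cong[OF refl])
        fix e assume "e \<in> l2_basis"
        then have "e \<in> V0" by (rule l2_basis_V0)
        then show "l2_inner \<Omega> (err t) e * l2_inner \<Omega> e w = coef e t * l2_inner \<Omega> w e"
          using err_coef[OF t'] L2.ip_commute[of e \<Omega> w] V0_square_integrable w by simp
      qed
      finally show ?thesis .
    qed
    have us: "square_integrable \<Omega> (u\<^sub>h' t)" "square_integrable \<Omega> (u.time_deriv t)"
      using V_square_integrable[OF u\<^sub>h'_V[OF t0]] u.time_deriv_square_integrable[OF T_pos t'] by auto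
    \<comment> \<open>The derivative is taken of the finite sum of squared coefficients and
      transferred to \<open>err_sq\<close>, which equals that sum on the open time interval.\<close>
    have "((\<lambda>t. \<Sum>e\<in>l2_basis. (coef e t)\<^sup>2) has_real_derivative
        (\<Sum>e\<in>l2_basis. 2 * (coef e t * (l2_inner \<Omega> (u\<^sub>h' t) e - l2_inner \<Omega> (u.time_deriv t) e)))) (at t)"
    proof (rule DERIV_sum)
      fix e assume "e \<in> l2_basis"
      then have "e \<in> V0" by (rule l2_basis_V0)
      from coef_has_derivative[OF t'' this]
      show "((\<lambda>t. (coef e t)\<^sup>2) has_real_derivative
          2 * (coef e t * (l2_inner \<Omega> (u\<^sub>h' t) e - l2_inner \<Omega> (u.time_deriv t) e))) (at t)"
        by (auto intro!: derivative_eq_intros)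
    qed
    also have "(\<Sum>e\<in>l2_basis. 2 * (coef e t * (l2_inner \<Omega> (u\<^sub>h' t) e - l2_inner \<Omega> (u.time_deriv t) e))) =
        2 * (l2_inner \<Omega> (u\<^sub>h' t) (err t) - l2_inner \<Omega> (u.time_deriv t) (err t))"
      unfolding expand[OF us(1)] expand[OF us(2)]
      by (simp add: sum_distrib_left sum_subtractf right_diff_distrib)
    finally show "(err_sq has_real_derivative
        2 * (l2_inner \<Omega> (u\<^sub>h' t) (err t) - l2_inner \<Omega> (u.time_deriv t) (err t))) (at t)"
      by (rule has_field_derivative_transform_within_open[of _ _ _ "{0<..<T}"]) (use t in \<open>auto simp: err_l2\<close>)
  qed (use T_pos \<nu>_pos in auto)
  also have "integral {0..T} ?a = \<nu> * integral {0..T} proj_diff_sq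
      + T * integral {0..T} interp_err_sq"
    using integrable_continuous_interval[OF continuous_proj_diff] integrable_continuous_interval[OF continuous_interp_err]
    by (subst integral_add) (auto intro: integrable_on_mult_right)
  finally show ?thesis by (simp add: algebra_simps)
qed

end

theorem theorem2:
  fixes \<Omega> :: "(real^'n::finite) set"
    and \<T> :: "(real^'n) set set"
    and V\<^sub>h :: "(real^'n \<Rightarrow> real^'n) set" and Q\<^sub>h :: "(real^'n \<Rightarrow> real) set"
    and T \<nu> \<sigma> :: real and k :: nat
    and f u u\<^sub>h u\<^sub>h' e\<^sub>h :: "real \<Rightarrow> real^'n \<Rightarrow> real^'n"
    and p p\<^sub>h :: "real \<Rightarrow> real^'n \<Rightarrow> real"
    and u\<^sub>0 :: "real^'n \<Rightarrow> real^'n"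
  assumes "CARD('n) \<in> {2, 3}"
    and "convex_polytopal_domain \<Omega>"
    and "triangulation_of \<Omega> \<T>" and "shape_regular \<sigma> \<T>"
    and "T > 0" and "\<nu> > 0"
    and "smooth_stokes_solution \<Omega> T \<nu> f u\<^sub>0 u p"
    and "conforming_pair \<Omega> V\<^sub>h Q\<^sub>h" and "inf_sup_stable \<Omega> V\<^sub>h Q\<^sub>h"
    and "k \<ge> 1" and "contains_lagrange_space \<Omega> Q\<^sub>h \<T> k"
    and "semidiscrete_stokes_solution \<Omega> V\<^sub>h Q\<^sub>h T \<nu> f u\<^sub>0 u\<^sub>h u\<^sub>h' p\<^sub>h"
    and "e\<^sub>h = (\<lambda>t x. u\<^sub>h t x - helmholtz_proj \<Omega> V\<^sub>h Q\<^sub>h (u t) x)"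
  shows "(l2_norm \<Omega> (e\<^sub>h T))\<^sup>2 + \<nu> * integral {0..T} (\<lambda>t. (l2_norm \<Omega> (weak_Grad \<Omega> (e\<^sub>h t)))\<^sup>2)
    \<le> exp 1 * \<nu> * integral {0..T} (\<lambda>t. (l2_norm \<Omega> (weak_Grad \<Omega>
           (\<lambda>x. stokes_proj \<Omega> V\<^sub>h Q\<^sub>h (u t) x - helmholtz_proj \<Omega> V\<^sub>h Q\<^sub>h (u t) x)))\<^sup>2)
      + exp 1 * T * integral {0..T} (\<lambda>t. (l2_norm \<Omega> (weak_grad \<Omega>
           (\<lambda>x. p t x - lagrange_interp \<T> k (p t) x)))\<^sup>2)"
proof -
  have dom: "open \<Omega>" "bounded \<Omega>" "convex \<Omega>" "\<Omega> \<noteq> {}"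
    using assms(2) by (auto simp: convex_polytopal_domain_def)
  have tri: "triangulation \<T>" "\<Union>\<T> = closure \<Omega>"
    using assms(3) by (auto simp: triangulation_of_def)
  have "smooth_on ({0..T} \<times> closure \<Omega>) (\<lambda>(t, x). u t x)" "smooth_on ({0..T} \<times> closure \<Omega>) (\<lambda>(t, x). p t x)"
    using assms(7) by (auto simp: smooth_stokes_solution_def)
  \<comment> \<open>Smoothness on the closed cylinder means a smooth extension to a neighbourhood;
    the two extensions become parameters of the locale.\<close>
  then obtain Uu gu Up gp where
    U: "{0..T} \<times> closure \<Omega> \<subseteq> Uu" "smooth_on_open Uu gu" "\<And>z. z \<in> {0..T} \<times> closure \<Omega> \<Longrightarrow> (case z of (t, x) \<Rightarrow> u t x) = gu z" and
    P: "{0..T} \<times> closure \<Omega> \<subseteq> Up" "smooth_on_open Up gp" "\<And>z. z \<in> {0..T} \<times> closure \<Omega> \<Longrightarrow> (case z of (t, x) \<Rightarrow> p t x) = gp z"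
    unfolding smooth_on_def by blast
  have clos: "x \<in> closure \<Omega>" if "x \<in> \<Omega>" for x using that closure_subset by blast
  interpret semidiscrete_stokes \<Omega> \<T> k V\<^sub>h Q\<^sub>h T u Uu gu p Up gp \<nu> f u\<^sub>0 u\<^sub>h u\<^sub>h' p\<^sub>h
  proof
    show "u t x = gu (t, x)" if "t \<in> {0..T}" "x \<in> \<Omega>" for t x
      using U(3)[of "(t, x)"] that clos by simp
    show "p t x = gp (t, x)" if "t \<in> {0..T}" "x \<in> \<Omega>" for t x
      using P(3)[of "(t, x)"] that clos by simp
    show "p t x = gp (t, x)" if "t \<in> {0..T}" "x \<in> closure \<Omega>" for t x
      using P(3)[of "(t, x)"] that by simp
  qed (use dom tri U P assms in simp_all)
  show ?thesis
    using error_estimate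
    unfolding l2_norm_power2 grad_ip_def err_def proj_diff_def interp_err_def assms(13) .
qed

end
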